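(* Let $A$ be an invertible commuting variable, let $i^2=-1$, and let $Z(K)$ be the tensor evaluation of an unoriented virtual link diagram $K$ in the plane determined by the matrices, with indices in $\{1,2\}$, $$(M_{ab}) = (M^{ab}) = \begin{pmatrix} 0 & iA\\ -iA^{-1} & 0\end{pmatrix},\quad R^{ab}_{cd} = A\,M^{ab}M_{cd}+A^{-1}\delta^a_c\delta^b_d,\quad \overline{R}^{ab}_{cd} = A^{-1}M^{ab}M_{cd}+A\,\delta^a_c\delta^b_d,\quad V^{ab}_{cd}=\delta^a_d\delta^b_c .$$ Then the invariant of virtual regular isotopy $Z(K)$ is described by the state summation $$Z(K) = \sum_{S}\langle K|S\rangle\prod_{C\in S} d(C),$$ where $S$ runs over all states of $K$, $\langle K|S\rangle$ is the product of the vertex weights of $S$, $C\in S$ means that $C$ is one of the curves in $S$, and $$d(C) = (-1)^{rot(C)}\left(A^{2\,rot(C)}+A^{-2\,rot(C)}\right).$$ Moreover $Z(K)$ reduces to $d\langle K\rangle$ when $K$ is a classical diagram, where $d=-A^2-A^{-2}$ and $\langle K\rangle$ is the bracket polynomial.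
   Context: A virtual link diagram is a generic immersion of circles in the plane whose double points are marked as classical crossings (with over/under information) or virtual crossings. Virtual regular isotopy (rotational) is the equivalence generated by planar isotopy, classical Reidemeister moves II and III, virtual Reidemeister moves II and III, and the mixed move in which an arc with two consecutive virtual crossings passes across a classical crossing; neither the classical nor the virtual Reidemeister move I is included. Tensor evaluation: put $K$ in general position with respect to a vertical direction, so that it is composed of maxima, minima, classical crossings and virtual crossings joined by arcs without vertical critical points. Label the arcs between these elementary pieces by indices. To a maximum with left leg $a$ and right leg $b$ assign $M_{ab}$; to a minimum with left end $a$ and right end $b$ assign $M^{ab}$; to a crossing with upper ends $a,b$ (left, right) and lower ends $c,d$ (left, right) assign $R^{ab}_{cd}$ if the over-strand runs from lower right to upper left, $\overline{R}^{ab}_{cd}$ if the over-strand runs from lower left to upper right, and $V^{ab}_{cd}=\delta^a_d\delta^b_c$ if the crossing is virtual. Here $\delta$ is the Kronecker delta. $Z(K)$ is the sum over all assignments of indices in $\{1,2\}$ of the product of the corresponding matrix entries. A state $S$ of $K$ is obtained by smoothing each classical crossing in one of two ways. The $A$-smoothing (weight $A$) joins the two regions swept out when the over-strand is rotated counterclockwise to the under-strand; the other smoothing has weight $A^{-1}$. $\langle K|S\rangle$ is the product of these weights. The result is a collection of closed plane curves having only virtual crossings; each individual curve $C$ is viewed as an immersion of a circle in the plane, and $rot(C)$ denotes the absolute value of its Whitney degree (total algebraic number of $2\pi$ turns of the unit tangent vector as the curve is traversed once). The bracket polynomial is $\langle K\rangle=\sum_S\langle K|S\rangle d^{\|S\|-1}$,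 where $\|S\|$ is the number of curves in $S$ and $d=-A^2-A^{-2}$. *)

theory Defs
  imports "HOL-Complex_Analysis.Complex_Analysis"
begin

section \<open>Virtual link diagrams in general position\<close>

text \<open>
  A diagram in general position with respect to the vertical direction is read from bottom to top
  as a list of horizontal slices, each containing one elementary piece.  A slice is the piece
  together with the number of strands running through the slice on the left of the piece, so the
  strands taking part in the piece are those at positions \<open>i\<close> and \<open>i + 1\<close>, counted from 0.
  In \<open>Over_NW\<close> the over-strand runs from lower right to upper left, in \<open>Over_NE\<close> from
  lower left to upper right.
\<close>

datatype piece = Maximum | Minimum | Over_NW | Over_NE | Virtual

type_synonym slice = "piece \<times> nat"

fun ins :: "piece \<Rightarrow> nat" where
  "ins Minimum = 0"
| "ins _ = 2"

fun outs :: "piece \<Rightarrow> nat" where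
  "outs Maximum = 0"
| "outs _ = 2"

text \<open>\<open>width K n\<close> is the number of strands at level \<open>n\<close>, that is, below slice \<open>n\<close>.\<close>

fun width :: "slice list \<Rightarrow> nat \<Rightarrow> nat" where
  "width K 0 = 0"
| "width K (Suc n) = width K n - ins (fst (K ! n)) + outs (fst (K ! n))"

definition diagram :: "slice list \<Rightarrow> bool" where
  "diagram K \<longleftrightarrow>
     (\<forall>n < length K. snd (K ! n) + ins (fst (K ! n)) \<le> width K n) \<and> width K (length K) = 0"

definition is_classical :: "piece \<Rightarrow> bool" where
  "is_classical p \<longleftrightarrow> p = Over_NW \<or> p = Over_NE"

definition is_crossing :: "piece \<Rightarrow> bool" where
  "is_crossing p \<longleftrightarrow> is_classical p \<or> p = Virtual"

definition classical_crossings :: "slice list \<Rightarrow> nat set" where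
  "classical_crossings K = {n. n < length K \<and> is_classical (fst (K ! n))}"

definition classical_diagram :: "slice list \<Rightarrow> bool" where
  "classical_diagram K \<longleftrightarrow> diagram K \<and> Virtual \<notin> fst ` set K"

text \<open>The point \<open>(n, j)\<close> is the place where strand number \<open>j\<close> crosses level \<open>n\<close>.\<close>

definition points :: "slice list \<Rightarrow> (nat \<times> nat) set" where
  "points K = (SIGMA n : {..length K}. {..<width K n})"

text \<open>
  For a slice of lower width \<open>w\<close>: the pairs (lower position, upper position) of the strands
  that pass the piece on its left or on its right.
\<close>

fun through :: "slice \<Rightarrow> nat \<Rightarrow> (nat \<times> nat) set" where
  "through (p, i) w =
     {(j, j) | j. j < i} \<union> {(j + ins p, j + outs p) | j. i \<le> j \<and> j + ins p < w}"


section \<open>Tensor evaluation\<close>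

text \<open>
  An arc joining two elementary pieces may run through several slices; a labelling of the arcs is
  a labelling of the points which is constant along the strands that pass by a piece.
\<close>

definition labellings :: "slice list \<Rightarrow> (nat \<times> nat \<Rightarrow> nat) set" where
  "labellings K = {l \<in> points K \<rightarrow>\<^sub>E {1, 2}.
     \<forall>n < length K. \<forall>(j, j') \<in> through (K ! n) (width K n). l (n, j) = l (Suc n, j')}"

type_synonym 'a matrix2 = "nat \<Rightarrow> nat \<Rightarrow> 'a"
type_synonym 'a matrix4 = "nat \<Rightarrow> nat \<Rightarrow> nat \<Rightarrow> nat \<Rightarrow> 'a"

text \<open>
  The matrices are \<open>ML = M\<^sub>a\<^sub>b\<close>, \<open>MU = M\<^sup>a\<^sup>b\<close> and, with the arguments in the order
  upper left, upper right, lower left, lower right, the crossing matrices \<open>R\<close> (\<open>Over_NW\<close>),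
  \<open>Rb\<close> (\<open>Over_NE\<close>) and \<open>V\<close>.
\<close>

fun entry ::
  "'a matrix2 \<Rightarrow> 'a matrix2 \<Rightarrow> 'a matrix4 \<Rightarrow> 'a matrix4 \<Rightarrow> 'a matrix4
     \<Rightarrow> (nat \<times> nat \<Rightarrow> nat) \<Rightarrow> nat \<Rightarrow> slice \<Rightarrow> 'a" where
  "entry ML MU R Rb V l n (Maximum, i) = ML (l (n, i)) (l (n, i + 1))"
| "entry ML MU R Rb V l n (Minimum, i) = MU (l (Suc n, i)) (l (Suc n, i + 1))"
| "entry ML MU R Rb V l n (Over_NW, i) =
     R (l (Suc n, i)) (l (Suc n, i + 1)) (l (n, i)) (l (n, i + 1))"
| "entry ML MU R Rb V l n (Over_NE, i) =
     Rb (l (Suc n, i)) (l (Suc n, i + 1)) (l (n, i)) (l (n, i + 1))"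
| "entry ML MU R Rb V l n (Virtual, i) =
     V (l (Suc n, i)) (l (Suc n, i + 1)) (l (n, i)) (l (n, i + 1))"

definition tensor_evaluation ::
  "'a::comm_ring_1 matrix2 \<Rightarrow> 'a matrix2 \<Rightarrow> 'a matrix4 \<Rightarrow> 'a matrix4 \<Rightarrow> 'a matrix4
     \<Rightarrow> slice list \<Rightarrow> 'a" where
  "tensor_evaluation ML MU R Rb V K =
     (\<Sum>l \<in> labellings K. \<Prod>n < length K. entry ML MU R Rb V l n (K ! n))"

definition kdelta :: "'a::comm_ring_1 matrix2" where
  "kdelta a b = (if a = b then 1 else 0)"

text \<open>In the following, \<open>B\<close> stands for the inverse of \<open>A\<close>, and \<open>\<iota>\<close> for the square root of -1.\<close>

definition M_mat :: "'a::comm_ring_1 \<Rightarrow> 'a \<Rightarrow> 'a \<Rightarrow> 'a matrix2" where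
  "M_mat A B \<iota> a b =
     (if a = 1 \<and> b = 2 then \<iota> * A else if a = 2 \<and> b = 1 then - \<iota> * B else 0)"

definition R_mat :: "'a::comm_ring_1 \<Rightarrow> 'a \<Rightarrow> 'a \<Rightarrow> 'a matrix4" where
  "R_mat A B \<iota> a b c d =
     A * M_mat A B \<iota> a b * M_mat A B \<iota> c d + B * kdelta a c * kdelta b d"

definition Rbar_mat :: "'a::comm_ring_1 \<Rightarrow> 'a \<Rightarrow> 'a \<Rightarrow> 'a matrix4" where
  "Rbar_mat A B \<iota> a b c d =
     B * M_mat A B \<iota> a b * M_mat A B \<iota> c d + A * kdelta a c * kdelta b d"

definition V_mat :: "'a::comm_ring_1 matrix4" where
  "V_mat a b c d = kdelta a d * kdelta b c"

definition Z :: "'a::comm_ring_1 \<Rightarrow> 'a \<Rightarrow> 'a \<Rightarrow> slice list \<Rightarrow> 'a" where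
  "Z A B \<iota> = tensor_evaluation (M_mat A B \<iota>) (M_mat A B \<iota>) (R_mat A B \<iota>) (Rbar_mat A B \<iota>) V_mat"


section \<open>Virtual regular isotopy\<close>

text \<open>Moving a strand across a maximum or minimum exchanges the two crossing types.\<close>

fun turned :: "piece \<Rightarrow> piece" where
  "turned Over_NW = Over_NE"
| "turned Over_NE = Over_NW"
| "turned p = p"

text \<open>
  Planar isotopies of diagrams in general position are generated by the first five rules:
  exchanging the heights of two pieces lying side by side, cancelling a maximum against a minimum,
  and moving a strand that crosses one leg of a maximum or minimum over to the other leg.

  In \<open>[(x, i), (y, i + 1), (z, i)]\<close> the crossings \<open>x\<close>, \<open>y\<close>, \<open>z\<close> are those of the strands
  1 and 2, 1 and 3, 2 and 3 (numbered from the left at the bottom), and so are they in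
  \<open>[(z, i + 1), (y, i), (x, i + 1)]\<close>. Three classical crossings admit the third Reidemeister move
  iff one strand lies over the two others, i.e. unless \<open>x = z \<noteq> y\<close>.
\<close>

inductive local_move :: "slice list \<Rightarrow> slice list \<Rightarrow> bool" where
  exchange: "local_move [(p, i), (q, i + outs p + k)] [(q, i + ins p + k), (p, i)]"
| cancel_right: "local_move [(Minimum, i), (Maximum, i + 1)] []"
| cancel_left: "local_move [(Minimum, i + 1), (Maximum, i)] []"
| across_maximum: "is_crossing x \<Longrightarrow>
    local_move [(x, i), (Maximum, i + 1)] [(turned x, i + 1), (Maximum, i)]"
| across_minimum: "is_crossing x \<Longrightarrow>
    local_move [(Minimum, i + 1), (x, i)] [(Minimum, i), (turned x, i + 1)]"
| reidemeister_2: "is_classical x \<Longrightarrow> local_move [(x, i), (turned x, i)] []"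
| reidemeister_3: "\<lbrakk>is_classical x; is_classical y; is_classical z; \<not> (x = z \<and> x \<noteq> y)\<rbrakk> \<Longrightarrow>
    local_move [(x, i), (y, i + 1), (z, i)] [(z, i + 1), (y, i), (x, i + 1)]"
| virtual_2: "local_move [(Virtual, i), (Virtual, i)] []"
| virtual_3: "local_move
    [(Virtual, i), (Virtual, i + 1), (Virtual, i)] [(Virtual, i + 1), (Virtual, i), (Virtual, i + 1)]"
| mixed_12: "is_classical x \<Longrightarrow> local_move
    [(x, i), (Virtual, i + 1), (Virtual, i)] [(Virtual, i + 1), (Virtual, i), (x, i + 1)]"
| mixed_13: "is_classical y \<Longrightarrow> local_move
    [(Virtual, i), (y, i + 1), (Virtual, i)] [(Virtual, i + 1), (y, i), (Virtual, i + 1)]"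
| mixed_23: "is_classical z \<Longrightarrow> local_move
    [(Virtual, i), (Virtual, i + 1), (z, i)] [(z, i + 1), (Virtual, i), (Virtual, i + 1)]"

inductive move :: "slice list \<Rightarrow> slice list \<Rightarrow> bool" where
  "\<lbrakk>local_move L L'; diagram (X @ L @ Y); diagram (X @ L' @ Y)\<rbrakk> \<Longrightarrow> move (X @ L @ Y) (X @ L' @ Y)"

definition virtual_regular_isotopic :: "slice list \<Rightarrow> slice list \<Rightarrow> bool" where
  "virtual_regular_isotopic = equivclp move"


section \<open>States\<close>

text \<open>
  The upper end of the over-strand of \<open>Over_NW\<close> points north-west; turned counterclockwise to the
  under-strand, the over-strand sweeps out the regions to the west and to the east of the crossing.
  Joining these leaves a maximum below a minimum.  For \<open>Over_NE\<close> the regions to the north and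
  to the south are swept out, and joining them leaves two vertical strands, so that the slice
  contains no piece any more.  The flag tells whether the smoothing is the \<open>A\<close>-smoothing.
\<close>

fun smooth :: "bool \<Rightarrow> slice \<Rightarrow> slice list" where
  "smooth a (Over_NW, i) = (if a then [(Maximum, i), (Minimum, i)] else [])"
| "smooth a (Over_NE, i) = (if a then [] else [(Maximum, i), (Minimum, i)])"
| "smooth a s = [s]"

text \<open>A state of \<open>K\<close> is given by the set \<open>S\<close> of the classical crossings that are \<open>A\<close>-smoothed.\<close>

definition states :: "slice list \<Rightarrow> nat set set" where
  "states K = Pow (classical_crossings K)"

definition smoothed :: "slice list \<Rightarrow> nat set \<Rightarrow> slice list" where
  "smoothed K S = concat (map (\<lambda>n. smooth (n \<in> S) (K ! n)) [0..<length K])"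

definition state_weight :: "'a::comm_ring_1 \<Rightarrow> 'a \<Rightarrow> slice list \<Rightarrow> nat set \<Rightarrow> 'a" where
  "state_weight A B K S = (\<Prod>n \<in> classical_crossings K. if n \<in> S then A else B)"


section \<open>The plane curves of a diagram and their Whitney degrees\<close>

text \<open>
  A diagram is drawn in the plane with slice \<open>n\<close> in the strip between the heights \<open>n\<close> and \<open>n + 1\<close>
  and with the point \<open>(n, j)\<close> at \<open>Complex j n\<close>.  The pieces are immersed arcs whose
  velocity at the two ends is vertical of length 1, so that arcs with a common end fit together
  to continuously differentiable immersed curves.
\<close>

definition ease :: "real \<Rightarrow> real" where
  "ease t = 3 * t ^ 2 - 2 * t ^ 3"

definition strand_arc :: "nat \<Rightarrow> nat \<Rightarrow> nat \<Rightarrow> real \<Rightarrow> complex" where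
  "strand_arc n j j' t = Complex (real j + (real j' - real j) * ease t) (real n + t)"

definition maximum_arc :: "nat \<Rightarrow> nat \<Rightarrow> real \<Rightarrow> complex" where
  "maximum_arc n i t = Complex (real i + ease t) (real n + t * (1 - t))"

definition minimum_arc :: "nat \<Rightarrow> nat \<Rightarrow> real \<Rightarrow> complex" where
  "minimum_arc n i t = Complex (real i + ease t) (real (Suc n) - t * (1 - t))"

fun piece_arcs :: "nat \<Rightarrow> slice \<Rightarrow> (real \<Rightarrow> complex) set" where
  "piece_arcs n (Maximum, i) = {maximum_arc n i}"
| "piece_arcs n (Minimum, i) = {minimum_arc n i}"
| "piece_arcs n (_, i) = {strand_arc n i (i + 1), strand_arc n (i + 1) i}"

definition arcs :: "slice list \<Rightarrow> (real \<Rightarrow> complex) set" where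
  "arcs K = (\<Union>n < length K. piece_arcs n (K ! n) \<union>
     {strand_arc n j j' | j j'. (j, j') \<in> through (K ! n) (width K n)})"

definition directed_arcs :: "slice list \<Rightarrow> (real \<Rightarrow> complex) set" where
  "directed_arcs K = arcs K \<union> reversepath ` arcs K"

text \<open>
  Exactly two arcs end at each point \<open>(n, j)\<close>, one above and one below; hence a closed chain of
  arcs without repetition runs once along one of the curves of the diagram.
\<close>

definition traversal :: "slice list \<Rightarrow> (real \<Rightarrow> complex) list \<Rightarrow> bool" where
  "traversal K gs \<longleftrightarrow> gs \<noteq> [] \<and> set gs \<subseteq> directed_arcs K \<and> distinct (map path_image gs) \<and>
     (\<forall>m < length gs. pathfinish (gs ! m) = pathstart (gs ! (Suc m mod length gs)))"

text \<open>The arcs in the list are run through one after the other, each in time \<open>1 / length gs\<close>.\<close>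

definition joined :: "(real \<Rightarrow> complex) list \<Rightarrow> real \<Rightarrow> complex" where
  "joined gs t =
     (let k = length gs; m = min (nat \<lfloor>real k * t\<rfloor>) (k - 1) in (gs ! m) (real k * t - real m))"

definition whitney_degree :: "(real \<Rightarrow> complex) \<Rightarrow> complex" where
  "whitney_degree c = winding_number (\<lambda>t. sgn (vector_derivative c (at t within {0..1}))) 0"

definition curves :: "slice list \<Rightarrow> complex set set" where
  "curves K = {path_image (joined gs) | gs. traversal K gs}"

definition rot :: "slice list \<Rightarrow> complex set \<Rightarrow> nat" where
  "rot K C = (THE r. \<exists>gs. traversal K gs \<and> path_image (joined gs) = C \<and>
     real r = cmod (whitney_degree (joined gs)))"


section \<open>State sums\<close>

definition curve_value :: "'a::comm_ring_1 \<Rightarrow> 'a \<Rightarrow> nat \<Rightarrow> 'a" where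
  "curve_value A B r = (-1) ^ r * (A ^ (2 * r) + B ^ (2 * r))"

definition rotational_state_sum :: "'a::comm_ring_1 \<Rightarrow> 'a \<Rightarrow> slice list \<Rightarrow> 'a" where
  "rotational_state_sum A B K = (\<Sum>S \<in> states K. state_weight A B K S *
     (\<Prod>C \<in> curves (smoothed K S). curve_value A B (rot (smoothed K S) C)))"

definition loop_value :: "'a::comm_ring_1 \<Rightarrow> 'a \<Rightarrow> 'a" where
  "loop_value A B = - (A ^ 2) - B ^ 2"

definition bracket :: "'a::comm_ring_1 \<Rightarrow> 'a \<Rightarrow> slice list \<Rightarrow> 'a" where
  "bracket A B K = (\<Sum>S \<in> states K. state_weight A B K S *
     loop_value A B ^ (card (curves (smoothed K S)) - 1))"

end

theory Submission
  imports Defs "HOL-Combinatorics.Cycles"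
begin

text \<open>
  The evaluation is linear in every crossing, and the crossing matrices are combinations
  \<open>A M M + B \<delta> \<delta>\<close> of the two smoothings. Hence \<open>Z\<close> is the sum over all states of the weight of
  the state times the evaluation of the smoothed diagram (\<open>Z_state_expansion\<close>), and everything
  depends on diagrams that consist of maxima, minima and virtual crossings.

  In such a diagram read the label 1 as upwards and 2 as downwards. The matrix \<open>V\<close> passes
  labels along the strands, and \<open>M\<close> vanishes unless the labels change at an extremum, where the
  direction of travel changes too. So a labelling with non-zero product is the same thing as an
  orientation of every curve (\<open>bij_betw_coherent\<close>). An oriented extremum contributes \<open>\<iota> A\<close> if it is
  passed clockwise and the inverse \<open>- \<iota> B\<close> otherwise. A curve with \<open>h\<close> half turns therefore
  contributes \<open>(\<iota> A) ^ (- h) + (\<iota> A) ^ h\<close>, one summand for each orientation, and the product over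
  the curves is the evaluation (\<open>Z_eq_prod_curves\<close>). It remains to see that \<open>\<bar>h\<bar>\<close> is twice the
  rotation number. A traversal of a plane curve of the diagram is a cycle of the permutation that
  takes a point with a direction of travel to the next one (\<open>traversal_imp_cyc\<close>), and the winding
  number of the unit tangent is the sum of its values on the single arcs, which are 0 or a half
  (\<open>whitney_degree_joined\<close>, \<open>rot_curve_of\<close>).

  For a classical diagram the states are embedded circles, of rotation number 1. This case of the
  theorem of turning tangents is derived from the evaluation itself (\<open>rot_planar\<close>): a diagram of
  maxima and minima reduces to circles by moves, so that over the complex numbers the product over
  its curves is a power of \<open>- A\<^sup>2 - A ^ (- 2)\<close> for every value of \<open>A\<close>, and suitable values of \<open>A\<close>
  leave no rotation number but 1.

  Invariance is an identity between linear maps for every local move. For this the sum over all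
  labellings is arranged as a composite of one map for each slice (\<open>Z_eq_transfer\<close>).
\<close>

section \<open>The tensor evaluation as a composite of linear maps\<close>

definition words :: "nat \<Rightarrow> nat list set" where
  "words k = {xs. set xs \<subseteq> {1, 2} \<and> length xs = k}"

lemma finite_words: "finite (words k)"
  unfolding words_def by (rule finite_lists_length_eq) simp

lemma words_0: "words 0 = {[]}"
  by (auto simp: words_def)

lemma words_2: "words 2 = {[1, 1], [1, 2], [2, 1], [2, 2]}"
  by (auto simp: words_def numeral_2_eq_2 length_Suc_conv)

lemma sum_words_2: "(\<Sum>xs\<in>words 2. f xs) = f [1, 1] + f [1, 2] + f [2, 1] + f [2, 2]"
  by (simp add: words_2 add.assoc)

text \<open>
  As one equation between the words below and above a slice, the conditions on the labels of the
  passing strands allow the sum over all labellings to be taken level by level.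
\<close>
lemma through_iff_word:
  assumes "i + ins p \<le> w"
  shows "(\<forall>(j, j') \<in> through (p, i) w. f j = g j') \<longleftrightarrow>
    map f [0..<w] = take i (map g [0..<w - ins p + outs p])
      @ map (\<lambda>j. f (i + j)) [0..<ins p] @ drop (i + outs p) (map g [0..<w - ins p + outs p])"
    (is "?L \<longleftrightarrow> map f [0..<w] = ?rhs")
proof -
  let ?w' = "w - ins p + outs p"
  have min: "min ?w' i = i" using assms by simp
  then have len: "length ?rhs = w"
    using assms by simp
  have nth: "?rhs ! j = (if j < i then g j else if j < i + ins p then f j else g (j - ins p + outs p))"
    if "j < w" for j
  proof -
    consider "j < i" | "i \<le> j" "j < i + ins p" | "i + ins p \<le> j" by linarith
    then show ?thesis
    proof cases
      case 3
      then have "i + outs p + (j - (i + ins p)) = j - ins p + outs p" by simp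
      then show ?thesis using 3 assms that min by (auto simp: nth_append)
    qed (use assms that min in \<open>auto simp: nth_append\<close>)
  qed
  have "map f [0..<w] = ?rhs \<longleftrightarrow> (\<forall>j<w. f j = ?rhs ! j)"
    using len by (auto simp: list_eq_iff_nth_eq)
  also have "\<dots> \<longleftrightarrow> ?L"
  proof
    assume *: "\<forall>j<w. f j = ?rhs ! j"
    have "f j = g j" if "j < i" for j
      using * nth[of j] that assms by simp
    moreover have "f (j + ins p) = g (j + outs p)" if "i \<le> j" "j + ins p < w" for j
      using *[rule_format, of "j + ins p"] nth[of "j + ins p"] that assms by simp
    ultimately show ?L by auto
  next
    assume L: ?L
    show "\<forall>j<w. f j = ?rhs ! j"
    proof (intro allI impI)
      fix j assume j: "j < w"
      show "f j = ?rhs ! j"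
      proof (cases "j < i + ins p")
        case True
        then show ?thesis using L nth[OF j] by auto
      next
        case False
        then have "(j, j - ins p + outs p) \<in> through (p, i) w"
          using j by (auto intro!: exI[of _ "j - ins p"])
        then show ?thesis using L nth[OF j] False by auto
      qed
    qed
  qed
  finally show ?thesis by simp
qed

text \<open>
  The condition that a list of slices can be stacked on \<open>w\<close> strands. Unlike the description by
  positions in \<open>diagram\<close> it splits along concatenation, as moves and smoothings require.
\<close>
fun fits :: "nat \<Rightarrow> slice list \<Rightarrow> nat \<Rightarrow> bool" where
  "fits w [] w' \<longleftrightarrow> w' = w"
| "fits w (s # K) w' \<longleftrightarrow>
     snd s + ins (fst s) \<le> w \<and> fits (w - ins (fst s) + outs (fst s)) K w'"

lemma fits_append: "fits w (K @ L) w' \<longleftrightarrow> (\<exists>u. fits w K u \<and> fits u L w')"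
  by (induction K arbitrary: w) auto

lemma width_append: "n \<le> length K \<Longrightarrow> width (K @ L) n = width K n"
  by (induction n) (auto simp: nth_append)

lemma fits_iff_width:
  "fits 0 K w' \<longleftrightarrow>
    (\<forall>n < length K. snd (K ! n) + ins (fst (K ! n)) \<le> width K n) \<and> width K (length K) = w'"
proof (induction K arbitrary: w' rule: rev_induct)
  case Nil
  then show ?case by auto
next
  case (snoc s K)
  have "(\<forall>n < length (K @ [s]). snd ((K @ [s]) ! n) + ins (fst ((K @ [s]) ! n)) \<le> width (K @ [s]) n) \<longleftrightarrow>
    (\<forall>n < length K. snd (K ! n) + ins (fst (K ! n)) \<le> width K n) \<and>
     snd s + ins (fst s) \<le> width K (length K)"
    by (auto simp: less_Suc_eq nth_append width_append)
  then show ?case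
    by (auto simp: fits_append snoc width_append)
qed

lemma diagram_iff_fits: "diagram K \<longleftrightarrow> fits 0 K 0"
  by (simp add: diagram_def fits_iff_width)

locale bracket_ring =
  fixes A B \<iota> :: "'a::comm_ring_1"
  assumes AB: "A * B = 1" and \<iota>_square: "\<iota> * \<iota> = -1"
begin

fun weight :: "piece \<Rightarrow> nat list \<Rightarrow> nat list \<Rightarrow> 'a" where
  "weight Maximum us ls = M_mat A B \<iota> (ls ! 0) (ls ! 1)"
| "weight Minimum us ls = M_mat A B \<iota> (us ! 0) (us ! 1)"
| "weight Over_NW us ls = R_mat A B \<iota> (us ! 0) (us ! 1) (ls ! 0) (ls ! 1)"
| "weight Over_NE us ls = Rbar_mat A B \<iota> (us ! 0) (us ! 1) (ls ! 0) (ls ! 1)"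
| "weight Virtual us ls = V_mat (us ! 0) (us ! 1) (ls ! 0) (ls ! 1)"

text \<open>
  The linear map of a slice between tensor powers of the free module of rank 2, in coordinates:
  vectors are functions of words.
\<close>
definition slice_op :: "slice \<Rightarrow> (nat list \<Rightarrow> 'a) \<Rightarrow> nat list \<Rightarrow> 'a" where
  "slice_op s v us = (case s of (p, i) \<Rightarrow> \<Sum>ls\<in>words (ins p).
     weight p (take (outs p) (drop i us)) ls * v (take i us @ ls @ drop (i + outs p) us))"

abbreviation transfer :: "slice list \<Rightarrow> (nat list \<Rightarrow> 'a) \<Rightarrow> nat list \<Rightarrow> 'a" where
  "transfer \<equiv> fold slice_op"

definition unit_vector :: "nat list \<Rightarrow> 'a" where
  "unit_vector us = (if us = [] then 1 else 0)"

abbreviation local_entry :: "(nat \<times> nat \<Rightarrow> nat) \<Rightarrow> nat \<Rightarrow> slice \<Rightarrow> 'a" where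
  "local_entry \<equiv> entry (M_mat A B \<iota>) (M_mat A B \<iota>) (R_mat A B \<iota>) (Rbar_mat A B \<iota>) V_mat"

lemma entry_eq_weight:
  "local_entry l n (p, i) =
     weight p (map (\<lambda>j. l (Suc n, i + j)) [0..<outs p]) (map (\<lambda>j. l (n, i + j)) [0..<ins p])"
  by (cases p) (simp_all add: numeral_2_eq_2)

definition partial_labellings :: "slice list \<Rightarrow> nat \<Rightarrow> (nat \<times> nat \<Rightarrow> nat) set" where
  "partial_labellings K n = {l \<in> (SIGMA m : {..n}. {..<width K m}) \<rightarrow>\<^sub>E {1, 2}.
     \<forall>m < n. \<forall>(j, j') \<in> through (K ! m) (width K m). l (m, j) = l (Suc m, j')}"

definition level_word :: "slice list \<Rightarrow> (nat \<times> nat \<Rightarrow> nat) \<Rightarrow> nat \<Rightarrow> nat list" where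
  "level_word K l n = map (\<lambda>j. l (n, j)) [0..<width K n]"

text \<open>
  Since the labels of the passing strands are carried over, a labelling up to the next level
  with a given word at the top is a labelling up to the present level together with the labels at
  the lower ends of the piece. This gives one more linear map.
\<close>
lemma sum_partial_labellings:
  assumes "\<And>m. m < length K \<Longrightarrow> snd (K ! m) + ins (fst (K ! m)) \<le> width K m"
    and "n \<le> length K" "us \<in> words (width K n)"
  shows "(\<Sum>l | l \<in> partial_labellings K n \<and> level_word K l n = us. \<Prod>m<n. local_entry l m (K ! m)) =
    transfer (take n K) unit_vector us"
  using assms(2,3)
proof (induction n arbitrary: us)
  case 0
  have "{l. l \<in> partial_labellings K 0 \<and> level_word K l 0 = us} = {\<lambda>_. undefined}"
    using 0 by (auto simp: partial_labellings_def level_word_def words_def Sigma_def)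
  then show ?case
    using 0 by (simp add: words_def unit_vector_def)
next
  case (Suc n)
  obtain p i where pi: "K ! n = (p, i)" by force
  define w where "w = width K n"
  define w' where "w' = w - ins p + outs p"
  have w': "width K (Suc n) = w'" using pi by (simp add: w'_def w_def)
  have iw: "i + ins p \<le> w" using assms(1)[of n] Suc.prems pi by (simp add: w_def)
  have len: "length us = w'" and us12: "set us \<subseteq> {1, 2}" using Suc.prems w' by (auto simp: words_def)
  define low where "low ls = take i us @ ls @ drop (i + outs p) us" for ls
  have low: "low ls \<in> words w" if "ls \<in> words (ins p)" for ls
    using that us12 iw len
    by (auto simp: words_def low_def w'_def dest: in_set_takeD in_set_dropD)
  define P where "P l = (\<Prod>m<n. local_entry l m (K ! m))" for l
  define f where "f l = map (\<lambda>j. l (n, i + j)) [0..<ins p]" for l :: "nat \<times> nat \<Rightarrow> nat"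
  define D where "D = (SIGMA m : {..n}. {..<width K m})"
  have D': "(SIGMA m : {..Suc n}. {..<width K m}) = D \<union> {Suc n} \<times> {..<w'}"
    using w' by (auto simp: D_def le_Suc_eq)
  \<comment> \<open>The labelling of one more level whose word there is \<open>us\<close>.\<close>
  define ext where "ext l = (\<lambda>(m, j). if m \<le> n then l (m, j) else if m = Suc n \<and> j < w' then us ! j else undefined)"
    for l :: "nat \<times> nat \<Rightarrow> nat"
  have thr: "(\<forall>(j, j') \<in> through (p, i) w. l (n, j) = l' (Suc n, j')) \<longleftrightarrow> level_word K l n = low (f l)"
    if "map (\<lambda>j. l' (Suc n, j)) [0..<w'] = us" for l l'
    using through_iff_word[OF iw, of "\<lambda>j. l (n, j)" "\<lambda>j. l' (Suc n, j)"] that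
    by (simp add: low_def level_word_def f_def w_def w'_def)
  have f_low: "f l = ls" if "level_word K l n = low ls" "ls \<in> words (ins p)" for l ls
  proof -
    have "take (ins p) (drop i (level_word K l n)) = f l"
      using iw by (auto simp: level_word_def f_def w_def list_eq_iff_nth_eq)
    moreover have "min (length us) i = i" using len iw by (simp add: w'_def)
    ultimately show ?thesis
      using that by (simp add: low_def words_def)
  qed
  have mid: "map (\<lambda>j. us ! (i + j)) [0..<outs p] = take (outs p) (drop i us)"
    using len iw by (auto simp: list_eq_iff_nth_eq w'_def)
  have "(\<Sum>l | l \<in> partial_labellings K (Suc n) \<and> level_word K l (Suc n) = us.
      \<Prod>m<Suc n. local_entry l m (K ! m)) =
    (\<Sum>(ls, l) \<in> (SIGMA ls : words (ins p). {l \<in> partial_labellings K n. level_word K l n = low ls}).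
      weight p (take (outs p) (drop i us)) ls * P l)"
  proof (rule sum.reindex_bij_witness[where
        i = "\<lambda>(ls, l). ext l" and j = "\<lambda>l. (f l, restrict l D)"])
    fix l assume l: "l \<in> {l. l \<in> partial_labellings K (Suc n) \<and> level_word K l (Suc n) = us}"
    then have lE: "l \<in> D \<union> {Suc n} \<times> {..<w'} \<rightarrow>\<^sub>E {1, 2}"
      and lt: "\<And>m. m < Suc n \<Longrightarrow> \<forall>(j, j') \<in> through (K ! m) (width K m). l (m, j) = l (Suc m, j')"
      and lw: "map (\<lambda>j. l (Suc n, j)) [0..<w'] = us"
      using D' w' by (auto simp: partial_labellings_def level_word_def)
    have ln: "l (Suc n, j) = us ! j" if "j < w'" for j
      using lw that by auto
    show "(\<lambda>(ls, l). ext l) (f l, restrict l D) = l"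
    proof
      fix x :: "nat \<times> nat"
      obtain m j where x: "x = (m, j)" by force
      show "(\<lambda>(ls, l). ext l) (f l, restrict l D) x = l x"
        using ln PiE_arb[OF lE, of x] by (auto simp: x ext_def D_def)
    qed
    have lw_n: "level_word K l n = low (f l)"
      using lt[of n] thr[OF lw, of l] by (simp add: pi w_def)
    have restr_word: "level_word K (restrict l D) n = level_word K l n"
      by (simp add: level_word_def D_def)
    have "l (n, i + j) \<in> {1, 2}" if "j < ins p" for j
      using iw that by (intro PiE_mem[OF lE]) (auto simp: D_def w_def)
    then have "f l \<in> words (ins p)"
      unfolding f_def words_def by (simp add: image_subset_iff)
    moreover have "restrict l D \<in> partial_labellings K n"
    proof -
      have "restrict l D \<in> D \<rightarrow>\<^sub>E {1, 2}" using lE by auto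
      moreover have "\<forall>(j, j') \<in> through (K ! m) (width K m). restrict l D (m, j) = restrict l D (Suc m, j')"
        if "m < n" for m
      proof -
        obtain q k where qk: "K ! m = (q, k)" by force
        have "(m, j) \<in> D \<and> (Suc m, j') \<in> D" if "(j, j') \<in> through (K ! m) (width K m)" for j j'
          using that \<open>m < n\<close> assms(1)[of m] Suc.prems by (auto simp: D_def qk)
        then show ?thesis using lt[of m] that by auto
      qed
      ultimately show ?thesis unfolding partial_labellings_def D_def by auto
    qed
    ultimately show "(f l, restrict l D) \<in>
      (SIGMA ls : words (ins p). {l \<in> partial_labellings K n. level_word K l n = low ls})"
      using lw_n restr_word by auto
    have "local_entry (restrict l D) m (K ! m) = local_entry l m (K ! m)" if "m < n" for m
    proof -
      obtain q k where qk: "K ! m = (q, k)" by force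
      have "(m, k + j) \<in> D" if "j < ins q" for j
        using that \<open>m < n\<close> assms(1)[of m] Suc.prems by (auto simp: D_def qk)
      moreover have "(Suc m, k + j) \<in> D" if "j < outs q" for j
        using that \<open>m < n\<close> assms(1)[of m] Suc.prems by (auto simp: D_def qk)
      ultimately show ?thesis
        unfolding qk entry_eq_weight by (intro arg_cong2[where f = "weight q"]) auto
    qed
    then have "P (restrict l D) = P l" unfolding P_def by (intro prod.cong) auto
    moreover have "local_entry l n (p, i) = weight p (take (outs p) (drop i us)) (f l)"
      unfolding entry_eq_weight f_def mid[symmetric] using ln iw
      by (intro arg_cong2[where f = "weight p"]) (auto simp: w'_def)
    ultimately show "(case (f l, restrict l D) of (ls, l) \<Rightarrow> weight p (take (outs p) (drop i us)) ls * P l) =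
        (\<Prod>m<Suc n. local_entry l m (K ! m))"
      by (simp add: P_def pi mult.commute)
  next
    fix x assume "x \<in> (SIGMA ls : words (ins p). {l \<in> partial_labellings K n. level_word K l n = low ls})"
    then obtain ls l where x: "x = (ls, l)" and ls: "ls \<in> words (ins p)"
      and l: "l \<in> partial_labellings K n" and lw: "level_word K l n = low ls" by auto
    have lE: "l \<in> D \<rightarrow>\<^sub>E {1, 2}"
      and lt: "\<And>m. m < n \<Longrightarrow> \<forall>(j, j') \<in> through (K ! m) (width K m). l (m, j) = l (Suc m, j')"
      using l by (auto simp: partial_labellings_def D_def)
    have fls: "f l = ls" by (rule f_low[OF lw ls])
    have "f (ext l) = f l" by (simp add: f_def ext_def)
    moreover have "restrict (ext l) D = l"
    proof
      fix y :: "nat \<times> nat"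
      obtain m j where y: "y = (m, j)" by force
      show "restrict (ext l) D y = l y"
        using PiE_arb[OF lE, of y] by (auto simp: y ext_def D_def restrict_def)
    qed
    ultimately show "(\<lambda>l. (f l, restrict l D)) ((\<lambda>(ls, l). ext l) x) = x"
      using fls by (simp add: x)
    have extw: "map (\<lambda>j. ext l (Suc n, j)) [0..<w'] = us"
      using len by (auto simp: ext_def list_eq_iff_nth_eq)
    have "ext l \<in> D \<union> {Suc n} \<times> {..<w'} \<rightarrow>\<^sub>E {1, 2}"
    proof
      fix y assume "y \<in> D \<union> {Suc n} \<times> {..<w'}"
      then consider "y \<in> D" "ext l y = l y" | j where "ext l y = us ! j" "j < length us"
        using len by (auto simp: ext_def D_def)
      then show "ext l y \<in> {1, 2}"
      proof cases
        case 1
        then show ?thesis using PiE_mem[OF lE] by (simp only:)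
      next
        case 2
        then show ?thesis using us12 nth_mem[of j us] by (simp only: subsetD)
      qed
    next
      fix y assume y: "y \<notin> D \<union> {Suc n} \<times> {..<w'}"
      obtain m j where "y = (m, j)" by force
      then show "ext l y = undefined"
        using y PiE_arb[OF lE, of y] by (auto simp: ext_def D_def)
    qed
    moreover have "\<forall>(j, j') \<in> through (K ! m) (width K m). ext l (m, j) = ext l (Suc m, j')"
      if "m < Suc n" for m
    proof (cases "m = n")
      case True
      have "\<forall>(j, j') \<in> through (p, i) w. l (n, j) = ext l (Suc n, j')"
        using thr[OF extw, of l] lw fls by simp
      moreover have "ext l (n, j) = l (n, j)" for j by (simp add: ext_def)
      ultimately show ?thesis using True by (auto simp: pi w_def)
    next
      case False
      then show ?thesis using that lt[of m] by (auto simp: ext_def)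
    qed
    moreover have "level_word K (ext l) (Suc n) = us"
      unfolding level_word_def w' by (rule extw)
    ultimately show "(\<lambda>(ls, l). ext l) x \<in> {l. l \<in> partial_labellings K (Suc n) \<and> level_word K l (Suc n) = us}"
      using D' by (simp add: x partial_labellings_def)
  qed
  also have "\<dots> = (\<Sum>ls\<in>words (ins p). \<Sum>l | l \<in> partial_labellings K n \<and> level_word K l n = low ls.
      weight p (take (outs p) (drop i us)) ls * P l)"
  proof (rule sum.Sigma[symmetric])
    show "finite (words (ins p))" by (rule finite_words)
    have "finite (partial_labellings K n)"
      unfolding partial_labellings_def by (rule finite_subset[OF _ finite_PiE[of "SIGMA m:{..n}. {..<width K m}" "\<lambda>_. {1,2}"]]) auto
    then show "\<forall>ls\<in>words (ins p). finite {l \<in> partial_labellings K n. level_word K l n = low ls}"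
      by auto
  qed
  also have "\<dots> = (\<Sum>ls\<in>words (ins p). weight p (take (outs p) (drop i us)) ls * transfer (take n K) unit_vector (low ls))"
    using Suc.IH low Suc.prems by (simp add: sum_distrib_left[symmetric] P_def w_def)
  also have "\<dots> = transfer (take (Suc n) K) unit_vector us"
    using Suc.prems by (simp add: take_Suc_conv_app_nth slice_op_def pi low_def)
  finally show ?case .
qed

lemma Z_eq_transfer:
  assumes "diagram K"
  shows "Z A B \<iota> K = transfer K unit_vector []"
proof -
  have "points K = (SIGMA m : {..length K}. {..<width K m})" by (simp add: points_def)
  then have "labellings K = {l. l \<in> partial_labellings K (length K) \<and> level_word K l (length K) = []}"
    using assms by (simp add: labellings_def partial_labellings_def level_word_def diagram_def)
  then show ?thesis
    using sum_partial_labellings[of K "length K" "[]"] assms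
    by (simp add: Z_def tensor_evaluation_def diagram_def words_def)
qed

end

section \<open>Invariance under the moves\<close>

lemma words_split:
  assumes "us \<in> words w" "i + k \<le> w"
  shows "\<exists>as ms cs. us = as @ ms @ cs \<and> length as = i \<and> ms \<in> words k"
proof (intro exI conjI)
  show "us = take i us @ take k (drop i us) @ drop k (drop i us)"
    by (simp only: append_take_drop_id)
  show "length (take i us) = i" "take k (drop i us) \<in> words k"
    using assms by (auto simp: words_def dest!: in_set_takeD in_set_dropD)
qed

lemma words_1_cases:
  assumes "xs \<in> words 1"
  obtains a where "xs = [a]" "a \<in> {1, 2}"
  using assms by (auto simp: words_def length_Suc_conv)

lemma words_2_cases:
  assumes "xs \<in> words 2"
  obtains a b where "xs = [a, b]" "a \<in> {1, 2}" "b \<in> {1, 2}"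
  using assms by (auto simp: words_def numeral_2_eq_2 length_Suc_conv)

lemma words_3_cases:
  assumes "xs \<in> words 3"
  obtains a b c where "xs = [a, b, c]" "a \<in> {1, 2}" "b \<in> {1, 2}" "c \<in> {1, 2}"
  using assms by (auto simp: words_def numeral_3_eq_3 length_Suc_conv)

context bracket_ring
begin

lemma slice_op_append:
  assumes "length as = i" "length ms = outs p"
  shows "slice_op (p, i) v (as @ ms @ cs) = (\<Sum>ls\<in>words (ins p). weight p ms ls * v (as @ ls @ cs))"
  using assms by (simp add: slice_op_def)

lemma slice_op_cong:
  assumes "i + ins p \<le> w" "us \<in> words (w - ins p + outs p)" "\<And>us. us \<in> words w \<Longrightarrow> v us = v' us"
  shows "slice_op (p, i) v us = slice_op (p, i) v' us"
proof -
  have "take i us @ ls @ drop (i + outs p) us \<in> words w" if "ls \<in> words (ins p)" for ls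
    using that assms(1,2) by (auto simp: words_def dest: in_set_takeD in_set_dropD)
  then show ?thesis using assms(3) by (simp add: slice_op_def)
qed

lemma transfer_cong:
  assumes "fits w K w'" "\<And>us. us \<in> words w \<Longrightarrow> v us = v' us" "us \<in> words w'"
  shows "transfer K v us = transfer K v' us"
  using assms
proof (induction K arbitrary: w v v')
  case (Cons s K)
  obtain p i where s: "s = (p, i)" by force
  have "fits (w - ins p + outs p) K w'"
    using Cons.prems(1) unfolding s by (simp only: fits.simps fst_conv snd_conv)
  moreover have "slice_op s v us = slice_op s v' us" if "us \<in> words (w - ins p + outs p)" for us
    using slice_op_cong[of i p w us v v'] Cons.prems that by (simp add: s)
  ultimately have "transfer K (slice_op s v) us = transfer K (slice_op s v') us"
    using Cons.prems(3) by (rule Cons.IH)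
  then show ?case by simp
qed simp

lemma AB_simps: "A * B = 1" "B * A = 1" "A * (B * x) = x" "B * (A * x) = x"
  using AB by (simp_all add: mult.commute) (metis AB mult.assoc mult.commute mult_1)+

lemma \<iota>_simps: "\<iota> * \<iota> = -1" "\<iota> * (\<iota> * x) = - x"
  using \<iota>_square by (simp_all add: mult.assoc[symmetric])

lemma M_values:
  "M_mat A B \<iota> 1 1 = 0" "M_mat A B \<iota> 1 2 = \<iota> * A" "M_mat A B \<iota> 2 1 = - \<iota> * B" "M_mat A B \<iota> 2 2 = 0"
  by (simp_all add: M_mat_def)

lemma slice_op_Maximum:
  "length as = i \<Longrightarrow> slice_op (Maximum, i) v (as @ cs) =
     \<iota> * A * v (as @ 1 # 2 # cs) - \<iota> * B * v (as @ 2 # 1 # cs)"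
  using slice_op_append[of as i "[]" Maximum v cs]
  by (simp add: sum_words_2 M_values del: One_nat_def)

lemma slice_op_Minimum:
  "length as = i \<Longrightarrow> slice_op (Minimum, i) v (as @ a # b # cs) = M_mat A B \<iota> a b * v (as @ cs)"
  using slice_op_append[of as i "[a, b]" Minimum v cs] by (simp add: words_0)

lemma slice_op_Virtual:
  assumes "length as = i" "a \<in> {1, 2}" "b \<in> {1, 2}"
  shows "slice_op (Virtual, i) v (as @ a # b # cs) = v (as @ b # a # cs)"
  using assms slice_op_append[of as i "[a, b]" Virtual v cs]
  by (auto simp: sum_words_2 V_mat_def kdelta_def)

text \<open>
  The entries of \<open>M\<close> enter the crossing matrices in pairs, so that \<open>\<iota>\<close> disappears. On words that are
  written out, the linear maps are rewriting rules by which the moves can be checked.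
\<close>
lemma slice_op_Over_NW:
  assumes "length as = i"
  shows "slice_op (Over_NW, i) v (as @ 1 # 1 # cs) = B * v (as @ 1 # 1 # cs)"
    and "slice_op (Over_NW, i) v (as @ 2 # 2 # cs) = B * v (as @ 2 # 2 # cs)"
    and "slice_op (Over_NW, i) v (as @ 1 # 2 # cs) =
      (B - A * (A * A)) * v (as @ 1 # 2 # cs) + A * v (as @ 2 # 1 # cs)"
    and "slice_op (Over_NW, i) v (as @ 2 # 1 # cs) = A * v (as @ 1 # 2 # cs)"
proof -
  have *: "slice_op (Over_NW, i) v (as @ a # b # cs) =
      (\<Sum>ls\<in>words 2. R_mat A B \<iota> a b (ls ! 0) (ls ! 1) * v (as @ ls @ cs))" for a b
    using assms slice_op_append[of as i "[a, b]" Over_NW v cs] by simp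
  show "slice_op (Over_NW, i) v (as @ 1 # 1 # cs) = B * v (as @ 1 # 1 # cs)"
    "slice_op (Over_NW, i) v (as @ 2 # 2 # cs) = B * v (as @ 2 # 2 # cs)"
    "slice_op (Over_NW, i) v (as @ 1 # 2 # cs) = (B - A * (A * A)) * v (as @ 1 # 2 # cs) + A * v (as @ 2 # 1 # cs)"
    "slice_op (Over_NW, i) v (as @ 2 # 1 # cs) = A * v (as @ 1 # 2 # cs)"
    unfolding * sum_words_2
    by (simp_all add: R_mat_def kdelta_def M_values AB_simps \<iota>_simps algebra_simps del: One_nat_def)
qed

lemma slice_op_Over_NE:
  assumes "length as = i"
  shows "slice_op (Over_NE, i) v (as @ 1 # 1 # cs) = A * v (as @ 1 # 1 # cs)"
    and "slice_op (Over_NE, i) v (as @ 2 # 2 # cs) = A * v (as @ 2 # 2 # cs)"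
    and "slice_op (Over_NE, i) v (as @ 1 # 2 # cs) = B * v (as @ 2 # 1 # cs)"
    and "slice_op (Over_NE, i) v (as @ 2 # 1 # cs) =
      B * v (as @ 1 # 2 # cs) + (A - B * (B * B)) * v (as @ 2 # 1 # cs)"
proof -
  have *: "slice_op (Over_NE, i) v (as @ a # b # cs) =
      (\<Sum>ls\<in>words 2. Rbar_mat A B \<iota> a b (ls ! 0) (ls ! 1) * v (as @ ls @ cs))" for a b
    using assms slice_op_append[of as i "[a, b]" Over_NE v cs] by simp
  show "slice_op (Over_NE, i) v (as @ 1 # 1 # cs) = A * v (as @ 1 # 1 # cs)"
    "slice_op (Over_NE, i) v (as @ 2 # 2 # cs) = A * v (as @ 2 # 2 # cs)"
    "slice_op (Over_NE, i) v (as @ 1 # 2 # cs) = B * v (as @ 2 # 1 # cs)"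
    "slice_op (Over_NE, i) v (as @ 2 # 1 # cs) = B * v (as @ 1 # 2 # cs) + (A - B * (B * B)) * v (as @ 2 # 1 # cs)"
    unfolding * sum_words_2
    by (simp_all add: Rbar_mat_def kdelta_def M_values AB_simps \<iota>_simps algebra_simps del: One_nat_def)
qed

lemmas slice_op_simps = slice_op_Maximum slice_op_Minimum slice_op_Virtual slice_op_Over_NW slice_op_Over_NE

text \<open>
  For a piece that stands one position further to the right, one more letter of the word lies on
  its left.
\<close>
lemmas slice_op_Suc_simps =
  slice_op_simps[where as = "as @ [x]" and i = "Suc i" for as x i, unfolded append_assoc append_Cons append_Nil]

text \<open>
  The two pieces act on disjoint parts of the word, so that the two sums are independent.
\<close>
lemma slice_op_exchange:
  assumes "fits w [(p, i), (q, i + outs p + k)] w'" "us \<in> words w'"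
  shows "transfer [(p, i), (q, i + outs p + k)] v us = transfer [(q, i + ins p + k), (p, i)] v us"
proof -
  have "i + outs p + k + outs q \<le> w'" using assms(1) by auto
  then obtain xs m2 cs where us: "us = xs @ m2 @ cs" and xs: "length xs = i + outs p + k"
    and m2: "m2 \<in> words (outs q)"
    using words_split[OF assms(2), of "i + outs p + k" "outs q"] by auto
  define as where "as = take i xs"
  define m1 where "m1 = take (outs p) (drop i xs)"
  define ks where "ks = drop (i + outs p) xs"
  have xs': "xs = as @ m1 @ ks"
    unfolding as_def m1_def ks_def by (metis append_take_drop_id drop_drop add.commute)
  have len: "length as = i" "length m1 = outs p" "length ks = k" "length m2 = outs q"
    using xs m2 by (auto simp: as_def m1_def ks_def words_def)
  have "transfer [(p, i), (q, i + outs p + k)] v us =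
      (\<Sum>l2\<in>words (ins q). weight q m2 l2 * slice_op (p, i) v (as @ m1 @ (ks @ l2 @ cs)))"
    using slice_op_append[of xs "i + outs p + k" m2 q] len xs by (simp add: us xs')
  also have "\<dots> = (\<Sum>l2\<in>words (ins q). \<Sum>l1\<in>words (ins p). weight q m2 l2 * (weight p m1 l1 * v (as @ l1 @ ks @ l2 @ cs)))"
    using len by (simp add: slice_op_append sum_distrib_left)
  also have "\<dots> = (\<Sum>l1\<in>words (ins p). \<Sum>l2\<in>words (ins q). weight p m1 l1 * (weight q m2 l2 * v ((as @ l1 @ ks) @ l2 @ cs)))"
    by (subst sum.swap) (simp add: mult.left_commute)
  also have "\<dots> = (\<Sum>l1\<in>words (ins p). weight p m1 l1 * slice_op (q, i + ins p + k) v ((as @ l1 @ ks) @ m2 @ cs))"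
    using len by (intro sum.cong refl, subst slice_op_append) (auto simp: sum_distrib_left words_def)
  also have "\<dots> = transfer [(q, i + ins p + k), (p, i)] v us"
    using slice_op_append[of as i m1 p _ "ks @ m2 @ cs"] len by (simp add: us xs')
  finally show ?thesis .
qed

lemma transfer_3_eqI:
  assumes "us \<in> words w" "i + 3 \<le> w"
    and "\<And>as a b c cs. length as = i \<Longrightarrow> a \<in> {1, 2} \<Longrightarrow> b \<in> {1, 2} \<Longrightarrow> c \<in> {1, 2} \<Longrightarrow> f (as @ a # b # c # cs) = g (as @ a # b # c # cs)"
  shows "f us = (g us :: 'a)"
proof -
  obtain as ms cs where us: "us = as @ ms @ cs" and as: "length as = i" and ms: "ms \<in> words 3"
    using words_split[OF assms(1,2)] by auto
  from ms obtain a b c where "ms = [a, b, c]" "a \<in> {1, 2}" "b \<in> {1, 2}" "c \<in> {1, 2}"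
    by (rule words_3_cases)
  with us show ?thesis using assms(3)[OF as, of a b c cs] by (simp only: append_Cons append_Nil)
qed

lemma transfer_2_eqI:
  assumes "us \<in> words w" "i + 2 \<le> w"
    and "\<And>as a b cs. length as = i \<Longrightarrow> a \<in> {1, 2} \<Longrightarrow> b \<in> {1, 2} \<Longrightarrow> f (as @ a # b # cs) = g (as @ a # b # cs)"
  shows "f us = (g us :: 'a)"
proof -
  obtain as ms cs where us: "us = as @ ms @ cs" and as: "length as = i" and ms: "ms \<in> words 2"
    using words_split[OF assms(1,2)] by auto
  from ms obtain a b where "ms = [a, b]" "a \<in> {1, 2}" "b \<in> {1, 2}"
    by (rule words_2_cases)
  with us show ?thesis using assms(3)[OF as, of a b cs] by (simp only: append_Cons append_Nil)
qed

lemma transfer_1_eqI: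
  assumes "us \<in> words w" "i + 1 \<le> w"
    and "\<And>as a cs. length as = i \<Longrightarrow> a \<in> {1, 2} \<Longrightarrow> f (as @ a # cs) = g (as @ a # cs)"
  shows "f us = (g us :: 'a)"
proof -
  obtain as ms cs where us: "us = as @ ms @ cs" and as: "length as = i" and ms: "ms \<in> words 1"
    using words_split[OF assms(1,2)] by auto
  from ms obtain a where "ms = [a]" "a \<in> {1, 2}"
    by (rule words_1_cases)
  with us show ?thesis using assms(3)[OF as, of a cs] by (simp only: append_Cons append_Nil)
qed

lemmas move_simps = Suc_eq_plus1[symmetric] Suc_eq_plus1_left[symmetric]
  slice_op_simps slice_op_Suc_simps M_values AB_simps \<iota>_simps algebra_simps


text \<open>
  Apart from the exchange of heights, a move concerns at most three adjacent strands, and the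
  identity is verified for each choice of the labels at their upper ends.
\<close>
lemma local_move_transfer:
  assumes "local_move L L'" "fits w L w1" "us \<in> words w1"
  shows "transfer L v us = transfer L' v us"
  using assms(1)
proof cases
  case (exchange p i q k)
  then show ?thesis using slice_op_exchange assms(2,3) by blast
next
  case (cancel_right i)
  show ?thesis
  proof (rule transfer_1_eqI[OF assms(3), of i])
    show "i + 1 \<le> w1" using assms(2) cancel_right by (auto simp: is_crossing_def is_classical_def)
  next
    fix as cs :: "nat list" and a :: nat
    assume as: "length as = i" and "a \<in> {1, 2}"
    with cancel_right show "transfer L v (as @ a # cs) = transfer L' v (as @ a # cs)"
      unfolding insert_iff empty_iff is_crossing_def is_classical_def
      by (elim disjE FalseE; simp add: move_simps del: One_nat_def)
  qed
next
  case (cancel_left i)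
  show ?thesis
  proof (rule transfer_1_eqI[OF assms(3), of i])
    show "i + 1 \<le> w1" using assms(2) cancel_left by (auto simp: is_crossing_def is_classical_def)
  next
    fix as cs :: "nat list" and a :: nat
    assume as: "length as = i" and "a \<in> {1, 2}"
    with cancel_left show "transfer L v (as @ a # cs) = transfer L' v (as @ a # cs)"
      unfolding insert_iff empty_iff is_crossing_def is_classical_def
      by (elim disjE FalseE; simp add: move_simps del: One_nat_def)
  qed
next
  case (across_maximum x i)
  show ?thesis
  proof (rule transfer_1_eqI[OF assms(3), of i])
    show "i + 1 \<le> w1" using assms(2) across_maximum by (auto simp: is_crossing_def is_classical_def)
  next
    fix as cs :: "nat list" and a :: nat
    assume as: "length as = i" and "a \<in> {1, 2}"
    with across_maximum show "transfer L v (as @ a # cs) = transfer L' v (as @ a # cs)"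
      unfolding insert_iff empty_iff is_crossing_def is_classical_def
      by (elim disjE FalseE; simp add: move_simps del: One_nat_def)
  qed
next
  case (across_minimum x i)
  show ?thesis
  proof (rule transfer_3_eqI[OF assms(3), of i])
    show "i + 3 \<le> w1" using assms(2) across_minimum by (auto simp: is_crossing_def is_classical_def)
  next
    fix as cs :: "nat list" and a b c :: nat
    assume as: "length as = i" and "a \<in> {1, 2}" "b \<in> {1, 2}" "c \<in> {1, 2}"
    with across_minimum show "transfer L v (as @ a # b # c # cs) = transfer L' v (as @ a # b # c # cs)"
      unfolding insert_iff empty_iff is_crossing_def is_classical_def
      by (elim disjE FalseE; simp add: move_simps del: One_nat_def)
  qed
next
  case (reidemeister_2 x i)
  show ?thesis
  proof (rule transfer_2_eqI[OF assms(3), of i])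
    show "i + 2 \<le> w1" using assms(2) reidemeister_2 by (auto simp: is_crossing_def is_classical_def)
  next
    fix as cs :: "nat list" and a b :: nat
    assume as: "length as = i" and "a \<in> {1, 2}" "b \<in> {1, 2}"
    with reidemeister_2 show "transfer L v (as @ a # b # cs) = transfer L' v (as @ a # b # cs)"
      unfolding insert_iff empty_iff is_crossing_def is_classical_def
      by (elim disjE FalseE; simp add: move_simps del: One_nat_def)
  qed
next
  case (reidemeister_3 x y z i)
  show ?thesis
  proof (rule transfer_3_eqI[OF assms(3), of i])
    show "i + 3 \<le> w1" using assms(2) reidemeister_3 by (auto simp: is_crossing_def is_classical_def)
  next
    fix as cs :: "nat list" and a b c :: nat
    assume as: "length as = i" and "a \<in> {1, 2}" "b \<in> {1, 2}" "c \<in> {1, 2}"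
    with reidemeister_3 show "transfer L v (as @ a # b # c # cs) = transfer L' v (as @ a # b # c # cs)"
      unfolding insert_iff empty_iff is_crossing_def is_classical_def
      by (elim disjE FalseE; simp add: move_simps del: One_nat_def)
  qed
next
  case (virtual_2 i)
  show ?thesis
  proof (rule transfer_2_eqI[OF assms(3), of i])
    show "i + 2 \<le> w1" using assms(2) virtual_2 by (auto simp: is_crossing_def is_classical_def)
  next
    fix as cs :: "nat list" and a b :: nat
    assume as: "length as = i" and "a \<in> {1, 2}" "b \<in> {1, 2}"
    with virtual_2 show "transfer L v (as @ a # b # cs) = transfer L' v (as @ a # b # cs)"
      unfolding insert_iff empty_iff is_crossing_def is_classical_def
      by (elim disjE FalseE; simp add: move_simps del: One_nat_def)
  qed
next
  case (virtual_3 i)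
  show ?thesis
  proof (rule transfer_3_eqI[OF assms(3), of i])
    show "i + 3 \<le> w1" using assms(2) virtual_3 by (auto simp: is_crossing_def is_classical_def)
  next
    fix as cs :: "nat list" and a b c :: nat
    assume as: "length as = i" and "a \<in> {1, 2}" "b \<in> {1, 2}" "c \<in> {1, 2}"
    with virtual_3 show "transfer L v (as @ a # b # c # cs) = transfer L' v (as @ a # b # c # cs)"
      unfolding insert_iff empty_iff is_crossing_def is_classical_def
      by (elim disjE FalseE; simp add: move_simps del: One_nat_def)
  qed
next
  case (mixed_12 x i)
  show ?thesis
  proof (rule transfer_3_eqI[OF assms(3), of i])
    show "i + 3 \<le> w1" using assms(2) mixed_12 by (auto simp: is_crossing_def is_classical_def)
  next
    fix as cs :: "nat list" and a b c :: nat
    assume as: "length as = i" and "a \<in> {1, 2}" "b \<in> {1, 2}" "c \<in> {1, 2}"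
    with mixed_12 show "transfer L v (as @ a # b # c # cs) = transfer L' v (as @ a # b # c # cs)"
      unfolding insert_iff empty_iff is_crossing_def is_classical_def
      by (elim disjE FalseE; simp add: move_simps del: One_nat_def)
  qed
next
  case (mixed_13 y i)
  show ?thesis
  proof (rule transfer_3_eqI[OF assms(3), of i])
    show "i + 3 \<le> w1" using assms(2) mixed_13 by (auto simp: is_crossing_def is_classical_def)
  next
    fix as cs :: "nat list" and a b c :: nat
    assume as: "length as = i" and "a \<in> {1, 2}" "b \<in> {1, 2}" "c \<in> {1, 2}"
    with mixed_13 show "transfer L v (as @ a # b # c # cs) = transfer L' v (as @ a # b # c # cs)"
      unfolding insert_iff empty_iff is_crossing_def is_classical_def
      by (elim disjE FalseE; simp add: move_simps del: One_nat_def)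
  qed
next
  case (mixed_23 z i)
  show ?thesis
  proof (rule transfer_3_eqI[OF assms(3), of i])
    show "i + 3 \<le> w1" using assms(2) mixed_23 by (auto simp: is_crossing_def is_classical_def)
  next
    fix as cs :: "nat list" and a b c :: nat
    assume as: "length as = i" and "a \<in> {1, 2}" "b \<in> {1, 2}" "c \<in> {1, 2}"
    with mixed_23 show "transfer L v (as @ a # b # c # cs) = transfer L' v (as @ a # b # c # cs)"
      unfolding insert_iff empty_iff is_crossing_def is_classical_def
      by (elim disjE FalseE; simp add: move_simps del: One_nat_def)
  qed
qed

lemma Z_move:
  assumes "move K K'"
  shows "Z A B \<iota> K = Z A B \<iota> K'"
  using assms
proof cases
  case (1 L L' X Y)
  obtain w w1 where w: "fits 0 X w" "fits w L w1" "fits w1 Y 0"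
    using 1 by (auto simp: diagram_iff_fits fits_append)
  have "transfer L v us = transfer L' v us" if "us \<in> words w1" for v us
    by (rule local_move_transfer[OF \<open>local_move L L'\<close> w(2) that])
  then have "transfer Y (transfer L v) [] = transfer Y (transfer L' v) []" for v
    by (intro transfer_cong[OF w(3)]) (simp_all add: words_0)
  then have "transfer Y (transfer L (transfer X unit_vector)) [] =
      transfer Y (transfer L' (transfer X unit_vector)) []" .
  moreover have "Z A B \<iota> K = transfer K unit_vector []" "Z A B \<iota> K' = transfer K' unit_vector []"
    using 1 by (simp_all only: Z_eq_transfer)
  ultimately show ?thesis using 1(1,2) by (simp only: fold_append comp_apply)
qed

lemma Z_invariant:
  assumes "virtual_regular_isotopic K K'"
  shows "Z A B \<iota> K = Z A B \<iota> K'"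
  using assms unfolding virtual_regular_isotopic_def
  by (induction rule: equivclp_induct) (auto dest: Z_move)

end

section \<open>State expansion\<close>

lemma smoothed_snoc: "smoothed (K @ [s]) S = smoothed K S @ smooth (length K \<in> S) s"
proof -
  have "map (\<lambda>n. smooth (n \<in> S) ((K @ [s]) ! n)) [0..<length K] =
      map (\<lambda>n. smooth (n \<in> S) (K ! n)) [0..<length K]" by (auto simp: nth_append)
  then have "concat (map (\<lambda>n. smooth (n \<in> S) ((K @ [s]) ! n)) [0..<length K]) =
      concat (map (\<lambda>n. smooth (n \<in> S) (K ! n)) [0..<length K])" by (rule arg_cong)
  then show ?thesis unfolding smoothed_def by simp
qed

lemma smoothed_insert: "smoothed K (insert (length K) S) = smoothed K S"
proof -
  have "map (\<lambda>n. smooth (n \<in> insert (length K) S) (K ! n)) [0..<length K] =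
      map (\<lambda>n. smooth (n \<in> S) (K ! n)) [0..<length K]" by auto
  then show ?thesis unfolding smoothed_def by (rule arg_cong)
qed

lemma classical_crossings_snoc:
  "classical_crossings (K @ [s]) =
     (if is_classical (fst s) then insert (length K) (classical_crossings K) else classical_crossings K)"
  by (auto simp: classical_crossings_def nth_append less_Suc_eq)

lemma length_notin_crossings: "length K \<notin> classical_crossings K"
  by (simp add: classical_crossings_def)

lemma finite_classical_crossings: "finite (classical_crossings K)"
  by (simp add: classical_crossings_def)

lemma smooth_non_classical: "\<not> is_classical (fst s) \<Longrightarrow> smooth a s = [s]"
  by (cases "(a, s)" rule: smooth.cases) (auto simp: is_classical_def)

lemma smooth_no_classical: "s' \<in> set (smooth a s) \<Longrightarrow> \<not> is_classical (fst s')"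
  by (cases "(a, s)" rule: smooth.cases) (auto simp: is_classical_def split: if_splits)

lemma smoothed_no_classical: "s \<in> set (smoothed K S) \<Longrightarrow> \<not> is_classical (fst s)"
  by (auto simp: smoothed_def dest: smooth_no_classical)

lemma fits_smooth: "fits w [s] w' \<Longrightarrow> fits w (smooth a s) w'"
  by (cases "(a, s)" rule: smooth.cases) auto

lemma fits_smoothed: "fits 0 K w \<Longrightarrow> fits 0 (smoothed K S) w"
proof (induction K arbitrary: w rule: rev_induct)
  case (snoc s K)
  then show ?case unfolding smoothed_snoc fits_append using fits_smooth by blast
qed (simp add: smoothed_def)

lemma diagram_smoothed: "diagram K \<Longrightarrow> diagram (smoothed K S)"
  by (simp add: diagram_iff_fits fits_smoothed)

context bracket_ring
begin

text \<open>
  The product \<open>M\<^sup>a\<^sup>b M\<^sub>c\<^sub>d\<close> is a maximum below a minimum and \<open>\<delta>\<^sup>a\<^sub>c \<delta>\<^sup>b\<^sub>d\<close> a pair of vertical strands, which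
  are the two smoothings.
\<close>
lemma slice_op_smooth:
  assumes "is_classical p" "us \<in> words w" "i + 2 \<le> w"
  shows "slice_op (p, i) v us =
    A * transfer (smooth True (p, i)) v us + B * transfer (smooth False (p, i)) v us"
proof (rule transfer_2_eqI[OF assms(2,3)])
  fix as cs :: "nat list" and a b :: nat
  assume as: "length as = i" and ab: "a \<in> {1, 2}" "b \<in> {1, 2}"
  from ab assms(1) show "slice_op (p, i) v (as @ a # b # cs) =
    A * transfer (smooth True (p, i)) v (as @ a # b # cs) + B * transfer (smooth False (p, i)) v (as @ a # b # cs)"
    unfolding insert_iff empty_iff is_classical_def
    by (elim disjE FalseE; simp add: as move_simps del: One_nat_def)
qed

lemma slice_op_sum:
  "slice_op s (\<lambda>us. \<Sum>S\<in>F. c S * f S us) us = (\<Sum>S\<in>F. c S * slice_op s (f S) us)"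
proof -
  obtain p i where s: "s = (p, i)" by force
  show ?thesis
    unfolding slice_op_def s prod.case sum_distrib_left
    by (subst sum.swap) (simp add: mult.left_commute)
qed

text \<open>
  If the last slice is a classical crossing, a state of the whole diagram is a state of the
  diagram below it, with or without the position of that crossing.
\<close>
lemma transfer_state_expansion:
  assumes "fits 0 K w" "us \<in> words w"
  shows "transfer K unit_vector us =
    (\<Sum>S\<in>states K. state_weight A B K S * transfer (smoothed K S) unit_vector us)"
  using assms
proof (induction K arbitrary: w us rule: rev_induct)
  case Nil
  then show ?case by (simp add: states_def classical_crossings_def state_weight_def smoothed_def)
next
  case (snoc s K)
  obtain p i where s: "s = (p, i)" by force
  obtain u where u: "fits 0 K u" "fits u [s] w" using snoc.prems by (auto simp: fits_append)
  define f where "f S = transfer (smoothed K S) unit_vector" for S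
  define c where "c S = state_weight A B K S" for S
  have "transfer (K @ [s]) unit_vector us = slice_op s (transfer K unit_vector) us" by simp
  also have "\<dots> = slice_op s (\<lambda>us. \<Sum>S\<in>states K. c S * f S us) us"
    unfolding s
  proof (rule slice_op_cong)
    show "i + ins p \<le> u" "us \<in> words (u - ins p + outs p)"
      using u(2) snoc.prems(2) s by auto
  qed (simp add: snoc.IH[OF u(1)] f_def c_def)
  also have "\<dots> = (\<Sum>S\<in>states K. c S * slice_op s (f S) us)"
    by (rule slice_op_sum)
  also have "\<dots> = (\<Sum>S\<in>states (K @ [s]). state_weight A B (K @ [s]) S * transfer (smoothed (K @ [s]) S) unit_vector us)"
  proof (cases "is_classical p")
    case False
    then have "classical_crossings (K @ [s]) = classical_crossings K"
      by (simp add: classical_crossings_snoc s)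
    then show ?thesis
      using False by (simp add: states_def state_weight_def smoothed_snoc smooth_non_classical s f_def c_def)
  next
    case True
    let ?n = "length K" and ?C = "classical_crossings K"
    have C: "classical_crossings (K @ [s]) = insert ?n ?C"
      using True by (simp add: classical_crossings_snoc s)
    have w: "us \<in> words w" "i + 2 \<le> w"
      using snoc.prems(2) u(2) True by (auto simp: s is_classical_def)
    have n_notin: "?n \<notin> S" if "S \<in> Pow ?C" for S using that length_notin_crossings by auto
    have sw: "state_weight A B (K @ [s]) S = B * c S"
      "state_weight A B (K @ [s]) (insert ?n S) = A * c S" if "S \<in> Pow ?C" for S
    proof -
      have "(\<Prod>n\<in>?C. if n \<in> insert ?n S then A else B) = c S"
        unfolding c_def state_weight_def
        by (intro prod.cong) (use length_notin_crossings[of K] in auto)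
      then show "state_weight A B (K @ [s]) (insert ?n S) = A * c S"
        using length_notin_crossings[of K] finite_classical_crossings[of K]
        by (simp add: state_weight_def C)
      show "state_weight A B (K @ [s]) S = B * c S"
        using length_notin_crossings[of K] finite_classical_crossings[of K] n_notin[OF that]
        by (simp add: state_weight_def C c_def)
    qed
    have inj: "inj_on (insert ?n) (Pow ?C)"
      using n_notin by (meson inj_onI insert_ident)
    have "(\<Sum>S\<in>Pow (insert ?n ?C). state_weight A B (K @ [s]) S * transfer (smoothed (K @ [s]) S) unit_vector us) =
        (\<Sum>S\<in>Pow ?C. state_weight A B (K @ [s]) S * transfer (smoothed (K @ [s]) S) unit_vector us) +
        (\<Sum>S\<in>insert ?n ` Pow ?C. state_weight A B (K @ [s]) S * transfer (smoothed (K @ [s]) S) unit_vector us)"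
      unfolding Pow_insert using n_notin finite_classical_crossings[of K]
      by (intro sum.union_disjoint) auto
    also have "\<dots> = (\<Sum>S\<in>Pow ?C. B * c S * transfer (smooth False s) (f S) us) +
        (\<Sum>S\<in>Pow ?C. A * c S * transfer (smooth True s) (f S) us)"
      unfolding sum.reindex[OF inj] using n_notin sw
      by (intro arg_cong2[where f = plus] sum.cong) (auto simp: smoothed_snoc smoothed_insert f_def)
    also have "\<dots> = (\<Sum>S\<in>Pow ?C. c S * slice_op s (f S) us)"
      unfolding s slice_op_smooth[OF True w] sum.distrib[symmetric]
      by (simp add: algebra_simps)
    finally show ?thesis by (simp add: states_def C)
  qed
  finally show ?case .
qed

lemma Z_state_expansion:
  assumes "diagram K"
  shows "Z A B \<iota> K = (\<Sum>S\<in>states K. state_weight A B K S * Z A B \<iota> (smoothed K S))"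
  using assms transfer_state_expansion[of K 0 "[]"] diagram_smoothed[OF assms]
  by (simp add: Z_eq_transfer) (simp add: diagram_iff_fits words_0)

end

section \<open>The Whitney degree of a closed chain of arcs\<close>

text \<open>
  A path that avoids a ray from the origin has a continuous logarithm; multiplication by \<open>c\<close> turns
  this ray to the branch cut of \<open>Ln\<close>.
\<close>
lemma winding_number_Ln:
  fixes \<gamma> :: "real \<Rightarrow> complex"
  assumes "path \<gamma>" "c \<noteq> 0" "\<And>t. t \<in> {0..1} \<Longrightarrow> c * \<gamma> t \<notin> \<real>\<^sub>\<le>\<^sub>0"
  shows "winding_number \<gamma> 0 = (Ln (c * pathfinish \<gamma>) - Ln (c * pathstart \<gamma>)) / (2 * of_real pi * \<i>)"
proof -
  let ?p = "\<lambda>t. Ln (c * \<gamma> t) - Ln c"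
  have "path ?p"
    unfolding path_def
    by (intro continuous_intros) (use assms(1,3) in \<open>auto simp: path_def\<close>)
  have "c * \<gamma> t \<noteq> 0" if "t \<in> {0..1}" for t using assms(3)[OF that] by auto
  then have "winding_number (exp \<circ> ?p) 0 = winding_number \<gamma> 0"
    using assms(2) by (intro winding_number_cong) (simp add: exp_diff)
  then show ?thesis
    using winding_number_compose_exp[OF \<open>path ?p\<close>] by (simp add: pathfinish_def pathstart_def)
qed

text \<open>
  At the right end of its time interval an arc agrees with the next one, which has taken over
  there in the definition of \<open>joined\<close>.
\<close>
lemma joined_on_piece:
  assumes "m < length gs" "t \<in> {real m / length gs..real (Suc m) / length gs}"
    "\<And>n. Suc n < length gs \<Longrightarrow> pathfinish (gs ! n) = pathstart (gs ! Suc n)"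
  shows "joined gs t = (gs ! m) (real (length gs) * t - real m)"
proof -
  define k where "k = length gs"
  have k: "0 < real k" using assms(1) by (auto simp: k_def)
  have kt: "real m \<le> real k * t" "real k * t \<le> real m + 1"
    using assms(2) k unfolding k_def[symmetric] by (auto simp: field_simps)
  show ?thesis
  proof (cases "real k * t = real m + 1")
    case True
    then have fl: "nat \<lfloor>real k * t\<rfloor> = Suc m" by (simp add: floor_eq_iff nat_eq_iff)
    show ?thesis
    proof (cases "Suc m < k")
      case T: True
      then have "min (Suc m) (k - 1) = Suc m" by simp
      then have "joined gs t = (gs ! Suc m) 0"
        unfolding joined_def Let_def k_def[symmetric] fl using True by simp
      also have "\<dots> = (gs ! m) 1"
        using assms(3)[of m] T by (simp add: k_def pathfinish_def pathstart_def)
      finally show ?thesis using True by (simp add: k_def)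
    next
      case False
      then have "min (Suc m) (k - 1) = m" using assms(1) by (simp add: k_def)
      then show ?thesis unfolding joined_def Let_def k_def[symmetric] fl by simp
    qed
  next
    case False
    then have "nat \<lfloor>real k * t\<rfloor> = m" using kt by (simp add: floor_eq_iff nat_eq_iff)
    moreover have "min m (k - 1) = m" using assms(1) by (simp add: k_def)
    ultimately show ?thesis unfolding joined_def Let_def k_def[symmetric] by simp
  qed
qed

lemma unit_interval_piece:
  assumes "t \<in> {0..1}" "0 < k"
  obtains m where "m < k" "t \<in> {real m / real k..real (Suc m) / real k}"
proof
  let ?m = "min (nat \<lfloor>real k * t\<rfloor>) (k - 1)"
  show "?m < k" using assms by simp
  have 0: "0 \<le> real k * t" "real k * t \<le> real k" using assms by (auto intro: mult_left_le)
  have "real (nat \<lfloor>real k * t\<rfloor>) \<le> real k * t" using 0 by simp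
  then have 1: "real ?m \<le> real k * t" by linarith
  have 2: "real k * t \<le> real ?m + 1"
  proof (cases "nat \<lfloor>real k * t\<rfloor> \<le> k - 1")
    case True
    then show ?thesis using 0 by (simp add: min_def)
  next
    case False
    then have "?m = k - 1" by simp
    then show ?thesis using 0 assms(2) by (simp add: of_nat_diff)
  qed
  show "t \<in> {real ?m / real k..real (Suc ?m) / real k}"
    using 1 2 assms(2) by (simp add: field_simps)
qed

lemma path_image_joined:
  assumes "gs \<noteq> []" "\<And>n. Suc n < length gs \<Longrightarrow> pathfinish (gs ! n) = pathstart (gs ! Suc n)"
  shows "path_image (joined gs) = (\<Union>g\<in>set gs. path_image g)"
proof -
  define k where "k = length gs"
  have k: "0 < k" using assms(1) by (simp add: k_def)
  show ?thesis
  proof (intro equalityI subsetI)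
    fix z assume "z \<in> path_image (joined gs)"
    then obtain t where t: "t \<in> {0..1}" "z = joined gs t" by (auto simp: path_image_def)
    obtain m where m: "m < k" "t \<in> {real m / real k..real (Suc m) / real k}"
      using unit_interval_piece[OF t(1) k] .
    then have "z = (gs ! m) (real k * t - real m)"
      using joined_on_piece[of m gs t] assms(2) t by (simp add: k_def)
    moreover have "real k * t - real m \<in> {0..1}" using m k by (auto simp: field_simps)
    ultimately have "z \<in> path_image (gs ! m)" by (auto simp: path_image_def)
    then show "z \<in> (\<Union>g\<in>set gs. path_image g)" using m by (auto simp: k_def)
  next
    fix z assume "z \<in> (\<Union>g\<in>set gs. path_image g)"
    then obtain m s where m: "m < k" and s: "s \<in> {0..1}" "z = (gs ! m) s"
      by (auto simp: k_def path_image_def in_set_conv_nth)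
    define t where "t = (real m + s) / real k"
    have "t \<in> {real m / real k..real (Suc m) / real k}"
      using s k by (auto simp: t_def divide_right_mono)
    then have "joined gs t = z"
      using joined_on_piece[of m gs t] assms(2) s m k by (simp add: k_def t_def)
    moreover have "t \<in> {0..1}" using s m k by (auto simp: t_def field_simps)
    ultimately show "z \<in> path_image (joined gs)" by (auto simp: path_image_def)
  qed
qed

lemma has_vector_derivative_join:
  fixes f :: "real \<Rightarrow> 'b::real_normed_vector"
  assumes "(f has_vector_derivative d) (at t within S)" "(f has_vector_derivative d) (at t within T)"
  shows "(f has_vector_derivative d) (at t within S \<union> T)"
  using assms unfolding has_vector_derivative_def has_derivative_within Lim_within_Un by blast

lemma has_vector_derivative_bot: "(f has_vector_derivative d) bot"
  by (simp add: has_vector_derivative_def has_derivative_def bounded_linear_scaleR_left)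

text \<open>
  Arcs \<open>gs\<close> with velocities \<open>vs\<close> which fit together at all junctions, including that of the last arc
  with the first one: the unit tangent of the joined curve is a closed path.
\<close>
locale smooth_closed_chain =
  fixes gs :: "(real \<Rightarrow> complex) list" and vs :: "(real \<Rightarrow> complex) list"
  assumes gs_nonempty: "gs \<noteq> []"
    and length_vs: "length vs = length gs"
    and velocity: "\<And>m t. m < length gs \<Longrightarrow> (gs ! m has_vector_derivative (vs ! m) t) (at t)"
    and continuous_velocity: "\<And>m. m < length gs \<Longrightarrow> continuous_on {0..1} (vs ! m)"
    and velocity_nonzero: "\<And>m t. m < length gs \<Longrightarrow> t \<in> {0..1} \<Longrightarrow> (vs ! m) t \<noteq> 0"
    and chain: "\<And>m. m < length gs \<Longrightarrow> pathfinish (gs ! m) = pathstart (gs ! (Suc m mod length gs))"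
    and velocity_chain: "\<And>m. m < length gs \<Longrightarrow> (vs ! m) 1 = (vs ! (Suc m mod length gs)) 0"
begin

abbreviation k :: nat where "k \<equiv> length gs"

lemma k_pos: "0 < k" using gs_nonempty by simp

definition tangent :: "real \<Rightarrow> complex" where
  "tangent t = sgn (vector_derivative (joined gs) (at t within {0..1}))"

lemma Suc_chain: "Suc n < k \<Longrightarrow> pathfinish (gs ! n) = pathstart (gs ! Suc n)"
  using chain[of n] by simp

lemma piece_derivative:
  assumes "m < k" "s \<in> {0..1}"
  shows "(joined gs has_vector_derivative real k *\<^sub>R (vs ! m) s)
    (at ((real m + s) / real k) within {real m / real k..real (Suc m) / real k})"
proof (rule has_vector_derivative_transform)
  let ?t = "(real m + s) / real k"
  show "?t \<in> {real m / real k..real (Suc m) / real k}"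
    using assms k_pos by (auto simp: divide_right_mono)
  show "joined gs u = (gs ! m \<circ> (\<lambda>t. real k * t - real m)) u"
    if "u \<in> {real m / real k..real (Suc m) / real k}" for u
    using joined_on_piece[OF assms(1) that Suc_chain] by simp
  have "real k * ?t - real m = s" using k_pos by simp
  then have "(gs ! m has_vector_derivative (vs ! m) s) (at (real k * ?t - real m))"
    using velocity[OF assms(1), of s] by simp
  moreover have "((\<lambda>t. real k * t - real m) has_vector_derivative real k)
      (at ?t within {real m / real k..real (Suc m) / real k})"
    by (auto intro!: derivative_eq_intros simp: has_real_derivative_iff_has_vector_derivative[symmetric])
  ultimately show "(gs ! m \<circ> (\<lambda>t. real k * t - real m) has_vector_derivative real k *\<^sub>R (vs ! m) s)
      (at ?t within {real m / real k..real (Suc m) / real k})"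
    using vector_diff_chain_within has_vector_derivative_at_within by blast
qed

text \<open>
  At a junction the one-sided derivatives of the two adjacent arcs are glued. The point is
  isolated from all other time intervals, within which the derivative is arbitrary.
\<close>
lemma joined_derivative:
  assumes "m < k" "s \<in> {0..1}"
  shows "(joined gs has_vector_derivative real k *\<^sub>R (vs ! m) s) (at ((real m + s) / real k) within {0..1})"
proof -
  let ?t = "(real m + s) / real k"
  define I where "I n = {real n / real k..real (Suc n) / real k}" for n
  have sub: "I n \<subseteq> {0..1}" if "n < k" for n
  proof -
    have "real (Suc n) / real k \<le> 1" using that k_pos by (simp add: field_simps)
    then show ?thesis by (auto simp: I_def intro: order_trans[OF divide_nonneg_nonneg])
  qed
  have UN: "{0..1} = (\<Union>n<k. I n)"
    using sub unit_interval_piece[OF _ k_pos] unfolding I_def by (intro equalityI subsetI) (blast, blast)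
  have each: "(joined gs has_vector_derivative real k *\<^sub>R (vs ! m) s) (at ?t within I n)" if n: "n < k" for n
  proof (cases "?t \<in> I n")
    case True
    then have le: "real n \<le> real m + s" "real m + s \<le> real n + 1"
      using k_pos by (auto simp: I_def divide_le_cancel)
    consider "n = m" | "n = Suc m" "s = 1" | "m = Suc n" "s = 0"
      using le assms(2) by force
    then show ?thesis
    proof cases
      case 1
      then show ?thesis using piece_derivative[OF assms] by (simp add: I_def)
    next
      case 2
      then have v: "(vs ! m) s = (vs ! n) 0" using velocity_chain[of m] n assms(1) by simp
      have t: "?t = (real n + 0) / real k" using 2 by simp
      show ?thesis unfolding v t I_def by (rule piece_derivative[OF n]) simp
    next
      case 3
      then have v: "(vs ! m) s = (vs ! n) 1" using velocity_chain[of n] n assms(1) by simp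
      have t: "?t = (real n + 1) / real k" using 3 by simp
      show ?thesis unfolding v t I_def by (rule piece_derivative[OF n]) simp
    qed
  next
    case False
    have "closed (I n)" by (simp add: I_def)
    then have "at ?t within I n = bot"
      using False trivial_limit_within islimpt_closure_open closed_limpt by (metis)
    then show ?thesis by (simp add: has_vector_derivative_bot)
  qed
  have "(joined gs has_vector_derivative real k *\<^sub>R (vs ! m) s) (at ?t within (\<Union>n<j. I n))" if "j \<le> k" for j
    using that
  proof (induction j)
    case 0
    show ?case by (simp add: has_vector_derivative_bot)
  next
    case (Suc j)
    then show ?case
      using has_vector_derivative_join[OF each[of j]] by (simp add: lessThan_Suc)
  qed
  then show ?thesis using UN by simp
qed

lemma tangent_on_piece:
  assumes "m < k" "s \<in> {0..1}"
  shows "tangent ((real m + s) / real k) = sgn ((vs ! m) s)"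
proof -
  have "(real m + s) / real k \<in> {0..1}" using assms k_pos by (auto simp: field_simps)
  then have "vector_derivative (joined gs) (at ((real m + s) / real k) within {0..1}) = real k *\<^sub>R (vs ! m) s"
    by (intro vector_derivative_within_cbox[of 0 1, simplified]) (auto simp: joined_derivative[OF assms])
  then show ?thesis
    using k_pos by (simp add: tangent_def sgn_scaleR)
qed

lemma tangent_on_piece':
  assumes "m < k" "t \<in> {real m / real k..real (Suc m) / real k}"
  shows "tangent t = sgn ((vs ! m) (real k * t - real m))" "real k * t - real m \<in> {0..1}"
proof -
  show *: "real k * t - real m \<in> {0..1}" using assms k_pos by (auto simp: field_simps)
  have "t = (real m + (real k * t - real m)) / real k" using k_pos by simp
  then show "tangent t = sgn ((vs ! m) (real k * t - real m))"
    using tangent_on_piece[OF assms(1) *] by simp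
qed

lemma path_tangent: "path tangent"
proof -
  define I where "I n = {real n / real k..real (Suc n) / real k}" for n
  have "continuous_on (I n) tangent" if "n < k" for n
  proof -
    have "continuous_on (I n) (\<lambda>t. sgn ((vs ! n) (real k * t - real n)))"
    proof (rule continuous_on_sgn)
      have "(\<lambda>t. real k * t - real n) ` I n \<subseteq> {0..1}"
        using tangent_on_piece'(2)[OF that] by (auto simp: I_def)
      then show "continuous_on (I n) (\<lambda>t. (vs ! n) (real k * t - real n))"
        by (intro continuous_on_compose2[OF continuous_velocity[OF that]] continuous_intros)
      show "\<forall>t\<in>I n. (vs ! n) (real k * t - real n) \<noteq> 0"
        using tangent_on_piece'(2)[OF that] velocity_nonzero[OF that] by (auto simp: I_def)
    qed
    then show ?thesis
      by (rule continuous_on_eq) (use tangent_on_piece'(1)[OF that] in \<open>auto simp: I_def\<close>)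
  qed
  then have "continuous_on (\<Union>n\<in>{..<k}. I n) tangent"
    by (intro continuous_on_closed_Union) (auto simp: I_def)
  moreover have "{0..1} \<subseteq> (\<Union>n\<in>{..<k}. I n)"
    using unit_interval_piece[OF _ k_pos] unfolding I_def by blast
  ultimately show ?thesis
    unfolding path_def by (rule continuous_on_subset)
qed

lemma tangent_nonzero: "0 \<notin> path_image tangent"
proof
  assume "0 \<in> path_image tangent"
  then obtain t where t: "t \<in> {0..1}" "tangent t = 0" by (auto simp: path_image_def)
  obtain m where m: "m < k" "t \<in> {real m / real k..real (Suc m) / real k}"
    using unit_interval_piece[OF t(1) k_pos] .
  then show False using tangent_on_piece'[OF m] velocity_nonzero[OF m(1)] t(2) by (simp add: sgn_zero_iff)
qed

lemma whitney_degree_eq_winding_number: "whitney_degree (joined gs) = winding_number tangent 0"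
  by (simp add: whitney_degree_def tangent_def[abs_def])

text \<open>
  The unit tangent is a closed path. This will show that the number of half turns along a curve is
  even.
\<close>
lemma whitney_degree_in_Ints: "whitney_degree (joined gs) \<in> \<int>"
  unfolding whitney_degree_eq_winding_number
proof (rule integer_winding_number[OF path_tangent _ tangent_nonzero])
  have "tangent 1 = sgn ((vs ! (k - 1)) 1)"
    using tangent_on_piece[of "k - 1" 1] k_pos by (simp add: of_nat_diff)
  also have "\<dots> = sgn ((vs ! 0) 0)" using velocity_chain[of "k - 1"] k_pos by simp
  also have "\<dots> = tangent 0" using tangent_on_piece[of 0 0] gs_nonempty by simp
  finally show "pathfinish tangent = pathstart tangent" by (simp add: pathfinish_def pathstart_def)
qed

lemma whitney_degree_joined:
  "whitney_degree (joined gs) = (\<Sum>m<k. winding_number (\<lambda>t. sgn ((vs ! m) t)) 0)"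
proof -
  have "winding_number (subpath 0 (real j / real k) tangent) 0 =
      (\<Sum>m<j. winding_number (\<lambda>t. sgn ((vs ! m) t)) 0)" if "j \<le> k" for j
    using that
  proof (induction j)
    case 0
    have "0 \<noteq> tangent 0" using tangent_nonzero by (metis pathstart_def pathstart_in_path_image)
    then show ?case by simp
  next
    case (Suc j)
    have "winding_number (subpath (real j / real k) (real (Suc j) / real k) tangent) 0 =
        winding_number (\<lambda>t. sgn ((vs ! j) t)) 0"
    proof (rule winding_number_cong)
      fix t :: real assume t: "0 \<le> t" "t \<le> 1"
      have "(real (Suc j) / real k - real j / real k) * t + real j / real k = (real j + t) / real k"
        by (simp add: field_simps add_divide_distrib diff_divide_distrib)
      then show "subpath (real j / real k) (real (Suc j) / real k) tangent t = sgn ((vs ! j) t)"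
        using tangent_on_piece[of j t] t Suc.prems by (simp add: subpath_def)
    qed
    moreover have "winding_number (subpath 0 (real j / real k) tangent) 0 +
        winding_number (subpath (real j / real k) (real (Suc j) / real k) tangent) 0 =
        winding_number (subpath 0 (real (Suc j) / real k) tangent) 0"
      using Suc.prems k_pos by (intro winding_number_subpath_combine[OF path_tangent tangent_nonzero]) (auto simp: field_simps)
    ultimately show ?case using Suc by simp
  qed
  from this[of k] show ?thesis
    using k_pos by (simp add: whitney_degree_eq_winding_number)
qed

end

section \<open>Oriented points and the arcs that leave them\<close>

text \<open>
  A dart is a point of the diagram with a direction of travel, upwards if the flag is true. It
  determines the arc along which the point is left.
\<close>
type_synonym dart = "(nat \<times> nat) \<times> bool"

definition flip :: "dart \<Rightarrow> dart" where
  "flip x = (fst x, \<not> snd x)"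

lemma flip_simps [simp]: "flip (q, u) = (q, \<not> u)" "flip (flip x) = x" "fst (flip x) = fst x"
  "flip x = flip y \<longleftrightarrow> x = y" "flip x \<noteq> x" "x \<noteq> flip x"
  by (auto simp: flip_def prod_eq_iff)

lemma fst_eq_iff: "fst x = fst y \<longleftrightarrow> y = x \<or> y = flip x"
  by (cases x; cases y) (auto simp: flip_def)

definition place :: "nat \<times> nat \<Rightarrow> complex" where
  "place q = Complex (real (snd q)) (real (fst q))"

lemma place_eq_iff [simp]: "place q = place q' \<longleftrightarrow> q = q'"
  by (auto simp: place_def prod_eq_iff)

definition heading :: "bool \<Rightarrow> complex" where
  "heading u = (if u then \<i> else - \<i>)"

definition strands :: "slice \<Rightarrow> nat \<Rightarrow> (nat \<times> nat) set" where
  "strands s w = through s w \<union>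
     (if is_crossing (fst s) then {(snd s, snd s + 1), (snd s + 1, snd s)} else {})"

lemma mem_strands:
  "(j, j') \<in> strands (p, i) w \<longleftrightarrow> j < i \<and> j' = j \<or>
     i + ins p \<le> j \<and> j < w \<and> j' + ins p = j + outs p \<or>
     is_crossing p \<and> (j = i \<and> j' = i + 1 \<or> j = i + 1 \<and> j' = i)"
proof -
  have "(\<exists>k. j = k + ins p \<and> j' = k + outs p \<and> i \<le> k \<and> k + ins p < w) \<longleftrightarrow>
      i + ins p \<le> j \<and> j < w \<and> j' + ins p = j + outs p"
    by (auto intro!: exI[of _ "j - ins p"])
  then show ?thesis
    by (simp add: strands_def conj_commute) blast
qed

lemma is_crossing_simps [simp]: "\<not> is_crossing Maximum" "\<not> is_crossing Minimum" "is_crossing Over_NW"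
  "is_crossing Over_NE" "is_crossing Virtual"
  by (auto simp: is_crossing_def is_classical_def)

text \<open>
  An edge runs from a dart to the next one along an arc. The integer counts the half turns of the
  tangent, positive if they are counterclockwise. Extrema are listed from left to right; \<open>edge\<close>
  adds the arcs run through backwards.
\<close>
inductive forward_edge :: "slice list \<Rightarrow> dart \<Rightarrow> dart \<Rightarrow> (real \<Rightarrow> complex) \<Rightarrow> int \<Rightarrow> bool" for K where
  strand: "n < length K \<Longrightarrow> (j, j') \<in> strands (K ! n) (width K n) \<Longrightarrow>
    forward_edge K ((n, j), True) ((Suc n, j'), True) (strand_arc n j j') 0"
| Maximum: "n < length K \<Longrightarrow> K ! n = (Maximum, i) \<Longrightarrow>
    forward_edge K ((n, i), True) ((n, i + 1), False) (maximum_arc n i) (- 1)"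
| Minimum: "n < length K \<Longrightarrow> K ! n = (Minimum, i) \<Longrightarrow>
    forward_edge K ((Suc n, i), False) ((Suc n, i + 1), True) (minimum_arc n i) 1"

definition edge :: "slice list \<Rightarrow> dart \<Rightarrow> dart \<Rightarrow> (real \<Rightarrow> complex) \<Rightarrow> int \<Rightarrow> bool" where
  "edge K x y g h \<longleftrightarrow> forward_edge K x y g h \<or>
     (\<exists>g'. g = reversepath g' \<and> forward_edge K (flip y) (flip x) g' (- h))"

lemma edge_flip: "edge K x y g h \<Longrightarrow> edge K (flip y) (flip x) (reversepath g) (- h)"
  by (auto simp: edge_def)

lemma edge_induct [consumes 1, case_names forward flip]:
  assumes "edge K x y g h"
    and "\<And>x y g h. forward_edge K x y g h \<Longrightarrow> P x y g h"
    and "\<And>x y g h. forward_edge K x y g h \<Longrightarrow> P x y g h \<Longrightarrow> P (flip y) (flip x) (reversepath g) (- h)"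
  shows "P x y g h"
  using assms(1) unfolding edge_def
proof
  assume "\<exists>g'. g = reversepath g' \<and> forward_edge K (flip y) (flip x) g' (- h)"
  then obtain g' where g': "g = reversepath g'" "forward_edge K (flip y) (flip x) g' (- h)" by blast
  show ?thesis using assms(3)[OF g'(2) assms(2)[OF g'(2)]] g'(1) by simp
qed (rule assms(2))


text \<open>
  The tangent of the arc \<open>g\<close> with velocity \<open>v\<close> makes \<open>h\<close> half turns; the flags give the directions at
  the two ends. The last part determines \<open>h\<close> by means of a ray that the velocity avoids. This form
  carries over to the reversed arc, with \<open>- c\<close> in place of \<open>c\<close>.
\<close>
definition has_turn :: "(real \<Rightarrow> complex) \<Rightarrow> bool \<Rightarrow> bool \<Rightarrow> int \<Rightarrow> (real \<Rightarrow> complex) \<Rightarrow> bool" where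
  "has_turn g u u' h v \<longleftrightarrow> (\<forall>t. (g has_vector_derivative v t) (at t)) \<and> continuous_on {0..1} v \<and>
     v 0 = heading u \<and> v 1 = heading u' \<and>
     (\<exists>c. c \<noteq> 0 \<and> (\<forall>t\<in>{0..1}. c * v t \<notin> \<real>\<^sub>\<le>\<^sub>0) \<and>
       (Ln (c * heading u') - Ln (c * heading u)) / (2 * of_real pi * \<i>) = of_int h / 2)"

lemma has_turn_nonzero: "has_turn g u u' h v \<Longrightarrow> t \<in> {0..1} \<Longrightarrow> v t \<noteq> 0"
  unfolding has_turn_def by (metis mult_zero_right nonpos_Reals_zero_I)

lemma sgn_nonpos_Reals_iff:
  fixes c z :: complex
  assumes "z \<noteq> 0"
  shows "c * sgn z \<in> \<real>\<^sub>\<le>\<^sub>0 \<longleftrightarrow> c * z \<in> \<real>\<^sub>\<le>\<^sub>0"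
proof -
  define r where "r = inverse (norm z)"
  have r: "0 < r" using assms by (simp add: r_def)
  have "c * sgn z = r *\<^sub>R (c * z)"
    by (simp add: sgn_div_norm r_def)
  also have "\<dots> \<in> \<real>\<^sub>\<le>\<^sub>0 \<longleftrightarrow> c * z \<in> \<real>\<^sub>\<le>\<^sub>0"
    using r by (simp add: complex_nonpos_Reals_iff mult_le_0_iff)
  finally show ?thesis .
qed

lemma has_turnD:
  assumes "has_turn g u u' h v"
  shows "(g has_vector_derivative v t) (at t)" "continuous_on {0..1} v"
    and "v 0 = heading u" "v 1 = heading u'"
  using assms unfolding has_turn_def by blast+

lemma has_turnI:
  assumes "\<And>t. (g has_vector_derivative v t) (at t)" "continuous_on {0..1} v"
    and "v 0 = heading u" "v 1 = heading u'"
    and "c \<noteq> 0" "\<And>t. t \<in> {0..1} \<Longrightarrow> c * v t \<notin> \<real>\<^sub>\<le>\<^sub>0"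
    and "(Ln (c * heading u') - Ln (c * heading u)) / (2 * of_real pi * \<i>) = of_int h / 2"
  shows "has_turn g u u' h v"
  using assms unfolding has_turn_def by blast

lemma has_turn_winding_number:
  assumes "has_turn g u u' h v"
  shows "winding_number (\<lambda>t. sgn (v t)) 0 = of_int h / 2"
proof -
  obtain c where c: "c \<noteq> 0" "\<forall>t\<in>{0..1}. c * v t \<notin> \<real>\<^sub>\<le>\<^sub>0"
    and h: "(Ln (c * heading u') - Ln (c * heading u)) / (2 * of_real pi * \<i>) = of_int h / 2"
    using assms unfolding has_turn_def by - (elim conjE exE, rule that)
  have "path (\<lambda>t. sgn (v t))"
    unfolding path_def
    by (rule continuous_on_sgn) (use has_turnD(2)[OF assms] has_turn_nonzero[OF assms] in auto)
  moreover have "c * sgn (v t) \<notin> \<real>\<^sub>\<le>\<^sub>0" if "t \<in> {0..1}" for t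
    using c(2) that has_turn_nonzero[OF assms that] sgn_nonpos_Reals_iff by blast
  ultimately have "winding_number (\<lambda>t. sgn (v t)) 0 =
      (Ln (c * pathfinish (\<lambda>t. sgn (v t))) - Ln (c * pathstart (\<lambda>t. sgn (v t)))) / (2 * of_real pi * \<i>)"
    using c(1) by (intro winding_number_Ln)
  moreover have "pathfinish (\<lambda>t. sgn (v t)) = heading u'" "pathstart (\<lambda>t. sgn (v t)) = heading u"
    using has_turnD(3,4)[OF assms] by (simp_all add: pathfinish_def pathstart_def heading_def sgn_div_norm)
  ultimately show ?thesis using h by (simp only:)
qed

lemma has_turn_reversepath:
  assumes "has_turn g u u' h v"
  shows "has_turn (reversepath g) (\<not> u') (\<not> u) (- h) (\<lambda>t. - v (1 - t))"
proof -
  obtain c where c: "c \<noteq> 0" "\<forall>t\<in>{0..1}. c * v t \<notin> \<real>\<^sub>\<le>\<^sub>0"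
    and h: "(Ln (c * heading u') - Ln (c * heading u)) / (2 * of_real pi * \<i>) = of_int h / 2"
    using assms unfolding has_turn_def by - (elim conjE exE, rule that)
  have neg: "heading (\<not> u) = - heading u" for u by (simp add: heading_def)
  show ?thesis
  proof (rule has_turnI[where c = "- c"])
    fix t :: real
    have "((\<lambda>t. 1 - t) has_real_derivative - 1) (at t)"
      by (auto intro!: derivative_eq_intros)
    then have "((\<lambda>t. 1 - t) has_vector_derivative - 1) (at t)"
      by (simp only: has_real_derivative_iff_has_vector_derivative)
    moreover have "(g has_vector_derivative v (1 - t)) (at (1 - t))" by (rule has_turnD(1)[OF assms])
    ultimately have "(g \<circ> (\<lambda>t. 1 - t) has_vector_derivative - 1 *\<^sub>R v (1 - t)) (at t)"
      by (rule vector_diff_chain_at)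
    moreover have "g \<circ> (\<lambda>t. 1 - t) = reversepath g" by (simp add: reversepath_def o_def)
    ultimately show "(reversepath g has_vector_derivative - v (1 - t)) (at t)"
      by (simp only: scaleR_minus1_left)
  next
    show "continuous_on {0..1} (\<lambda>t. - v (1 - t))"
      by (intro continuous_on_minus continuous_on_compose2[OF has_turnD(2)[OF assms]])
        (auto intro: continuous_intros)
  next
    show "- v (1 - 0) = heading (\<not> u')" "- v (1 - 1) = heading (\<not> u)"
      using has_turnD(3,4)[OF assms] by (simp_all add: neg)
  next
    show "(Ln (- c * heading (\<not> u)) - Ln (- c * heading (\<not> u'))) / (2 * of_real pi * \<i>) = of_int (- h) / 2"
    proof -
      have "Ln (- c * heading (\<not> u)) - Ln (- c * heading (\<not> u')) =
          - (Ln (c * heading u') - Ln (c * heading u))" by (simp add: neg)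
      then show ?thesis using h by (simp only: minus_divide_left[symmetric] of_int_minus)
    qed
  next
    show "- c * - v (1 - t) \<notin> \<real>\<^sub>\<le>\<^sub>0" if "t \<in> {0..1}" for t
      using bspec[OF c(2), of "1 - t"] that by simp
  qed (use c(1) in simp)
qed

lemma Complex_has_vector_derivative:
  assumes "(f has_real_derivative a) (at t)" "(g has_real_derivative b) (at t)"
  shows "((\<lambda>t. Complex (f t) (g t)) has_vector_derivative Complex a b) (at t)"
proof -
  have "((\<lambda>t. of_real (f t) + \<i> * of_real (g t)) has_vector_derivative (of_real a + \<i> * of_real b)) (at t)"
    using assms by (intro has_vector_derivative_add has_vector_derivative_mult_right has_vector_derivative_of_real)
  then show ?thesis by (simp add: Complex_eq)
qed

lemma has_turn_strand_arc:
  "has_turn (strand_arc n j j') True True 0 (\<lambda>t. Complex ((real j' - real j) * (6 * t - 6 * t\<^sup>2)) 1)"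
proof (rule has_turnI[where c = "- \<i>"])
  show "(strand_arc n j j' has_vector_derivative Complex ((real j' - real j) * (6 * t - 6 * t\<^sup>2)) 1) (at t)" for t
    unfolding strand_arc_def ease_def
    by (intro Complex_has_vector_derivative)
      (auto intro!: derivative_eq_intros simp: algebra_simps power2_eq_square)
  show "continuous_on {0..1} (\<lambda>t. Complex ((real j' - real j) * (6 * t - 6 * t\<^sup>2)) 1)"
    unfolding Complex_eq by (intro continuous_intros)
  show "- \<i> * Complex ((real j' - real j) * (6 * t - 6 * t\<^sup>2)) 1 \<notin> \<real>\<^sub>\<le>\<^sub>0" for t
    by (simp add: complex_nonpos_Reals_iff)
  show "(Ln (- \<i> * heading True) - Ln (- \<i> * heading True)) / (2 * of_real pi * \<i>) = of_int 0 / 2"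
    by (simp add: heading_def field_simps)
qed (simp_all add: heading_def complex_eq_iff)

lemma has_turn_maximum_arc:
  "has_turn (maximum_arc n i) True False (- 1) (\<lambda>t. Complex (6 * t - 6 * t\<^sup>2) (1 - 2 * t))"
proof (rule has_turnI[where c = "1"])
  show "(maximum_arc n i has_vector_derivative Complex (6 * t - 6 * t\<^sup>2) (1 - 2 * t)) (at t)" for t
    unfolding maximum_arc_def ease_def
    by (intro Complex_has_vector_derivative)
      (auto intro!: derivative_eq_intros simp: algebra_simps power2_eq_square)
  show "continuous_on {0..1} (\<lambda>t. Complex (6 * t - 6 * t\<^sup>2) (1 - 2 * t))"
    unfolding Complex_eq by (intro continuous_intros)
  show "1 * Complex (6 * t - 6 * t\<^sup>2) (1 - 2 * t) \<notin> \<real>\<^sub>\<le>\<^sub>0" for t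
    proof
      assume "1 * Complex (6 * t - 6 * t\<^sup>2) (1 - 2 * t) \<in> \<real>\<^sub>\<le>\<^sub>0"
      then have "6 * t - 6 * t\<^sup>2 \<le> 0" "t = 1/2" by (simp_all add: complex_nonpos_Reals_iff)
      then show False by (simp add: power2_eq_square)
    qed
  show "(Ln (1 * heading False) - Ln (1 * heading True)) / (2 * of_real pi * \<i>) = of_int (- 1) / 2"
    by (simp add: heading_def field_simps)
qed (simp_all add: heading_def complex_eq_iff)

lemma has_turn_minimum_arc:
  "has_turn (minimum_arc n i) False True 1 (\<lambda>t. Complex (6 * t - 6 * t\<^sup>2) (2 * t - 1))"
proof (rule has_turnI[where c = "1"])
  show "(minimum_arc n i has_vector_derivative Complex (6 * t - 6 * t\<^sup>2) (2 * t - 1)) (at t)" for t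
    unfolding minimum_arc_def ease_def
    by (intro Complex_has_vector_derivative)
      (auto intro!: derivative_eq_intros simp: algebra_simps power2_eq_square)
  show "continuous_on {0..1} (\<lambda>t. Complex (6 * t - 6 * t\<^sup>2) (2 * t - 1))"
    unfolding Complex_eq by (intro continuous_intros)
  show "1 * Complex (6 * t - 6 * t\<^sup>2) (2 * t - 1) \<notin> \<real>\<^sub>\<le>\<^sub>0" for t
    proof
      assume "1 * Complex (6 * t - 6 * t\<^sup>2) (2 * t - 1) \<in> \<real>\<^sub>\<le>\<^sub>0"
      then have "6 * t - 6 * t\<^sup>2 \<le> 0" "t = 1/2" by (simp_all add: complex_nonpos_Reals_iff)
      then show False by (simp add: power2_eq_square)
    qed
  show "(Ln (1 * heading True) - Ln (1 * heading False)) / (2 * of_real pi * \<i>) = of_int 1 / 2"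
    by (simp add: heading_def field_simps)
qed (simp_all add: heading_def complex_eq_iff)

lemma edge_has_turn:
  assumes "edge K x y g h"
  shows "\<exists>v. has_turn g (snd x) (snd y) h v"
  using assms
proof (induction rule: edge_induct)
  case (forward x y g h)
  then show ?case
    by cases (simp_all, (blast intro: has_turn_strand_arc has_turn_maximum_arc has_turn_minimum_arc)+)
next
  case (flip x y g h)
  then obtain v where "has_turn g (snd x) (snd y) h v" by blast
  from has_turn_reversepath[OF this] show ?case by (auto simp: flip_def)
qed

lemma ease_simps [simp]: "ease 0 = 0" "ease 1 = 1"
  by (simp_all add: ease_def)

lemma edge_ends:
  assumes "edge K x y g h"
  shows "pathstart g = place (fst x) \<and> pathfinish g = place (fst y)"
  using assms
proof (induction rule: edge_induct)
  case (forward x y g h)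
  then show ?case
    by cases (auto simp: pathstart_def pathfinish_def place_def strand_arc_def maximum_arc_def minimum_arc_def)
qed simp

lemma mult_one_minus_bounds:
  assumes "t \<in> {0..1::real}"
  shows "0 \<le> t * (1 - t)" "t * (1 - t) < 1"
proof -
  show "0 \<le> t * (1 - t)" using assms by simp
  have "0 \<le> (t - 1/2)\<^sup>2" by simp
  then show "t * (1 - t) < 1" by (simp add: power2_eq_square field_simps)
qed

text \<open>
  Between its ends an arc meets no point of the diagram. Hence a plane curve, as a set, knows the
  points that a traversal has visited.
\<close>
lemma edge_lattice_points:
  assumes "edge K x y g h" "place q \<in> path_image g"
  shows "q = fst x \<or> q = fst y"
  using assms
proof (induction arbitrary: q rule: edge_induct)
  case (forward x y g h)
  obtain t where t: "t \<in> {0..1}" "g t = place q" using forward.prems by (auto simp: path_image_def)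
  have "t = 0 \<or> t = 1"
    using forward.hyps
  proof cases
    case (strand n j j')
    then have "real n + t = real (fst q)" using t(2) by (simp add: strand_arc_def place_def)
    moreover have "fst q = n \<or> fst q = Suc n \<or> fst q < n \<or> fst q \<ge> n + 2" by linarith
    ultimately show ?thesis using t(1) by auto
  next
    case (Maximum n i)
    then have "real n + t * (1 - t) = real (fst q)" using t(2) by (simp add: maximum_arc_def place_def)
    moreover have "fst q = n \<or> fst q < n \<or> fst q \<ge> n + 1" by linarith
    ultimately have "t * (1 - t) = 0" using mult_one_minus_bounds[OF t(1)] by linarith
    then show ?thesis by auto
  next
    case (Minimum n i)
    then have "real (Suc n) - t * (1 - t) = real (fst q)" using t(2) by (simp add: minimum_arc_def place_def)
    moreover have "fst q = Suc n \<or> fst q \<le> n \<or> fst q > Suc n" by linarith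
    ultimately have "t * (1 - t) = 0" using mult_one_minus_bounds[OF t(1)] by linarith
    then show ?thesis by auto
  qed
  moreover have "edge K x y g h" using forward.hyps by (simp add: edge_def)
  then have "g 0 = place (fst x)" "g 1 = place (fst y)"
    using edge_ends by (auto simp: pathstart_def pathfinish_def)
  ultimately show ?case using t(2) by auto
qed auto

text \<open>
  Two arcs may have both ends in common, as the two halves of a circle do. They are told apart by
  the side of a common end on which they lie.
\<close>
definition leaves_on_side :: "(real \<Rightarrow> complex) \<Rightarrow> nat \<Rightarrow> bool \<Rightarrow> bool" where
  "leaves_on_side g n u \<longleftrightarrow>
     (\<forall>z\<in>path_image g. if u then real n \<le> Im z else Im z \<le> real n) \<and> (\<exists>z\<in>path_image g. Im z \<noteq> real n)"

lemma edge_side: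
  assumes "edge K x y g h"
  shows "leaves_on_side g (fst (fst x)) (snd x) \<and> leaves_on_side g (fst (fst y)) (\<not> snd y)"
  using assms
proof (induction rule: edge_induct)
  case (forward x y g h)
  have half: "g (1/2) \<in> path_image g" by (auto simp: path_image_def)
  have "\<exists>z\<in>path_image g. Im z \<noteq> real (fst (fst x))" "\<exists>z\<in>path_image g. Im z \<noteq> real (fst (fst y))"
    using forward by (cases; intro bexI[OF _ half]; simp add: strand_arc_def maximum_arc_def minimum_arc_def)+
  moreover have "\<forall>z\<in>path_image g. if snd x then real (fst (fst x)) \<le> Im z else Im z \<le> real (fst (fst x))"
    "\<forall>z\<in>path_image g. if \<not> snd y then real (fst (fst y)) \<le> Im z else Im z \<le> real (fst (fst y))"
    using forward mult_one_minus_bounds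
    by (cases; auto simp: path_image_def strand_arc_def maximum_arc_def minimum_arc_def)+
  ultimately show ?case by (simp add: leaves_on_side_def)
qed (auto simp: flip_def leaves_on_side_def)

lemma leaves_on_side_unique: "leaves_on_side g n u \<Longrightarrow> leaves_on_side g' n u' \<Longrightarrow> path_image g = path_image g' \<Longrightarrow> u = u'"
  unfolding leaves_on_side_def by (metis (full_types) order_antisym)

lemma edge_distinct_ends: "edge K x y g h \<Longrightarrow> fst x \<noteq> fst y"
proof (induction rule: edge_induct)
  case (forward x y g h)
  then show ?case by cases auto
qed auto

lemma arcs_eq_forward: "arcs K = {g. \<exists>x y h. forward_edge K x y g h}"
proof (intro equalityI subsetI CollectI)
  fix g assume "g \<in> arcs K"
  then obtain n where n: "n < length K" and "g \<in> piece_arcs n (K ! n) \<union>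
     {strand_arc n j j' | j j'. (j, j') \<in> through (K ! n) (width K n)}" by (auto simp: arcs_def)
  then consider "g \<in> piece_arcs n (K ! n)" | j j' where "g = strand_arc n j j'" "(j, j') \<in> through (K ! n) (width K n)"
    by auto
  then show "\<exists>x y h. forward_edge K x y g h"
  proof cases
    case 1
    obtain p i where pi: "K ! n = (p, i)" by force
    show ?thesis
    proof (cases "is_crossing p")
      case True
      then have "g = strand_arc n i (i + 1) \<or> g = strand_arc n (i + 1) i"
        using 1 pi by (auto simp: is_crossing_def is_classical_def)
      moreover have "(i, i + 1) \<in> strands (K ! n) (width K n)" "(i + 1, i) \<in> strands (K ! n) (width K n)"
        using True pi by (auto simp: strands_def)
      ultimately show ?thesis using forward_edge.strand[OF n] by blast
    next
      case False
      then have "p = Maximum \<and> g = maximum_arc n i \<or> p = Minimum \<and> g = minimum_arc n i"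
        using 1 pi by (cases p) (auto simp: is_crossing_def is_classical_def)
      then show ?thesis using forward_edge.Maximum[OF n] forward_edge.Minimum[OF n] pi by blast
    qed
  next
    case 2
    then have "(j, j') \<in> strands (K ! n) (width K n)" by (simp add: strands_def)
    then show ?thesis using forward_edge.strand[OF n] 2 by blast
  qed
next
  fix g assume "g \<in> {g. \<exists>x y h. forward_edge K x y g h}"
  then obtain x y h where "forward_edge K x y g h" by blast
  then show "g \<in> arcs K"
  proof cases
    case (strand n j j')
    obtain p i where pi: "K ! n = (p, i)" by force
    then have "g \<in> piece_arcs n (K ! n) \<union>
     {strand_arc n j j' | j j'. (j, j') \<in> through (K ! n) (width K n)}"
      using strand by (cases p) (auto simp: strands_def is_crossing_def is_classical_def split: if_splits)
    then show ?thesis using strand by (auto simp: arcs_def)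
  qed (force simp: arcs_def)+
qed

lemma directed_arcs_eq: "directed_arcs K = {g. \<exists>x y h. edge K x y g h}"
proof (intro equalityI subsetI CollectI)
  fix g assume "g \<in> directed_arcs K"
  then consider "g \<in> arcs K" | g' where "g = reversepath g'" "g' \<in> arcs K"
    by (auto simp: directed_arcs_def)
  then show "\<exists>x y h. edge K x y g h"
  proof cases
    case 1
    then show ?thesis unfolding arcs_eq_forward edge_def by blast
  next
    case 2
    then obtain x y h where "edge K x y g' h" unfolding arcs_eq_forward edge_def by blast
    from edge_flip[OF this] show ?thesis using 2(1) by blast
  qed
next
  fix g assume "g \<in> {g. \<exists>x y h. edge K x y g h}"
  then obtain x y h where "edge K x y g h" by blast
  then show "g \<in> directed_arcs K"
    unfolding edge_def directed_arcs_def arcs_eq_forward by blast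
qed

locale link_diagram =
  fixes K :: "slice list"
  assumes diagram: "diagram K"
begin

lemma slice_fits: "n < length K \<Longrightarrow> K ! n = (p, i) \<Longrightarrow> i + ins p \<le> width K n"
  using diagram by (fastforce simp: diagram_def)

lemma width_Suc: "K ! n = (p, i) \<Longrightarrow> width K (Suc n) = width K n - ins p + outs p"
  by simp

lemma width_length: "width K (length K) = 0"
  using diagram by (simp add: diagram_def)

lemma strands_bounds:
  assumes "n < length K" "(j, j') \<in> strands (K ! n) (width K n)"
  shows "j < width K n" "j' < width K (Suc n)"
proof -
  obtain p i where pi: "K ! n = (p, i)" by force
  have "i + ins p \<le> width K n" using slice_fits[OF assms(1) pi] .
  then show "j < width K n" "j' < width K (Suc n)"
    using assms(2) unfolding width_Suc[OF pi] pi mem_strands by (cases p; fastforce)+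
qed

lemma strands_functional:
  assumes "(j, j') \<in> strands s w"
  shows "(j, k') \<in> strands s w \<Longrightarrow> j' = k'" "(k, j') \<in> strands s w \<Longrightarrow> j = k"
  using assms by (cases s; cases "fst s"; auto simp: mem_strands)+

lemma strands_extrema:
  "(j, j') \<in> strands (Maximum, i) w \<Longrightarrow> j \<noteq> i \<and> j \<noteq> i + 1"
  "(j, j') \<in> strands (Minimum, i) w \<Longrightarrow> j' \<noteq> i \<and> j' \<noteq> i + 1"
  by (auto simp: mem_strands)

lemma strands_total_lower:
  assumes "j < w" "i + ins p \<le> w"
  shows "(\<exists>j'. (j, j') \<in> strands (p, i) w) \<or> p = Maximum \<and> (j = i \<or> j = i + 1)"
proof -
  consider "j < i" | "i \<le> j" "j < i + ins p" | "i + ins p \<le> j" by linarith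
  then show ?thesis
  proof cases
    case 2
    then have "j = i \<or> j = i + 1" "p \<noteq> Minimum" by (cases p; auto)+
    then show ?thesis unfolding mem_strands by (cases p) auto
  next
    case 3
    then have "(j, j - ins p + outs p) \<in> strands (p, i) w" using assms by (simp add: mem_strands)
    then show ?thesis by blast
  qed (auto simp: mem_strands)
qed

lemma strands_total_upper:
  assumes "j' < w - ins p + outs p" "i + ins p \<le> w"
  shows "(\<exists>j. (j, j') \<in> strands (p, i) w) \<or> p = Minimum \<and> (j' = i \<or> j' = i + 1)"
proof -
  consider "j' < i" | "i \<le> j'" "j' < i + outs p" | "i + outs p \<le> j'" by linarith
  then show ?thesis
  proof cases
    case 2
    then have "j' = i \<or> j' = i + 1" "p \<noteq> Maximum" by (cases p; auto)+
    then show ?thesis unfolding mem_strands by (cases p) auto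
  next
    case 3
    then have "i + ins p \<le> j' - outs p + ins p \<and> j' - outs p + ins p < w \<and>
        j' + ins p = j' - outs p + ins p + outs p" using assms by linarith
    then have "(j' - outs p + ins p, j') \<in> strands (p, i) w" unfolding mem_strands by blast
    then show ?thesis by blast
  qed (auto simp: mem_strands)
qed

abbreviation darts :: "dart set" where "darts \<equiv> points K \<times> UNIV"

lemma finite_darts: "finite darts"
  by (simp add: points_def)

lemma flip_in_darts [simp]: "flip x \<in> darts \<longleftrightarrow> x \<in> darts"
  by (cases x) simp

lemma edge_in_darts:
  assumes "edge K x y g h"
  shows "x \<in> darts \<and> y \<in> darts"
  using assms
proof (induction rule: edge_induct)
  case (forward x y g h)
  then show ?case
  proof cases
    case (strand n j j')
    then show ?thesis using strands_bounds[of n j j'] by (auto simp: points_def)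
  next
    case (Maximum n i)
    then show ?thesis using slice_fits[of n Maximum i] by (auto simp: points_def)
  next
    case (Minimum n i)
    then show ?thesis using slice_fits[of n Minimum i] by (auto simp: points_def)
  qed
qed auto

lemma edge_exists:
  assumes "x \<in> darts"
  shows "\<exists>y g h. edge K x y g h"
proof -
  obtain n j u where x: "x = ((n, j), u)" by (cases x) auto
  have n: "n \<le> length K" "j < width K n" using assms by (auto simp: x points_def)
  show ?thesis
  proof (cases u)
    case True
    with x have x: "x = ((n, j), True)" by simp
    have nK: "n < length K" using n width_length by (metis le_neq_implies_less not_less_zero)
    obtain p i where pi: "K ! n = (p, i)" by force
    consider j' where "(j, j') \<in> strands (p, i) (width K n)" | "p = Maximum" "j = i" | "p = Maximum" "j = i + 1"
      using strands_total_lower[OF n(2) slice_fits[OF nK pi]] by blast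
    then show ?thesis
    proof cases
      case 1
      then have "edge K ((n, j), True) ((Suc n, j'), True) (strand_arc n j j') 0"
        using forward_edge.strand[OF nK] pi by (auto simp: edge_def)
      then show ?thesis unfolding x by blast
    next
      case 2
      then have "edge K ((n, j), True) ((n, j + 1), False) (maximum_arc n j) (- 1)"
        using forward_edge.Maximum[OF nK] pi by (auto simp: edge_def)
      then show ?thesis unfolding x by blast
    next
      case 3
      then have "edge K ((n, i), True) ((n, i + 1), False) (maximum_arc n i) (- 1)"
        using forward_edge.Maximum[OF nK] pi by (auto simp: edge_def)
      then have "\<exists>y g h. edge K (flip ((n, i + 1), False)) y g h" using edge_flip by blast
      then show ?thesis unfolding 3 x by simp
    qed
  next
    case False
    with x have x: "x = ((n, j), False)" by simp
    obtain m where m: "n = Suc m" using n by (cases n) auto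
    have mK: "m < length K" using n m by simp
    obtain p i where pi: "K ! m = (p, i)" by force
    have "j < width K m - ins p + outs p" using n(2) m pi by simp
    then consider j' where "(j', j) \<in> strands (p, i) (width K m)" | "p = Minimum" "j = i" | "p = Minimum" "j = i + 1"
      using strands_total_upper[OF _ slice_fits[OF mK pi]] by blast
    then show ?thesis
    proof cases
      case 1
      then have "edge K ((m, j'), True) ((Suc m, j), True) (strand_arc m j' j) 0"
        using forward_edge.strand[OF mK] pi by (auto simp: edge_def)
      then have "\<exists>y g h. edge K (flip ((Suc m, j), True)) y g h" using edge_flip by blast
      then show ?thesis unfolding m x by simp
    next
      case 2
      then have "edge K ((Suc m, j), False) ((Suc m, j + 1), True) (minimum_arc m j) 1"
        using forward_edge.Minimum[OF mK] pi m by (auto simp: edge_def)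
      then show ?thesis unfolding x m by blast
    next
      case 3
      then have "edge K ((n, i), False) ((n, i + 1), True) (minimum_arc m i) 1"
        using forward_edge.Minimum[OF mK] pi m by (auto simp: edge_def)
      then have "\<exists>y g h. edge K (flip ((n, i + 1), True)) y g h" using edge_flip by blast
      then show ?thesis unfolding 3 x by simp
    qed
  qed
qed

lemma forward_edge_unique_target:
  assumes "forward_edge K x y g h" "forward_edge K x y' g' h'"
  shows "y = y' \<and> g = g' \<and> h = h'"
  using assms(1)
proof cases
  case (strand n j j')
  from assms(2)[unfolded strand] show ?thesis
    using strand by cases (auto dest: strands_functional(1) strands_extrema)
next
  case (Maximum n i)
  from assms(2)[unfolded Maximum] show ?thesis
    using Maximum by cases (auto dest: strands_extrema)
next
  case (Minimum n i)
  from assms(2)[unfolded Minimum] show ?thesis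
    using Minimum by cases auto
qed

lemma forward_edge_unique_source:
  assumes "forward_edge K x y g h" "forward_edge K x' y g' h'"
  shows "x = x' \<and> g = g' \<and> h = h'"
  using assms(1)
proof cases
  case (strand n j j')
  from assms(2)[unfolded strand] show ?thesis
    using strand by cases (auto dest: strands_functional(2) strands_extrema)
next
  case (Maximum n i)
  from assms(2)[unfolded Maximum] show ?thesis
    using Maximum by cases auto
next
  case (Minimum n i)
  from assms(2)[unfolded Minimum] show ?thesis
    using Minimum by cases (auto dest: strands_extrema)
qed

lemma forward_edge_no_clash:
  assumes "forward_edge K x y g h" "forward_edge K z (flip x) g' h'"
  shows False
  using assms(1)
proof cases
  case (strand n j j')
  from assms(2)[unfolded strand flip_simps] show ?thesis
    using strand by cases (auto dest: strands_extrema)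
next
  case (Maximum n i)
  from assms(2)[unfolded Maximum flip_simps] show ?thesis
    using Maximum by cases auto
next
  case (Minimum n i)
  from assms(2)[unfolded Minimum flip_simps] show ?thesis
    using Minimum by cases (auto dest: strands_extrema)
qed

lemma edge_unique:
  assumes "edge K x y g h" "edge K x y' g' h'"
  shows "y = y' \<and> g = g' \<and> h = h'"
proof (cases "forward_edge K x y g h")
  case True
  then have "forward_edge K x y' g' h'"
    using assms(2) forward_edge_no_clash unfolding edge_def by blast
  with True show ?thesis by (rule forward_edge_unique_target)
next
  case False
  then obtain k where k: "g = reversepath k" "forward_edge K (flip y) (flip x) k (- h)"
    using assms(1) unfolding edge_def by blast
  then obtain k' where k': "g' = reversepath k'" "forward_edge K (flip y') (flip x) k' (- h')"
    using assms(2) forward_edge_no_clash unfolding edge_def by blast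
  have "flip y = flip y' \<and> k = k' \<and> - h = - h'"
    using k(2) k'(2) by (rule forward_edge_unique_source)
  then show ?thesis using k(1) k'(1) by simp
qed

end

section \<open>Traversals as cycles of a permutation\<close>

context link_diagram
begin

text \<open>
  By \<open>edge_unique\<close> the choices made here are forced. Outside the diagram \<open>nxt\<close> is the identity, which
  makes it a permutation of the whole type.
\<close>
definition nxt :: "dart \<Rightarrow> dart" where
  "nxt x = (if x \<in> darts then SOME y. \<exists>g h. edge K x y g h else x)"

definition arc_of :: "dart \<Rightarrow> real \<Rightarrow> complex" where
  "arc_of x = (SOME g. \<exists>h. edge K x (nxt x) g h)"

definition turn :: "dart \<Rightarrow> int" where
  "turn x = (SOME h. edge K x (nxt x) (arc_of x) h)"

lemma edge_nxt:
  assumes "x \<in> darts"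
  shows "edge K x (nxt x) (arc_of x) (turn x)"
proof -
  have "\<exists>g h. edge K x (nxt x) g h"
    using someI_ex[OF edge_exists[OF assms]] assms by (simp add: nxt_def)
  from someI_ex[OF this] have "\<exists>h. edge K x (nxt x) (arc_of x) h" unfolding arc_of_def .
  from someI_ex[OF this] show ?thesis unfolding turn_def .
qed

lemma nxt_eqI:
  assumes "edge K x y g h"
  shows "nxt x = y" "arc_of x = g" "turn x = h"
proof -
  have "edge K x (nxt x) (arc_of x) (turn x)" using edge_nxt edge_in_darts[OF assms] by blast
  from edge_unique[OF this assms] show "nxt x = y" "arc_of x = g" "turn x = h" by auto
qed

lemma nxt_in_darts: "x \<in> darts \<Longrightarrow> nxt x \<in> darts"
  using edge_nxt edge_in_darts by blast

lemma flip_nxt: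
  assumes "x \<in> darts"
  shows "nxt (flip (nxt x)) = flip x" "arc_of (flip (nxt x)) = reversepath (arc_of x)"
    "turn (flip (nxt x)) = - turn x"
  using nxt_eqI[OF edge_flip[OF edge_nxt[OF assms]]] by auto

lemma fst_nxt: "x \<in> darts \<Longrightarrow> fst (nxt x) \<noteq> fst x"
  using edge_distinct_ends[OF edge_nxt] by metis

lemma arc_ends:
  "x \<in> darts \<Longrightarrow> pathstart (arc_of x) = place (fst x)" "x \<in> darts \<Longrightarrow> pathfinish (arc_of x) = place (fst (nxt x))"
  using edge_ends[OF edge_nxt] by auto

lemma nxt_inj: "x \<in> darts \<Longrightarrow> y \<in> darts \<Longrightarrow> nxt x = nxt y \<Longrightarrow> x = y"
  using flip_nxt(1) by (metis flip_simps(2))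

text \<open>
  Reversing directions turns \<open>nxt\<close> into its inverse, so it is injective on the finite set of darts.
\<close>
lemma nxt_permutes: "nxt permutes darts"
proof (rule bij_imp_permutes)
  have "inj_on nxt darts" using nxt_inj by (meson inj_onI)
  moreover have "nxt ` darts \<subseteq> darts" using nxt_in_darts by blast
  ultimately show "bij_betw nxt darts darts"
    using endo_inj_surj[OF finite_darts] by (simp add: bij_betw_def)
  show "nxt x = x" if "x \<notin> darts" for x using that by (simp add: nxt_def)
qed

lemma permutation_nxt: "permutation nxt"
  using nxt_permutes finite_darts by (meson permutation_permutes)

definition cyc :: "dart \<Rightarrow> dart list" where
  "cyc x = support nxt x"

abbreviation orb :: "dart \<Rightarrow> dart set" where
  "orb x \<equiv> set (cyc x)"

lemma orb_eq_range: "orb x = range (\<lambda>i. (nxt ^^ i) x)"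
  unfolding cyc_def by (rule support_set[OF permutation_nxt])

lemma self_in_orb [simp]: "x \<in> orb x"
  unfolding orb_eq_range by (rule range_eqI[of _ _ 0]) simp

lemma nxt_in_orb:
  assumes "y \<in> orb x"
  shows "nxt y \<in> orb x"
proof -
  obtain i where "y = (nxt ^^ i) x" using assms unfolding orb_eq_range by blast
  then have "nxt y = (nxt ^^ Suc i) x" by simp
  then show ?thesis unfolding orb_eq_range by blast
qed

lemma orb_eqI: "y \<in> orb x \<Longrightarrow> orb y = orb x"
proof -
  assume y: "y \<in> orb x"
  have "disjoint (range orb)" using disjoint_support[OF permutation_nxt] by (simp only: cyc_def)
  then have "orb y \<noteq> orb x \<Longrightarrow> orb y \<inter> orb x = {}" by (rule disjointD) blast+
  then show ?thesis using y self_in_orb by blast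
qed

lemma nxt_image_orb: "nxt ` orb x = orb x"
proof (rule card_subset_eq)
  show "nxt ` orb x \<subseteq> orb x" using nxt_in_orb by blast
  have "inj nxt" using nxt_permutes by (rule permutes_inj)
  then show "card (nxt ` orb x) = card (orb x)" by (intro card_image) (auto intro: inj_on_subset)
qed simp

lemma funpow_in_darts: "x \<in> darts \<Longrightarrow> (nxt ^^ i) x \<in> darts"
  by (induction i) (auto simp: nxt_in_darts simp del: mem_Sigma_iff)

lemma orb_subset_darts: "x \<in> darts \<Longrightarrow> orb x \<subseteq> darts"
  unfolding orb_eq_range using funpow_in_darts by blast

lemma distinct_cyc: "distinct (cyc x)"
  unfolding cyc_def by (rule cycle_of_permutation[OF permutation_nxt])

lemma length_cyc: "length (cyc x) = least_power nxt x"
  by (simp add: cyc_def)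

lemma cyc_nth: "m < length (cyc x) \<Longrightarrow> cyc x ! m = (nxt ^^ m) x"
  by (simp add: cyc_def)

lemma cyc_nonempty: "cyc x \<noteq> []"
  using self_in_orb by (metis empty_iff list.set(1))

lemma cyc_nth_Suc:
  assumes "m < length (cyc x)"
  shows "cyc x ! (Suc m mod length (cyc x)) = nxt (cyc x ! m)"
proof (cases "Suc m = length (cyc x)")
  case True
  have "nxt (cyc x ! m) = (nxt ^^ Suc m) x" using assms by (simp add: cyc_nth)
  also have "\<dots> = x"
    using True least_power_of_permutation(1)[OF permutation_nxt] by (simp only: length_cyc)
  finally show ?thesis using True assms cyc_nth[of 0 x] cyc_nonempty[of x] by simp
next
  case False
  then show ?thesis using assms by (simp add: cyc_nth)
qed

lemma funpow_flip: "x \<in> darts \<Longrightarrow> (nxt ^^ i) (flip ((nxt ^^ i) x)) = flip x"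
proof (induction i)
  case (Suc i)
  have "(nxt ^^ Suc i) (flip ((nxt ^^ Suc i) x)) = (nxt ^^ i) (nxt (flip (nxt ((nxt ^^ i) x))))"
    by (simp add: funpow_swap1)
  also have "\<dots> = flip x"
    using Suc flip_nxt(1)[OF funpow_in_darts[OF Suc.prems]] by simp
  finally show ?case .
qed simp

lemma flip_orb_subset: "x \<in> darts \<Longrightarrow> flip ` orb x \<subseteq> orb (flip x)"
proof
  fix z assume x: "x \<in> darts" and "z \<in> flip ` orb x"
  then obtain i where z: "z = flip ((nxt ^^ i) x)" by (auto simp: orb_eq_range)
  have "flip x \<in> orb z" unfolding z orb_eq_range using funpow_flip[OF x, of i] by (metis rangeI)
  then show "z \<in> orb (flip x)" using orb_eqI self_in_orb by metis
qed

lemma orb_flip: 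
  assumes "x \<in> darts"
  shows "orb (flip x) = flip ` orb x"
proof
  show "flip ` orb x \<subseteq> orb (flip x)" by (rule flip_orb_subset[OF assms])
  have "flip ` orb (flip x) \<subseteq> orb x" using flip_orb_subset[of "flip x"] assms by simp
  then have "flip ` flip ` orb (flip x) \<subseteq> flip ` orb x" by (rule image_mono)
  then show "orb (flip x) \<subseteq> flip ` orb x" by (simp add: image_comp o_def)
qed

text \<open>
  A curve does not run through a point in both directions. If it did, the first and the last step
  of the way from \<open>x\<close> to \<open>flip x\<close> would be reverse to each other. Dropping both steps repeatedly, one
  arrives at a dart that is its own reverse or at an arc with equal ends.
\<close>
lemma funpow_neq_flip: "x \<in> darts \<Longrightarrow> (nxt ^^ m) x \<noteq> flip x"
proof (induction m arbitrary: x rule: less_induct)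
  case (less m)
  consider "m = 0" | "m = 1" | l where "m = Suc (Suc l)" by (cases m; cases "m - 1") auto
  then show ?case
  proof cases
    case 1
    then show ?thesis by simp
  next
    case 2
    then have "(nxt ^^ m) x = nxt x" by simp
    then show ?thesis using fst_nxt[OF less.prems] by (metis flip_simps(3))
  next
    case 3
    show ?thesis
    proof
      assume *: "(nxt ^^ m) x = flip x"
      let ?y = "nxt x"
      have y: "?y \<in> darts" by (rule nxt_in_darts[OF less.prems])
      have "nxt ((nxt ^^ l) ?y) = (nxt ^^ m) x" unfolding 3 by (simp add: funpow_swap1)
      also have "\<dots> = nxt (flip ?y)" using * flip_nxt(1)[OF less.prems] by simp
      finally have "(nxt ^^ l) ?y = flip ?y"
        using nxt_inj[OF funpow_in_darts[OF y]] y by simp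
      then show False using less.IH[of l ?y] 3 y by simp
    qed
  qed
qed

lemma flip_notin_orb: "x \<in> darts \<Longrightarrow> flip x \<notin> orb x"
  unfolding orb_eq_range using funpow_neq_flip by (metis (no_types, lifting) rangeE)

text \<open>
  By \<open>curves_eq\<close> these are the curves of the diagram.
\<close>
definition curve_of :: "dart \<Rightarrow> complex set" where
  "curve_of x = (\<Union>y\<in>orb x. path_image (arc_of y))"

lemma arc_lattice_points:
  "y \<in> darts \<Longrightarrow> place q \<in> path_image (arc_of y) \<Longrightarrow> q = fst y \<or> q = fst (nxt y)"
  using edge_lattice_points[OF edge_nxt] by blast

lemma place_in_arc: "y \<in> darts \<Longrightarrow> place (fst y) \<in> path_image (arc_of y)"
  using arc_ends(1) pathstart_in_path_image by metis

lemma place_in_curve_of: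
  assumes "x \<in> darts"
  shows "place q \<in> curve_of x \<longleftrightarrow> q \<in> fst ` orb x"
proof
  assume "place q \<in> curve_of x"
  then obtain y where y: "y \<in> orb x" "place q \<in> path_image (arc_of y)" by (auto simp: curve_of_def)
  then have "q = fst y \<or> q = fst (nxt y)"
    using arc_lattice_points orb_subset_darts[OF assms] by blast
  then show "q \<in> fst ` orb x" using y(1) nxt_in_orb by blast
next
  assume "q \<in> fst ` orb x"
  then obtain y where "y \<in> orb x" "q = fst y" by blast
  then show "place q \<in> curve_of x"
    using place_in_arc[of y] orb_subset_darts[OF assms] by (auto simp: curve_of_def simp del: mem_Sigma_iff)
qed

text \<open>
  The points on the image of an arc are its ends, which leaves four candidates for a dart with the
  same image. The side of the end on which the arc lies excludes two of them.
\<close>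
lemma arc_image_eq:
  assumes "y \<in> darts" "z \<in> darts" "path_image (arc_of y) = path_image (arc_of z)"
  shows "z = y \<or> z = flip (nxt y)"
proof -
  have z: "leaves_on_side (arc_of z) (fst (fst z)) (snd z)"
    using edge_side[OF edge_nxt[OF assms(2)]] by blast
  have y: "leaves_on_side (arc_of y) (fst (fst y)) (snd y)"
    "leaves_on_side (arc_of y) (fst (fst (nxt y))) (\<not> snd (nxt y))"
    using edge_side[OF edge_nxt[OF assms(1)]] by blast+
  have "fst z = fst y \<or> fst z = fst (nxt y)"
    using arc_lattice_points[OF assms(1)] place_in_arc[OF assms(2)] assms(3) by blast
  then show ?thesis
  proof
    assume *: "fst z = fst y"
    then have "snd y = snd z" using leaves_on_side_unique[OF y(1) _ assms(3)] z by simp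
    then show ?thesis using * by (simp add: prod_eq_iff)
  next
    assume *: "fst z = fst (nxt y)"
    then have "(\<not> snd (nxt y)) = snd z" using leaves_on_side_unique[OF y(2) _ assms(3)] z by simp
    then show ?thesis using * by (simp add: flip_def prod_eq_iff)
  qed
qed

lemma directed_arcs_eq_image: "directed_arcs K = arc_of ` darts"
proof (intro equalityI subsetI)
  fix g assume "g \<in> directed_arcs K"
  then obtain x y h where "edge K x y g h" by (auto simp: directed_arcs_eq)
  then show "g \<in> arc_of ` darts" using nxt_eqI(2) edge_in_darts by blast
next
  fix g assume "g \<in> arc_of ` darts"
  then show "g \<in> directed_arcs K" unfolding directed_arcs_eq using edge_nxt by blast
qed

lemma traversal_cyc:
  assumes "x \<in> darts"
  shows "traversal K (map arc_of (cyc x))"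
  unfolding traversal_def
proof (intro conjI allI impI)
  show "map arc_of (cyc x) \<noteq> []" using cyc_nonempty[of x] by blast
  show "set (map arc_of (cyc x)) \<subseteq> directed_arcs K"
    unfolding directed_arcs_eq_image set_map using orb_subset_darts[OF assms] by (rule image_mono)
  have "inj_on (path_image \<circ> arc_of) (orb x)"
  proof (rule inj_onI)
    fix y z assume yz: "y \<in> orb x" "z \<in> orb x" "(path_image \<circ> arc_of) y = (path_image \<circ> arc_of) z"
    have d: "y \<in> darts" "z \<in> darts" using yz orb_subset_darts[OF assms] by blast+
    show "y = z"
    proof (rule ccontr)
      assume "y \<noteq> z"
      then have "z = flip (nxt y)" using arc_image_eq[OF d] yz(3) by (metis comp_apply)
      moreover have "orb z = orb x" "orb (nxt y) = orb x"
        using orb_eqI yz nxt_in_orb by blast+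
      ultimately show False
        using flip_notin_orb[OF nxt_in_darts[OF d(1)]] self_in_orb by metis
    qed
  qed
  then show "distinct (map path_image (map arc_of (cyc x)))"
    using distinct_cyc by (simp only: map_map distinct_map simp_thms)
next
  fix m assume "m < length (map arc_of (cyc x))"
  then have m: "m < length (cyc x)" by (simp only: length_map)
  have "Suc m mod length (cyc x) < length (cyc x)" using m by (intro mod_less_divisor) linarith
  moreover have "cyc x ! m \<in> darts" using m nth_mem orb_subset_darts[OF assms] by blast
  ultimately show "pathfinish (map arc_of (cyc x) ! m) = pathstart (map arc_of (cyc x) ! (Suc m mod length (map arc_of (cyc x))))"
    using arc_ends nxt_in_darts cyc_nth_Suc[OF m] m by (simp only: length_map nth_map)
qed

text \<open>
  At the end of an arc a traversal can only go on along \<open>nxt\<close> or turn back, and turning back would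
  repeat the image of the arc just travelled. The traversal stops after the least period, because
  no image is repeated.
\<close>
lemma traversal_imp_cyc:
  assumes "traversal K gs"
  shows "\<exists>x\<in>darts. gs = map arc_of (cyc x)"
proof -
  define k where "k = length gs"
  note trav = assms[unfolded traversal_def directed_arcs_eq_image, folded k_def]
  have ne: "gs \<noteq> []" and sub: "set gs \<subseteq> arc_of ` darts" and dist: "distinct (map path_image gs)"
    and ch: "\<forall>m<k. pathfinish (gs ! m) = pathstart (gs ! (Suc m mod k))"
    using trav by blast+
  from ne have k: "0 < k" unfolding k_def by (rule length_greater_0_conv[THEN iffD2])
  have "\<exists>x. x \<in> darts \<and> gs ! m = arc_of x" if "m < k" for m
  proof -
    have "gs ! m \<in> set gs" using that unfolding k_def by (rule nth_mem)
    then show ?thesis using sub by blast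
  qed
  then obtain X where X: "\<And>m. m < k \<Longrightarrow> X m \<in> darts" "\<And>m. m < k \<Longrightarrow> gs ! m = arc_of (X m)" by metis
  have dist': "a = b" if ab: "a < k" "b < k" "path_image (gs ! a) = path_image (gs ! b)" for a b
  proof -
    have "map path_image gs ! a = map path_image gs ! b"
      using ab unfolding k_def by (simp only: nth_map)
    then show ?thesis using nth_eq_iff_index_eq[OF dist] ab unfolding k_def length_map by blast
  qed
  have step: "X (Suc m mod k) = nxt (X m)" if m: "m < k" for m
  proof -
    let ?m' = "Suc m mod k"
    have m': "?m' < k" using k by (rule mod_less_divisor)
    have "place (fst (nxt (X m))) = pathfinish (gs ! m)"
      using arc_ends(2)[OF X(1)[OF m]] X(2)[OF m] by (simp only:)
    also have "\<dots> = pathstart (gs ! ?m')" using ch m by blast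
    also have "\<dots> = place (fst (X ?m'))"
      using arc_ends(1)[OF X(1)[OF m']] X(2)[OF m'] by (simp only:)
    finally have "fst (nxt (X m)) = fst (X ?m')" by (simp only: place_eq_iff)
    then have "X ?m' = nxt (X m) \<or> X ?m' = flip (nxt (X m))" by (simp only: fst_eq_iff)
    moreover have "X ?m' \<noteq> flip (nxt (X m))"
    proof
      assume *: "X ?m' = flip (nxt (X m))"
      have "gs ! ?m' = reversepath (gs ! m)"
        using X(2)[OF m'] X(2)[OF m] flip_nxt(2)[OF X(1)[OF m]] * by (simp only:)
      then have "path_image (gs ! ?m') = path_image (gs ! m)" by (simp only: path_image_reversepath)
      then have "?m' = m" using dist' m m' by blast
      then have "fst (X m) = fst (nxt (X m))" using * by (metis flip_simps(3))
      then show False using fst_nxt[OF X(1)[OF m]] by metis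
    qed
    ultimately show ?thesis by blast
  qed
  have pow: "X m = (nxt ^^ m) (X 0)" if "m < k" for m
    using that
  proof (induction m)
    case (Suc m)
    have "X (Suc m) = nxt (X m)"
      using step[OF Suc_lessD[OF Suc.prems]] Suc.prems by (simp only: mod_less)
    also have "\<dots> = nxt ((nxt ^^ m) (X 0))"
      using Suc.IH[OF Suc_lessD[OF Suc.prems]] by (rule arg_cong)
    finally show ?case by (simp only: funpow.simps comp_apply)
  qed (simp only: funpow_0)
  have "(nxt ^^ k) (X 0) = X 0"
  proof -
    obtain n where n: "k = Suc n" using k by (cases k) auto
    then have nk: "n < k" by simp
    have "(nxt ^^ k) (X 0) = nxt ((nxt ^^ n) (X 0))" unfolding n by (simp only: funpow.simps comp_apply)
    also have "\<dots> = nxt (X n)" using pow[OF nk] by (simp only:)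
    also have "\<dots> = X (Suc n mod k)" using step[OF nk] by (simp only:)
    also have "Suc n mod k = 0" unfolding n by (rule mod_self)
    finally show ?thesis .
  qed
  then have le: "least_power nxt (X 0) \<le> k" using k by (rule least_power_le)
  have "\<not> least_power nxt (X 0) < k"
  proof
    assume lt: "least_power nxt (X 0) < k"
    have "X (least_power nxt (X 0)) = X 0"
      using pow[OF lt] least_power_of_permutation(1)[OF permutation_nxt, of "X 0"] by (rule trans)
    then have "path_image (gs ! least_power nxt (X 0)) = path_image (gs ! 0)"
      unfolding X(2)[OF lt] X(2)[OF k] by (rule arg_cong)
    then have "least_power nxt (X 0) = 0" using dist' lt k by blast
    then show False using least_power_of_permutation(2)[OF permutation_nxt, of "X 0"] by (simp only: less_irrefl)
  qed
  then have len: "length (cyc (X 0)) = k" using le unfolding length_cyc by (simp only: le_less simp_thms)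
  have "gs = map arc_of (cyc (X 0))"
  proof (rule nth_equalityI)
    fix m assume m: "m < length gs"
    then have mk: "m < k" by (simp only: k_def)
    have "cyc (X 0) ! m = X m" unfolding pow[OF mk] by (rule cyc_nth) (simp only: len mk)
    then show "gs ! m = map arc_of (cyc (X 0)) ! m"
      using X(2)[OF mk] mk len by (simp only: nth_map)
  qed (simp only: length_map len k_def)
  then show ?thesis using X(1)[OF k] by (rule bexI)
qed

lemma path_image_joined_cyc:
  assumes "x \<in> darts"
  shows "path_image (joined (map arc_of (cyc x))) = curve_of x"
proof -
  define gs where "gs = map arc_of (cyc x)"
  have "traversal K gs" unfolding gs_def by (rule traversal_cyc[OF assms])
  then have ne: "gs \<noteq> []"
    and ch: "\<forall>m<length gs. pathfinish (gs ! m) = pathstart (gs ! (Suc m mod length gs))"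
    unfolding traversal_def by blast+
  have "pathfinish (gs ! n) = pathstart (gs ! Suc n)" if "Suc n < length gs" for n
    using ch[rule_format, OF Suc_lessD[OF that]] that by (simp only: mod_less)
  then have "path_image (joined gs) = (\<Union>g\<in>set gs. path_image g)"
    by (rule path_image_joined[OF ne])
  also have "\<dots> = curve_of x" by (simp only: gs_def curve_of_def set_map image_image)
  finally show ?thesis by (simp only: gs_def)
qed

end

section \<open>Rotation numbers\<close>

context link_diagram
begin

lemma curves_eq: "curves K = curve_of ` darts"
proof (intro equalityI subsetI)
  fix C assume "C \<in> curves K"
  then obtain gs where "traversal K gs" "C = path_image (joined gs)" by (auto simp: curves_def)
  then show "C \<in> curve_of ` darts" using traversal_imp_cyc path_image_joined_cyc by (metis imageI)
next
  fix C assume "C \<in> curve_of ` darts"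
  then show "C \<in> curves K"
  proof -
    obtain x where x: "x \<in> darts" "C = curve_of x" using \<open>C \<in> curve_of ` darts\<close> by (elim imageE)
    then have "traversal K (map arc_of (cyc x))" "C = path_image (joined (map arc_of (cyc x)))"
      by (simp_all only: traversal_cyc path_image_joined_cyc)
    then show ?thesis unfolding curves_def by blast
  qed
qed

lemma curve_of_flip: 
  assumes "x \<in> darts"
  shows "curve_of (flip x) = curve_of x"
proof -
  have "curve_of (flip x) = (\<Union>y\<in>orb x. path_image (arc_of (flip y)))"
    unfolding curve_of_def orb_flip[OF assms] by (simp only: image_image)
  also have "\<dots> = (\<Union>y\<in>nxt ` orb x. path_image (arc_of (flip y)))" by (simp only: nxt_image_orb)
  also have "\<dots> = (\<Union>y\<in>orb x. path_image (arc_of (flip (nxt y))))" by (simp only: image_image)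
  also have "\<dots> = curve_of x"
    unfolding curve_of_def
  proof (rule SUP_cong[OF refl])
    fix y assume "y \<in> orb x"
    then have "y \<in> darts" using orb_subset_darts[OF assms] by blast
    then show "path_image (arc_of (flip (nxt y))) = path_image (arc_of y)"
      using flip_nxt(2) by (simp only: path_image_reversepath)
  qed
  finally show ?thesis .
qed

text \<open>
  As a set in the plane, a curve forgets only the starting point and the direction of its
  traversals.
\<close>
lemma curve_of_eq_iff:
  assumes "x \<in> darts" "y \<in> darts"
  shows "curve_of y = curve_of x \<longleftrightarrow> y \<in> orb x \<or> flip y \<in> orb x"
proof
  assume "curve_of y = curve_of x"
  then have "place (fst y) \<in> curve_of x" using place_in_curve_of[OF assms(2)] self_in_orb by blast
  then obtain z where z: "z \<in> orb x" "fst y = fst z" using place_in_curve_of[OF assms(1)] by blast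
  then show "y \<in> orb x \<or> flip y \<in> orb x" using fst_eq_iff[of y z] by auto
next
  have "curve_of y = curve_of x" if "y \<in> orb x" for y using orb_eqI[OF that] by (simp add: curve_of_def)
  moreover have "curve_of y = curve_of (flip y)" by (rule curve_of_flip[OF assms(2), symmetric])
  ultimately show "curve_of y = curve_of x" if "y \<in> orb x \<or> flip y \<in> orb x" using that by metis
qed

definition total_turn :: "dart \<Rightarrow> int" where
  "total_turn x = (\<Sum>y\<in>orb x. turn y)"

lemma total_turn_flip:
  assumes "x \<in> darts"
  shows "total_turn (flip x) = - total_turn x"
proof -
  have "inj flip" by (rule injI) simp
  then have "total_turn (flip x) = (\<Sum>y\<in>orb x. turn (flip y))"
    unfolding total_turn_def orb_flip[OF assms] by (subst sum.reindex) (auto intro: inj_on_subset)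
  also have "\<dots> = (\<Sum>y\<in>nxt ` orb x. turn (flip y))" by (simp only: nxt_image_orb)
  also have "\<dots> = (\<Sum>y\<in>orb x. turn (flip (nxt y)))"
    using permutes_inj[OF nxt_permutes] by (subst sum.reindex) (auto intro: inj_on_subset)
  also have "\<dots> = (\<Sum>y\<in>orb x. - turn y)"
  proof (rule sum.cong[OF refl])
    fix y assume "y \<in> orb x"
    then have "y \<in> darts" using orb_subset_darts[OF assms] by blast
    then show "turn (flip (nxt y)) = - turn y" by (rule flip_nxt(3))
  qed
  finally show ?thesis by (simp add: total_turn_def sum_negf)
qed

lemma whitney_degree_cyc:
  assumes "x \<in> darts"
  shows "whitney_degree (joined (map arc_of (cyc x))) = of_int (total_turn x) / 2"
    and "even (total_turn x)"
proof -
  define vel where "vel y = (SOME v. has_turn (arc_of y) (snd y) (snd (nxt y)) (turn y) v)" for y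
  have vel: "has_turn (arc_of y) (snd y) (snd (nxt y)) (turn y) (vel y)" if "y \<in> darts" for y
    using someI_ex[OF edge_has_turn[OF edge_nxt[OF that]]] unfolding vel_def .
  let ?k = "length (cyc x)"
  have cyc: "cyc x ! m \<in> darts" if "m < ?k" for m
    using nth_mem[OF that] orb_subset_darts[OF assms] by blast
  have k: "0 < ?k" using cyc_nonempty[of x] by blast
  interpret smooth_closed_chain "map arc_of (cyc x)" "map vel (cyc x)"
  proof
    show "map arc_of (cyc x) \<noteq> []" using cyc_nonempty[of x] by blast
    show "length (map vel (cyc x)) = length (map arc_of (cyc x))" by (simp only: length_map)
  next
    fix m assume "m < length (map arc_of (cyc x))"
    then have m: "m < ?k" by (simp only: length_map)
    note has = vel[OF cyc[OF m]]
    have m': "Suc m mod ?k < ?k" using k by (rule mod_less_divisor)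
    show "(map arc_of (cyc x) ! m has_vector_derivative (map vel (cyc x) ! m) t) (at t)" for t
      using has_turnD(1)[OF has] m by (simp only: nth_map)
    show "continuous_on {0..1} (map vel (cyc x) ! m)"
      using has_turnD(2)[OF has] m by (simp only: nth_map)
    show "(map vel (cyc x) ! m) t \<noteq> 0" if "t \<in> {0..1}" for t
      unfolding nth_map[OF m] by (rule has_turn_nonzero[OF has that])
    show "pathfinish (map arc_of (cyc x) ! m) = pathstart (map arc_of (cyc x) ! (Suc m mod length (map arc_of (cyc x))))"
      using traversal_cyc[OF assms] \<open>m < length (map arc_of (cyc x))\<close> unfolding traversal_def by blast
    show "(map vel (cyc x) ! m) 1 = (map vel (cyc x) ! (Suc m mod length (map arc_of (cyc x)))) 0"
      using has_turnD(4)[OF has] has_turnD(3)[OF vel[OF cyc[OF m']]] cyc_nth_Suc[OF m] m m'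
      by (simp only: nth_map length_map)
  qed
  have "whitney_degree (joined (map arc_of (cyc x))) =
      (\<Sum>m<?k. winding_number (\<lambda>t. sgn ((map vel (cyc x) ! m) t)) 0)"
    using whitney_degree_joined by (simp only: length_map)
  also have "\<dots> = (\<Sum>m<?k. of_int (turn (cyc x ! m)) / 2)"
    by (intro sum.cong refl) (use has_turn_winding_number[OF vel[OF cyc]] in \<open>simp only: nth_map lessThan_iff\<close>)
  also have "\<dots> = of_int (\<Sum>m<?k. turn (cyc x ! m)) / 2"
    by (simp only: sum_divide_distrib[symmetric] of_int_sum)
  also have "(\<Sum>m<?k. turn (cyc x ! m)) = total_turn x"
    unfolding total_turn_def
    by (rule sum.reindex_bij_betw) (rule bij_betw_nth[OF distinct_cyc], simp_all only: lessThan_atLeast0)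
  finally show wd: "whitney_degree (joined (map arc_of (cyc x))) = of_int (total_turn x) / 2" .
  obtain c where "whitney_degree (joined (map arc_of (cyc x))) = of_int c"
    using whitney_degree_in_Ints by (elim Ints_cases)
  then have "(of_int (total_turn x) :: complex) = of_int (2 * c)" using wd by simp
  then have "total_turn x = 2 * c" by (simp only: of_int_eq_iff)
  then show "even (total_turn x)" by simp
qed

text \<open>
  All traversals of a curve have the same number of half turns up to sign, so the definite
  description in \<open>rot\<close> denotes. The number is even by the integrality of the Whitney degree.
\<close>
lemma rot_curve_of:
  assumes "x \<in> darts"
  shows "2 * int (rot K (curve_of x)) = \<bar>total_turn x\<bar>"
proof -
  define r where "r = nat (\<bar>total_turn x\<bar> div 2)"
  have r: "2 * int r = \<bar>total_turn x\<bar>" using whitney_degree_cyc(2)[OF assms] by (simp add: r_def)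
  have norm: "cmod (of_int t / 2) = real_of_int \<bar>t\<bar> / 2" for t
    by (simp add: norm_divide)
  have "rot K (curve_of x) = r"
    unfolding rot_def
  proof (rule the_equality)
    have "real r = cmod (whitney_degree (joined (map arc_of (cyc x))))"
      unfolding whitney_degree_cyc(1)[OF assms] norm r[symmetric] by simp
    then show "\<exists>gs. traversal K gs \<and> path_image (joined gs) = curve_of x \<and> real r = cmod (whitney_degree (joined gs))"
      using traversal_cyc[OF assms] path_image_joined_cyc[OF assms] by blast
  next
    fix r' assume "\<exists>gs. traversal K gs \<and> path_image (joined gs) = curve_of x \<and> real r' = cmod (whitney_degree (joined gs))"
    then obtain gs where gs: "traversal K gs" "path_image (joined gs) = curve_of x"
      "real r' = cmod (whitney_degree (joined gs))" by blast
    obtain y where y: "y \<in> darts" "gs = map arc_of (cyc y)" using traversal_imp_cyc[OF gs(1)] by blast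
    have "curve_of y = curve_of x" using gs(2) y path_image_joined_cyc by blast
    then have "y \<in> orb x \<or> flip y \<in> orb x" using curve_of_eq_iff[OF assms y(1)] by blast
    then have "orb y = orb x \<or> orb (flip y) = orb x" using orb_eqI by blast
    then have "total_turn y = total_turn x \<or> total_turn (flip y) = total_turn x"
      unfolding total_turn_def by metis
    then have "\<bar>total_turn y\<bar> = \<bar>total_turn x\<bar>" using total_turn_flip[OF y(1)] by auto
    then have "real r' = real r"
      using gs(3) unfolding y(2) whitney_degree_cyc(1)[OF y(1)] norm by (simp add: r[symmetric])
    then show "r' = r" by simp
  qed
  then show ?thesis using r by simp
qed

end

section \<open>Labellings as orientations of the curves\<close>

text \<open>
  Labels are read as directions of travel, because \<open>M\<close> vanishes unless the labels change at an
  extremum, where the direction changes as well.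
\<close>
definition coherent_at :: "(nat \<times> nat \<Rightarrow> nat) \<Rightarrow> dart \<Rightarrow> bool" where
  "coherent_at l x \<longleftrightarrow> l (fst x) = (if snd x then 1 else 2)"

lemma coherent_at_flip:
  assumes "l (fst x) \<in> {1, 2}"
  shows "coherent_at l (flip x) \<longleftrightarrow> \<not> coherent_at l x"
  using assms by (cases "snd x") (auto simp: coherent_at_def flip_def)

context link_diagram
begin

definition coherent_labellings :: "(nat \<times> nat \<Rightarrow> nat) set" where
  "coherent_labellings =
     {l \<in> points K \<rightarrow>\<^sub>E {1, 2}. \<forall>x\<in>darts. coherent_at l (nxt x) \<longleftrightarrow> coherent_at l x}"

lemma finite_points: "finite (points K)"
  by (simp add: points_def)

lemma label_values:
  assumes "l \<in> points K \<rightarrow>\<^sub>E {1, 2}" "x \<in> darts"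
  shows "l (fst x) \<in> {1, 2}"
  using assms by (intro PiE_mem[OF assms(1)]) (auto simp: mem_Times_iff)

lemma coherent_flip:
  assumes "l \<in> points K \<rightarrow>\<^sub>E {1, 2}" "x \<in> darts"
  shows "coherent_at l (flip x) \<longleftrightarrow> \<not> coherent_at l x"
  using label_values[OF assms] by (rule coherent_at_flip)

lemma coherent_labellingsD:
  assumes "l \<in> coherent_labellings"
  shows "l \<in> points K \<rightarrow>\<^sub>E {1, 2}" "x \<in> darts \<Longrightarrow> coherent_at l (nxt x) \<longleftrightarrow> coherent_at l x"
  using assms unfolding coherent_labellings_def mem_Collect_eq by blast+

lemma coherent_iff_forward:
  assumes "l \<in> points K \<rightarrow>\<^sub>E {1, 2}"
  shows "(\<forall>x\<in>darts. coherent_at l (nxt x) \<longleftrightarrow> coherent_at l x) \<longleftrightarrow>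
    (\<forall>x y g h. forward_edge K x y g h \<longrightarrow> (coherent_at l x \<longleftrightarrow> coherent_at l y))"
    (is "?L \<longleftrightarrow> ?R")
proof
  assume L: ?L
  show ?R
  proof (intro allI impI)
    fix x y g h assume "forward_edge K x y g h"
    then have e: "edge K x y g h" unfolding edge_def by blast
    then have "x \<in> darts" using edge_in_darts by blast
    then show "coherent_at l x \<longleftrightarrow> coherent_at l y" using L nxt_eqI(1)[OF e] by metis
  qed
next
  assume R: ?R
  show ?L
  proof
    fix x assume x: "x \<in> darts"
    have "forward_edge K x (nxt x) (arc_of x) (turn x) \<or>
        (\<exists>g. forward_edge K (flip (nxt x)) (flip x) g (- turn x))"
      using edge_nxt[OF x] unfolding edge_def by blast
    then show "coherent_at l (nxt x) \<longleftrightarrow> coherent_at l x"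
    proof
      assume "\<exists>g. forward_edge K (flip (nxt x)) (flip x) g (- turn x)"
      then have "coherent_at l (flip (nxt x)) \<longleftrightarrow> coherent_at l (flip x)" using R by blast
      then show ?thesis
        using coherent_flip[OF assms x] coherent_flip[OF assms nxt_in_darts[OF x]] by blast
    qed (use R in blast)
  qed
qed

definition slice_of :: "dart \<Rightarrow> nat" where
  "slice_of x = (if snd x then fst (fst x) else fst (fst x) - 1)"

lemma turn_cases:
  assumes "x \<in> darts"
  obtains "slice_of x < length K" "turn x = 0"
  | i where "slice_of x < length K" "K ! slice_of x = (Maximum, i)"
      "x = ((slice_of x, i), True) \<and> turn x = - 1 \<or> x = ((slice_of x, i + 1), True) \<and> turn x = 1"
  | i where "slice_of x < length K" "K ! slice_of x = (Minimum, i)"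
      "x = ((Suc (slice_of x), i), False) \<and> turn x = 1 \<or> x = ((Suc (slice_of x), i + 1), False) \<and> turn x = - 1"
proof -
  have "forward_edge K x (nxt x) (arc_of x) (turn x) \<or>
      (\<exists>g. forward_edge K (flip (nxt x)) (flip x) g (- turn x))"
    using edge_nxt[OF assms] unfolding edge_def by blast
  then show thesis
  proof
    assume "forward_edge K x (nxt x) (arc_of x) (turn x)"
    then show thesis
    proof cases
      case (strand n j j')
      then show thesis by (intro that(1)) (auto simp: slice_of_def)
    next
      case (Maximum n i)
      then show thesis by (intro that(2)[of i]) (auto simp: slice_of_def)
    next
      case (Minimum n i)
      then show thesis by (intro that(3)[of i]) (auto simp: slice_of_def)
    qed
  next
    assume "\<exists>g. forward_edge K (flip (nxt x)) (flip x) g (- turn x)"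
    then obtain g where g: "forward_edge K (flip (nxt x)) (flip x) g (- turn x)" ..
    have x: "x = flip y" if "flip x = y" for y using that by auto
    from g show thesis
    proof cases
      case (strand n j j')
      then have "x = ((Suc n, j'), False)" using x by fastforce
      then show thesis using strand by (intro that(1)) (auto simp: slice_of_def)
    next
      case (Maximum n i)
      then have "x = ((n, i + 1), True)" using x by fastforce
      then show thesis using Maximum by (intro that(2)[of i]) (auto simp: slice_of_def)
    next
      case (Minimum n i)
      then have "x = ((Suc n, i + 1), False)" using x by fastforce
      then show thesis using Minimum by (intro that(3)[of i]) (auto simp: slice_of_def)
    qed
  qed
qed

lemma extremum_turns:
  "n < length K \<Longrightarrow> K ! n = (Maximum, i) \<Longrightarrow> turn ((n, i), True) = - 1"
  "n < length K \<Longrightarrow> K ! n = (Maximum, i) \<Longrightarrow> turn ((n, i + 1), True) = 1"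
  "n < length K \<Longrightarrow> K ! n = (Minimum, i) \<Longrightarrow> turn ((Suc n, i), False) = 1"
  "n < length K \<Longrightarrow> K ! n = (Minimum, i) \<Longrightarrow> turn ((Suc n, i + 1), False) = - 1"
proof -
  assume n: "n < length K"
  {
    assume "K ! n = (Maximum, i)"
    then have "edge K ((n, i), True) ((n, i + 1), False) (maximum_arc n i) (- 1)"
      using forward_edge.Maximum[OF n] unfolding edge_def by blast
    from nxt_eqI(3)[OF this] nxt_eqI(3)[OF edge_flip[OF this]]
    show "turn ((n, i), True) = - 1" "turn ((n, i + 1), True) = 1" by simp_all
  }
  {
    assume "K ! n = (Minimum, i)"
    then have "edge K ((Suc n, i), False) ((Suc n, i + 1), True) (minimum_arc n i) 1"
      using forward_edge.Minimum[OF n] unfolding edge_def by blast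
    from nxt_eqI(3)[OF this] nxt_eqI(3)[OF edge_flip[OF this]]
    show "turn ((Suc n, i), False) = 1" "turn ((Suc n, i + 1), False) = - 1" by simp_all
  }
qed

lemma coherent_labellings_subset: "coherent_labellings \<subseteq> labellings K"
proof
  fix l assume l: "l \<in> coherent_labellings"
  then have lE: "l \<in> points K \<rightarrow>\<^sub>E {1, 2}" by (simp add: coherent_labellings_def)
  then have fw: "\<And>x y g h. forward_edge K x y g h \<Longrightarrow> coherent_at l x \<longleftrightarrow> coherent_at l y"
    using l coherent_iff_forward[OF lE] unfolding coherent_labellings_def by blast
  have "l (n, j) = l (Suc n, j')" if n: "n < length K" and j: "(j, j') \<in> through (K ! n) (width K n)" for n j j'
  proof -
    have e: "forward_edge K ((n, j), True) ((Suc n, j'), True) (strand_arc n j j') 0"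
      using j by (intro forward_edge.strand[OF n]) (simp add: strands_def)
    then have "((n, j), True) \<in> darts" "((Suc n, j'), True) \<in> darts"
      using edge_in_darts unfolding edge_def by blast+
    then have "l (n, j) \<in> {1, 2}" "l (Suc n, j') \<in> {1, 2}"
      using label_values[OF lE] by (metis fst_conv)+
    then show ?thesis using fw[OF e] by (auto simp: coherent_at_def)
  qed
  then show "l \<in> labellings K" using lE unfolding labellings_def by blast
qed

text \<open>
  A reference orientation for every curve.
\<close>
definition representative :: "complex set \<Rightarrow> dart" where
  "representative C = (SOME x. x \<in> darts \<and> curve_of x = C)"

lemma representative:
  assumes "C \<in> curves K"
  shows "representative C \<in> darts" "curve_of (representative C) = C"
proof -
  have "\<exists>x. x \<in> darts \<and> curve_of x = C" using assms unfolding curves_eq by blast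
  from someI_ex[OF this] show "representative C \<in> darts" "curve_of (representative C) = C"
    unfolding representative_def by blast+
qed

lemma finite_curves: "finite (curves K)"
  unfolding curves_eq by (rule finite_imageI[OF finite_darts])

lemma coherent_orb:
  assumes "l \<in> coherent_labellings" "x \<in> darts" "y \<in> orb x"
  shows "coherent_at l y \<longleftrightarrow> coherent_at l x"
proof -
  obtain m where "y = (nxt ^^ m) x" using assms(3) unfolding orb_eq_range by blast
  moreover have "coherent_at l ((nxt ^^ m) x) \<longleftrightarrow> coherent_at l x"
  proof (induction m)
    case (Suc m)
    have "coherent_at l (nxt ((nxt ^^ m) x)) \<longleftrightarrow> coherent_at l ((nxt ^^ m) x)"
      by (rule coherent_labellingsD(2)[OF assms(1) funpow_in_darts[OF assms(2)]])
    then show ?case using Suc.IH by (simp only: funpow.simps comp_apply)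
  qed (simp only: funpow_0)
  ultimately show ?thesis by (simp only:)
qed

lemma on_curve_cases:
  assumes "C \<in> curves K" "x \<in> darts" "curve_of x = C"
  shows "x \<in> orb (representative C) \<longleftrightarrow> flip x \<notin> orb (representative C)"
proof -
  let ?r = "representative C"
  have "x \<in> orb ?r \<or> flip x \<in> orb ?r"
    using curve_of_eq_iff representative[OF assms(1)] assms(2,3) by metis
  moreover have "\<not> (x \<in> orb ?r \<and> flip x \<in> orb ?r)"
    using orb_eqI flip_notin_orb[OF assms(2)] by metis
  ultimately show ?thesis by blast
qed

text \<open>
  Coherence is carried on by \<open>nxt\<close> and reversed by \<open>flip\<close>.
\<close>
lemma coherent_on_curve:
  assumes "C \<in> curves K" "l \<in> coherent_labellings"
  shows "{x \<in> darts. coherent_at l x \<and> curve_of x = C} =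
    (if coherent_at l (representative C) then orb (representative C) else orb (flip (representative C)))"
proof -
  let ?r = "representative C"
  note r = representative[OF assms(1)]
  have lE: "l \<in> points K \<rightarrow>\<^sub>E {1, 2}" using assms(2) by (simp add: coherent_labellings_def)
  have flip_mem: "x \<in> orb (flip ?r) \<longleftrightarrow> flip x \<in> orb ?r" for x
    unfolding orb_flip[OF r(1)] by (metis flip_simps(2) imageE imageI)
  have curve: "curve_of x = C \<longleftrightarrow> x \<in> orb ?r \<or> flip x \<in> orb ?r" if "x \<in> darts" for x
    using curve_of_eq_iff[OF r(1) that] r(2) by (simp only:)
  have coh: "coherent_at l x \<longleftrightarrow> coherent_at l ?r" if "x \<in> orb ?r" for x
    by (rule coherent_orb[OF assms(2) r(1) that])
  have coh': "coherent_at l x \<longleftrightarrow> \<not> coherent_at l ?r" if "x \<in> darts" "flip x \<in> orb ?r" for x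
    using coh[OF that(2)] coherent_flip[OF lE that(1)] by blast
  have "flip ?r \<in> darts" using r(1) by (simp only: flip_in_darts)
  then have sub: "orb ?r \<subseteq> darts" "orb (flip ?r) \<subseteq> darts"
    using orb_subset_darts r(1) by (simp_all only:)
  show ?thesis
  proof (cases "coherent_at l ?r")
    case True
    have "x \<in> darts \<and> coherent_at l x \<and> curve_of x = C \<longleftrightarrow> x \<in> orb ?r" for x
    proof (cases "x \<in> darts")
      case d: True
      show ?thesis using d True curve[OF d] coh[of x] coh'[OF d] by metis
    qed (use sub(1) in auto)
    then show ?thesis using True by (simp only: if_True Collect_mem_eq)
  next
    case False
    have "x \<in> darts \<and> coherent_at l x \<and> curve_of x = C \<longleftrightarrow> x \<in> orb (flip ?r)" for x
    proof (cases "x \<in> darts")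
      case d: True
      show ?thesis using d False curve[OF d] coh[of x] coh'[OF d] flip_mem[of x] by metis
    qed (use sub(2) in auto)
    then show ?thesis using False by (simp only: if_False Collect_mem_eq)
  qed
qed

text \<open>
  Every dart lies on exactly one curve, so the orientations of different curves do not constrain
  each other.
\<close>
lemma bij_betw_coherent:
  "bij_betw (\<lambda>l. \<lambda>C\<in>curves K. coherent_at l (representative C)) coherent_labellings
     (curves K \<rightarrow>\<^sub>E (UNIV :: bool set))"
proof (rule bij_betw_imageI)
  show "inj_on (\<lambda>l. \<lambda>C\<in>curves K. coherent_at l (representative C)) coherent_labellings"
  proof (rule inj_onI)
    fix l l' :: "nat \<times> nat \<Rightarrow> nat"
    assume l: "l \<in> coherent_labellings" and l': "l' \<in> coherent_labellings"
      and "(\<lambda>C\<in>curves K. coherent_at l (representative C)) = (\<lambda>C\<in>curves K. coherent_at l' (representative C))"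
    then have eq: "coherent_at l (representative C) \<longleftrightarrow> coherent_at l' (representative C)" if "C \<in> curves K" for C
      using that by (metis restrict_apply')
    have lE: "l \<in> points K \<rightarrow>\<^sub>E {1, 2}" "l' \<in> points K \<rightarrow>\<^sub>E {1, 2}"
      using l l' by (simp_all add: coherent_labellings_def)
    show "l = l'"
    proof (rule PiE_ext[OF lE])
      fix p assume "p \<in> points K"
      then have x: "(p, True) \<in> darts" by simp
      define C where "C = curve_of (p, True)"
      have C: "C \<in> curves K" unfolding C_def curves_eq using x by blast
      have "{x \<in> darts. coherent_at l x \<and> curve_of x = C} = {x \<in> darts. coherent_at l' x \<and> curve_of x = C}"
        unfolding coherent_on_curve[OF C l] coherent_on_curve[OF C l'] eq[OF C] ..
      then have "(p, True) \<in> {x \<in> darts. coherent_at l x \<and> curve_of x = C} \<longleftrightarrow>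
          (p, True) \<in> {x \<in> darts. coherent_at l' x \<and> curve_of x = C}" by (rule arg_cong)
      then have "coherent_at l (p, True) \<longleftrightarrow> coherent_at l' (p, True)"
        using x C_def by (simp only: mem_Collect_eq simp_thms)
      then show "l p = l' p"
        using label_values[OF lE(1) x] label_values[OF lE(2) x] by (auto simp: coherent_at_def)
    qed
  qed
  show "(\<lambda>l. \<lambda>C\<in>curves K. coherent_at l (representative C)) ` coherent_labellings =
      (curves K \<rightarrow>\<^sub>E (UNIV :: bool set))"
  proof (intro equalityI subsetI)
    fix f :: "complex set \<Rightarrow> bool" assume f: "f \<in> curves K \<rightarrow>\<^sub>E UNIV"
    \<comment> \<open>The reference orientation where \<open>f\<close> holds, and the opposite one elsewhere.\<close>
    define chosen where "chosen x \<longleftrightarrow> (x \<in> orb (representative (curve_of x)) \<longleftrightarrow> f (curve_of x))" for x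
    define l :: "nat \<times> nat \<Rightarrow> nat" where "l p = (if p \<in> points K then if chosen (p, True) then 1 else 2 else undefined)" for p
    have lE: "l \<in> points K \<rightarrow>\<^sub>E {1, 2}" by (auto simp: l_def)
    have in_curves: "curve_of x \<in> curves K" if "x \<in> darts" for x unfolding curves_eq using that by blast
    have chosen_flip: "chosen (flip x) \<longleftrightarrow> \<not> chosen x" if "x \<in> darts" for x
      using on_curve_cases[OF in_curves[OF that] that refl] unfolding chosen_def curve_of_flip[OF that] by argo
    have chosen_nxt: "chosen (nxt x) \<longleftrightarrow> chosen x" if "x \<in> darts" for x
    proof -
      have o: "orb (nxt x) = orb x" by (rule orb_eqI[OF nxt_in_orb[OF self_in_orb]])
      have "nxt x \<in> orb r \<longleftrightarrow> x \<in> orb r" for r using o orb_eqI self_in_orb by metis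
      moreover have "curve_of (nxt x) = curve_of x" unfolding curve_of_def o ..
      ultimately show ?thesis unfolding chosen_def by (simp only:)
    qed
    have coh: "coherent_at l x \<longleftrightarrow> chosen x" if "x \<in> darts" for x
    proof (cases "snd x")
      case True
      then have x: "x = (fst x, True)" by (simp add: prod_eq_iff)
      have "fst x \<in> points K" using that by (auto simp: mem_Times_iff)
      then have "coherent_at l x \<longleftrightarrow> chosen (fst x, True)" using True by (simp add: coherent_at_def l_def)
      then show ?thesis using x by metis
    next
      case False
      then have x: "flip x = (fst x, True)" by (simp add: prod_eq_iff flip_def)
      have "fst x \<in> points K" using that by (auto simp: mem_Times_iff)
      then have "coherent_at l x \<longleftrightarrow> \<not> chosen (fst x, True)" using False by (simp add: coherent_at_def l_def)
      then show ?thesis using x chosen_flip[OF that] by metis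
    qed
    have "l \<in> coherent_labellings"
      unfolding coherent_labellings_def
    proof (intro CollectI conjI ballI lE)
      fix x assume x: "x \<in> darts"
      show "coherent_at l (nxt x) \<longleftrightarrow> coherent_at l x"
        unfolding coh[OF x] coh[OF nxt_in_darts[OF x]] by (rule chosen_nxt[OF x])
    qed
    moreover have "(\<lambda>C\<in>curves K. coherent_at l (representative C)) = f"
    proof (rule PiE_ext[OF _ f])
      show "(\<lambda>C\<in>curves K. coherent_at l (representative C)) \<in> curves K \<rightarrow>\<^sub>E UNIV" by (rule restrict_PiE_iff[THEN iffD2]) blast
      fix C assume C: "C \<in> curves K"
      have "coherent_at l (representative C) \<longleftrightarrow> f C"
        unfolding coh[OF representative(1)[OF C]] chosen_def representative(2)[OF C]
        by (simp only: self_in_orb simp_thms)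
      then show "(\<lambda>C\<in>curves K. coherent_at l (representative C)) C = f C" using C by simp
    qed
    ultimately show "f \<in> (\<lambda>l. \<lambda>C\<in>curves K. coherent_at l (representative C)) ` coherent_labellings"
      by (intro image_eqI[where x = l]) (simp_all only:)
  qed (auto simp: PiE_def)
qed

end

section \<open>Evaluation of diagrams without classical crossings\<close>

context link_diagram
begin

lemma coherent_forward:
  assumes "l \<in> coherent_labellings" "forward_edge K x y g h"
  shows "coherent_at l x \<longleftrightarrow> coherent_at l y"
  using coherent_iff_forward[OF coherent_labellingsD(1)[OF assms(1)]] coherent_labellingsD(2)[OF assms(1)]
    assms(2) by metis

lemma coherent_strand:
  assumes "l \<in> coherent_labellings" "n < length K" "(j, j') \<in> strands (K ! n) (width K n)"
  shows "l (n, j) = l (Suc n, j')"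
proof -
  note e = forward_edge.strand[OF assms(2,3)]
  then have "((n, j), True) \<in> darts" "((Suc n, j'), True) \<in> darts"
    using edge_in_darts unfolding edge_def by blast+
  from this[THEN label_values[OF coherent_labellingsD(1)[OF assms(1)]]]
  show ?thesis using coherent_forward[OF assms(1) e] by (auto simp: coherent_at_def)
qed

lemma coherent_Maximum:
  assumes "l \<in> coherent_labellings" "n < length K" "K ! n = (Maximum, i)"
  shows "l (n, i) = 1 \<and> l (n, i + 1) = 2 \<or> l (n, i) = 2 \<and> l (n, i + 1) = 1"
    and "((n, i), True) \<in> darts" "((n, i + 1), True) \<in> darts"
proof -
  note e = forward_edge.Maximum[OF assms(2,3)]
  show d: "((n, i), True) \<in> darts" "((n, i + 1), True) \<in> darts"
    using edge_in_darts[of _ _ "maximum_arc n i" "- 1"] e unfolding edge_def by blast+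
  from d[THEN label_values[OF coherent_labellingsD(1)[OF assms(1)]]]
  show "l (n, i) = 1 \<and> l (n, i + 1) = 2 \<or> l (n, i) = 2 \<and> l (n, i + 1) = 1"
    using coherent_forward[OF assms(1) e] by (auto simp: coherent_at_def)
qed

lemma coherent_Minimum:
  assumes "l \<in> coherent_labellings" "n < length K" "K ! n = (Minimum, i)"
  shows "l (Suc n, i) = 1 \<and> l (Suc n, i + 1) = 2 \<or> l (Suc n, i) = 2 \<and> l (Suc n, i + 1) = 1"
    and "((Suc n, i), False) \<in> darts" "((Suc n, i + 1), False) \<in> darts"
proof -
  note e = forward_edge.Minimum[OF assms(2,3)]
  show d: "((Suc n, i), False) \<in> darts" "((Suc n, i + 1), False) \<in> darts"
    using edge_in_darts[of _ _ "minimum_arc n i" 1] e unfolding edge_def by blast+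
  from d[THEN label_values[OF coherent_labellingsD(1)[OF assms(1)]]]
  show "l (Suc n, i) = 1 \<and> l (Suc n, i + 1) = 2 \<or> l (Suc n, i) = 2 \<and> l (Suc n, i + 1) = 1"
    using coherent_forward[OF assms(1) e] by (auto simp: coherent_at_def)
qed

lemma turn_cases_at:
  assumes "x \<in> darts" "slice_of x = n"
  obtains "turn x = 0"
  | i where "K ! n = (Maximum, i)"
      "x = ((n, i), True) \<and> turn x = - 1 \<or> x = ((n, i + 1), True) \<and> turn x = 1"
  | i where "K ! n = (Minimum, i)"
      "x = ((Suc n, i), False) \<and> turn x = 1 \<or> x = ((Suc n, i + 1), False) \<and> turn x = - 1"
  using assms(1)
proof (cases rule: turn_cases)
  case 1
  then show thesis by (intro that(1))
next
  case (2 i)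
  then show thesis unfolding assms(2) by (intro that(2))
next
  case (3 i)
  then show thesis unfolding assms(2) by (intro that(3))
qed

end

context bracket_ring
begin

text \<open>
  The power of \<open>\<iota> A\<close> with exponent \<open>- h\<close>; its inverse is \<open>- \<iota> B\<close>.
\<close>
definition turn_weight :: "int \<Rightarrow> 'a" where
  "turn_weight h = (if 0 \<le> h then (- \<iota> * B) ^ nat h else (\<iota> * A) ^ nat (- h))"

lemma \<iota>A_\<iota>B: "- \<iota> * B * (\<iota> * A) = 1" "\<iota> * A * (- \<iota> * B) = 1"
  by (simp_all add: AB_simps \<iota>_simps ac_simps)

lemma turn_weight_simps [simp]: "turn_weight 0 = 1" "turn_weight 1 = - \<iota> * B" "turn_weight (- 1) = \<iota> * A"
  by (simp_all add: turn_weight_def)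

lemma turn_weight_int: "turn_weight (int m) = (- \<iota> * B) ^ m" "turn_weight (- int m) = (\<iota> * A) ^ m"
  by (cases m; simp add: turn_weight_def nat_add_distrib)+

lemma turn_weight_step: "turn_weight (h + 1) = turn_weight h * (- \<iota> * B)"
proof (cases "0 \<le> h")
  case True
  then obtain m where m: "h = int m" by (elim nonneg_int_cases)
  have "turn_weight (int (Suc m)) = turn_weight (int m) * (- \<iota> * B)"
    unfolding turn_weight_int by (rule power_Suc2)
  moreover have "h + 1 = int (Suc m)" using m by simp
  ultimately show ?thesis unfolding m by (simp only:)
next
  case False
  define m where "m = nat (- h - 1)"
  have h: "h = - int (Suc m)" "h + 1 = - int m" using False by (simp_all add: m_def)
  have "turn_weight h * (- \<iota> * B) = (\<iota> * A) ^ m * (\<iota> * A * (- \<iota> * B))"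
    unfolding h(1) turn_weight_int power_Suc2 by (rule mult.assoc)
  then show ?thesis unfolding h(2) turn_weight_int \<iota>A_\<iota>B by simp
qed

lemma turn_weight_back: "turn_weight (h - 1) = turn_weight h * (\<iota> * A)"
proof -
  have "turn_weight h * (\<iota> * A) = turn_weight (h - 1) * (- \<iota> * B * (\<iota> * A))"
    using turn_weight_step[of "h - 1"] by (simp only: diff_add_cancel mult.assoc)
  then show ?thesis by (simp only: \<iota>A_\<iota>B mult_1_right)
qed

lemma turn_weight_add: "turn_weight (g + h) = turn_weight g * turn_weight h"
proof (induction h rule: int_induct[of _ 0])
  case (step1 h)
  have "turn_weight (g + (h + 1)) = turn_weight (g + h) * (- \<iota> * B)"
    using turn_weight_step[of "g + h"] by (simp only: add.assoc)
  then show ?case using step1.IH turn_weight_step[of h] by (simp only: mult.assoc)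
next
  case (step2 h)
  have "turn_weight (g + (h - 1)) = turn_weight (g + h) * (\<iota> * A)"
    using turn_weight_back[of "g + h"] by (simp only: add_diff_eq)
  then show ?case using step2.IH turn_weight_back[of h] by (simp only: mult.assoc)
qed simp

lemma turn_weight_sum: "turn_weight (sum f S) = (\<Prod>x\<in>S. turn_weight (f x))"
  by (induction S rule: infinite_finite_induct) (simp_all add: turn_weight_add)

lemma power_even_\<iota>: "(\<iota> * x) ^ (2 * r) = (- 1) ^ r * x ^ (2 * r)"
proof -
  have "(\<iota> * x) ^ 2 = - 1 * x ^ 2" by (simp add: power2_eq_square \<iota>_simps ac_simps)
  then show ?thesis unfolding power_mult by (simp only: power_mult_distrib)
qed

text \<open>
  The contributions of the two orientations of a curve: the even powers of \<open>\<iota>\<close> give the sign.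
\<close>
lemma turn_weight_both:
  assumes "2 * int r = \<bar>t\<bar>"
  shows "turn_weight t + turn_weight (- t) = curve_value A B r"
proof -
  have "(- \<iota> * B) ^ (2 * r) = (- 1) ^ r * B ^ (2 * r)"
    using power_even_\<iota>[of "- B" r] by simp
  then have *: "turn_weight (int (2 * r)) + turn_weight (- int (2 * r)) = curve_value A B r"
    unfolding turn_weight_int power_even_\<iota>[of A r] curve_value_def by (simp only: distrib_left add.commute)
  have "t = int (2 * r) \<or> t = - int (2 * r)" using assms by auto
  then show ?thesis
  proof
    assume "t = - int (2 * r)"
    then have "- t = int (2 * r)" by simp
    then show ?thesis using * \<open>t = - int (2 * r)\<close> by (simp only: add.commute)
  qed (use * in simp)
qed

end

locale virtual_evaluation = bracket_ring A B \<iota> + link_diagram K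
  for A B \<iota> :: "'a::comm_ring_1" and K +
  assumes no_classical: "s \<in> set K \<Longrightarrow> \<not> is_classical (fst s)"
begin

lemma piece_cases:
  assumes "n < length K"
  obtains i where "K ! n = (Maximum, i)" | i where "K ! n = (Minimum, i)" | i where "K ! n = (Virtual, i)"
proof -
  obtain p i where pi: "K ! n = (p, i)" by force
  have "\<not> is_classical p" using no_classical[OF nth_mem[OF assms]] by (simp add: pi)
  then show thesis using that pi by (cases p) (auto simp: is_classical_def)
qed

text \<open>
  An extremum is left by two darts, one for each direction of travel, and exactly one of them is
  coherent. The entry of \<open>M\<close> at the labels is the weight of its half turn.
\<close>
lemma entry_eq_prod_turns:
  assumes l: "l \<in> coherent_labellings" and n: "n < length K"
  shows "(\<Prod>x\<in>{x. x \<in> {x \<in> darts. coherent_at l x} \<and> slice_of x = n}. turn_weight (turn x)) =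
    local_entry l n (K ! n)" (is "prod ?f ?S = _")
proof -
  have fin: "finite ?S" using finite_darts by (rule rev_finite_subset) blast
  have single: "prod ?f ?S = ?f y" if "y \<in> ?S" "\<And>x. x \<in> ?S \<Longrightarrow> x = y \<or> turn x = 0" for y
  proof -
    have "prod ?f {y} = prod ?f ?S"
    proof (rule prod.mono_neutral_left[OF fin])
      show "{y} \<subseteq> ?S" using that(1) by blast
      show "\<forall>x\<in>?S - {y}. ?f x = 1"
      proof
        fix x assume "x \<in> ?S - {y}"
        then have "turn x = 0" using that(2)[of x] by blast
        then show "?f x = 1" by (simp only: turn_weight_simps)
      qed
    qed
    then show ?thesis by simp
  qed
  from n show ?thesis
  proof (cases rule: piece_cases)
    case (1 i)
    note lab = coherent_Maximum[OF l n 1]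
    define y where "y = (if l (n, i) = 1 then ((n, i), True) else ((n, i + 1), True))"
    have "y \<in> ?S" using lab by (auto simp: y_def coherent_at_def slice_of_def simp del: mem_Sigma_iff)
    moreover have "x = y \<or> turn x = 0" if "x \<in> ?S" for x
    proof -
      have x: "x \<in> darts" "coherent_at l x" "slice_of x = n" using that by blast+
      from x(1,3) show ?thesis
        by (cases rule: turn_cases_at) (use x(2) 1 lab(1) in \<open>auto simp: y_def coherent_at_def\<close>)
    qed
    ultimately have "prod ?f ?S = ?f y" by (rule single)
    then show ?thesis using lab(1) extremum_turns(1,2)[OF n 1] 1
      by (auto simp: y_def M_mat_def)
  next
    case (2 i)
    note lab = coherent_Minimum[OF l n 2]
    define y where "y = (if l (Suc n, i) = 1 then ((Suc n, i + 1), False) else ((Suc n, i), False))"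
    have "y \<in> ?S" using lab by (auto simp: y_def coherent_at_def slice_of_def simp del: mem_Sigma_iff)
    moreover have "x = y \<or> turn x = 0" if "x \<in> ?S" for x
    proof -
      have x: "x \<in> darts" "coherent_at l x" "slice_of x = n" using that by blast+
      from x(1,3) show ?thesis
        by (cases rule: turn_cases_at) (use x(2) 2 lab(1) in \<open>auto simp: y_def coherent_at_def\<close>)
    qed
    ultimately have "prod ?f ?S = ?f y" by (rule single)
    then show ?thesis using lab(1) extremum_turns(3,4)[OF n 2] 2
      by (auto simp: y_def M_mat_def)
  next
    case (3 i)
    have "turn x = 0" if "x \<in> ?S" for x
    proof -
      have x: "x \<in> darts" "slice_of x = n" using that by blast+
      from x show ?thesis by (cases rule: turn_cases_at) (use 3 in auto)
    qed
    then have "prod ?f ?S = 1" by (intro prod.neutral ballI) (simp only: turn_weight_simps)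
    moreover have "(i, i + 1) \<in> strands (K ! n) (width K n)" "(i + 1, i) \<in> strands (K ! n) (width K n)"
      by (simp_all add: 3 strands_def)
    then have "l (n, i) = l (Suc n, i + 1)" "l (n, i + 1) = l (Suc n, i)"
      using coherent_strand[OF l n] by blast+
    then have "local_entry l n (K ! n) = 1" by (simp add: 3 V_mat_def kdelta_def)
    ultimately show ?thesis by simp
  qed
qed

lemma prod_entries_coherent:
  assumes l: "l \<in> coherent_labellings"
  shows "(\<Prod>n<length K. local_entry l n (K ! n)) = (\<Prod>x\<in>{x \<in> darts. coherent_at l x}. turn_weight (turn x))"
proof -
  let ?D = "{x \<in> darts. coherent_at l x}"
  have "finite ?D" using finite_darts by (rule rev_finite_subset) blast
  moreover have "slice_of ` ?D \<subseteq> {..<length K}"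
  proof (rule image_subsetI)
    fix x assume "x \<in> ?D"
    then have "x \<in> darts" by blast
    then show "slice_of x \<in> {..<length K}"
      by (cases rule: turn_cases) (simp_all only: lessThan_iff)
  qed
  ultimately have "(\<Prod>n<length K. \<Prod>x\<in>{x. x \<in> ?D \<and> slice_of x = n}. turn_weight (turn x)) =
      (\<Prod>x\<in>?D. turn_weight (turn x))"
    by (intro prod.group) simp_all
  moreover have "(\<Prod>n<length K. \<Prod>x\<in>{x. x \<in> ?D \<and> slice_of x = n}. turn_weight (turn x)) =
      (\<Prod>n<length K. local_entry l n (K ! n))"
    by (intro prod.cong refl entry_eq_prod_turns[OF l]) (simp only: lessThan_iff)
  ultimately show ?thesis by (simp only:)
qed

text \<open>
  Coherence along the strands comes from the condition on labellings and, at a crossing, from the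
  zeros of \<open>V\<close>; at an extremum it comes from the zeros on the diagonal of \<open>M\<close>.
\<close>
lemma nonzero_imp_coherent:
  assumes l: "l \<in> labellings K" and nz: "(\<Prod>n<length K. local_entry l n (K ! n)) \<noteq> 0"
  shows "l \<in> coherent_labellings"
proof -
  have lE: "l \<in> points K \<rightarrow>\<^sub>E {1, 2}" using l by (simp add: labellings_def)
  have nz': "local_entry l n (K ! n) \<noteq> 0" if "n < length K" for n
    using nz that by (metis finite_lessThan lessThan_iff prod_zero)
  have "coherent_at l x \<longleftrightarrow> coherent_at l y" if e: "forward_edge K x y g h" for x y g h
    using e
  proof cases
    case (strand n j j')
    have "l (n, j) = l (Suc n, j')"
    proof (cases "(j, j') \<in> through (K ! n) (width K n)")
      case True
      then show ?thesis using l strand(5) unfolding labellings_def by blast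
    next
      case False
      from strand(5) show ?thesis
      proof (cases rule: piece_cases)
        case (3 i)
        then have "j = i \<and> j' = i + 1 \<or> j = i + 1 \<and> j' = i"
          using False strand(6) by (auto simp: strands_def)
        then show ?thesis
          using nz'[OF strand(5)] 3 by (auto simp: V_mat_def kdelta_def split: if_splits)
      qed (use False strand(6) in \<open>auto simp: strands_def\<close>)
    qed
    then show ?thesis using strand by (simp add: coherent_at_def)
  next
    case (Maximum n i)
    then show ?thesis using nz'[of n]
      by (auto simp: coherent_at_def M_mat_def split: if_splits)
  next
    case (Minimum n i)
    then show ?thesis using nz'[of n]
      by (auto simp: coherent_at_def M_mat_def split: if_splits)
  qed
  then show ?thesis
    using lE coherent_iff_forward[OF lE] unfolding coherent_labellings_def mem_Collect_eq by blast
qed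

lemma prod_orb:
  assumes "x \<in> darts"
  shows "(\<Prod>y\<in>orb x. turn_weight (turn y)) = turn_weight (total_turn x)"
  by (simp add: turn_weight_sum total_turn_def)

text \<open>
  Orientations are chosen curve by curve, and the product of the entries splits accordingly. Hence
  the sum over all choices is the product over the curves of sums with two terms.
\<close>
lemma Z_eq_prod_curves: "Z A B \<iota> K = (\<Prod>C\<in>curves K. curve_value A B (rot K C))"
proof -
  define F where "F C b = turn_weight (if b then total_turn (representative C) else - total_turn (representative C))"
    for C and b :: bool
  have fin: "finite (labellings K)"
    unfolding labellings_def by (rule finite_subset[OF _ finite_PiE[OF finite_points, of "\<lambda>_. {1, 2}"]]) auto
  have "Z A B \<iota> K = (\<Sum>l\<in>labellings K. \<Prod>n<length K. local_entry l n (K ! n))"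
    by (simp only: Z_def tensor_evaluation_def)
  also have "\<dots> = (\<Sum>l\<in>coherent_labellings. \<Prod>n<length K. local_entry l n (K ! n))"
    using nonzero_imp_coherent by (intro sum.mono_neutral_right fin coherent_labellings_subset) blast
  also have "\<dots> = (\<Sum>l\<in>coherent_labellings. \<Prod>C\<in>curves K. F C ((\<lambda>C\<in>curves K. coherent_at l (representative C)) C))"
  proof (rule sum.cong[OF refl])
    fix l assume l: "l \<in> coherent_labellings"
    let ?D = "{x \<in> darts. coherent_at l x}"
    have "finite ?D" using finite_darts by (rule rev_finite_subset) blast
    moreover have "curve_of ` ?D \<subseteq> curves K" unfolding curves_eq by blast
    ultimately have "(\<Prod>C\<in>curves K. \<Prod>x\<in>{x. x \<in> ?D \<and> curve_of x = C}. turn_weight (turn x)) =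
        (\<Prod>x\<in>?D. turn_weight (turn x))"
      by (intro prod.group finite_curves)
    moreover have "(\<Prod>x\<in>{x. x \<in> ?D \<and> curve_of x = C}. turn_weight (turn x)) =
        F C ((\<lambda>C\<in>curves K. coherent_at l (representative C)) C)" if C: "C \<in> curves K" for C
    proof -
      have r: "representative C \<in> darts" "flip (representative C) \<in> darts"
        using representative(1)[OF C] by (simp_all only: flip_in_darts)
      have "{x. x \<in> ?D \<and> curve_of x = C} = {x \<in> darts. coherent_at l x \<and> curve_of x = C}" by blast
      then show ?thesis
        using C unfolding coherent_on_curve[OF C l] F_def restrict_apply
        by (simp only: prod_orb[OF r(1)] prod_orb[OF r(2)] total_turn_flip[OF r(1)] if_True split: if_split) simp
    qed
    ultimately show "(\<Prod>n<length K. local_entry l n (K ! n)) =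
        (\<Prod>C\<in>curves K. F C ((\<lambda>C\<in>curves K. coherent_at l (representative C)) C))"
      unfolding prod_entries_coherent[OF l] by (metis (no_types, lifting) prod.cong)
  qed
  also have "\<dots> = (\<Sum>f\<in>curves K \<rightarrow>\<^sub>E UNIV. \<Prod>C\<in>curves K. F C (f C))"
    by (rule sum.reindex_bij_betw[OF bij_betw_coherent])
  also have "\<dots> = (\<Prod>C\<in>curves K. \<Sum>b\<in>UNIV. F C b)"
    by (rule prod_sum_PiE[symmetric]) (simp_all add: finite_curves)
  also have "\<dots> = (\<Prod>C\<in>curves K. curve_value A B (rot K C))"
  proof (rule prod.cong[OF refl])
    fix C assume C: "C \<in> curves K"
    have "2 * int (rot K C) = \<bar>total_turn (representative C)\<bar>"
      using rot_curve_of[OF representative(1)[OF C]] unfolding representative(2)[OF C] .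
    from turn_weight_both[OF this] show "(\<Sum>b\<in>UNIV. F C b) = curve_value A B (rot K C)"
      by (simp add: UNIV_bool F_def add.commute)
  qed
  finally show ?thesis .
qed

end

context bracket_ring
begin

lemma Z_eq_rotational_state_sum:
  assumes "diagram K"
  shows "Z A B \<iota> K = rotational_state_sum A B K"
proof -
  have "Z A B \<iota> (smoothed K S) =
      (\<Prod>C\<in>curves (smoothed K S). curve_value A B (rot (smoothed K S) C))" for S
  proof -
    interpret virtual_evaluation A B \<iota> "smoothed K S"
      by unfold_locales (use diagram_smoothed[OF assms] smoothed_no_classical in blast)+
    show ?thesis by (rule Z_eq_prod_curves)
  qed
  then show ?thesis unfolding Z_state_expansion[OF assms] rotational_state_sum_def by (simp only:)
qed

end

section \<open>Diagrams without crossings\<close>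

definition planar :: "slice list \<Rightarrow> bool" where
  "planar K \<longleftrightarrow> (\<forall>s\<in>set K. fst s = Maximum \<or> fst s = Minimum)"

lemma planar_append [simp]: "planar (K @ L) \<longleftrightarrow> planar K \<and> planar L"
  by (auto simp: planar_def)

lemma planar_Cons [simp]: "planar (s # K) \<longleftrightarrow> (fst s = Maximum \<or> fst s = Minimum) \<and> planar K"
  by (auto simp: planar_def)

context bracket_ring
begin

text \<open>
  The value of a circle is \<open>M\<^sup>1\<^sup>2 M\<^sub>1\<^sub>2 + M\<^sup>2\<^sup>1 M\<^sub>2\<^sub>1 = - A\<^sup>2 - B\<^sup>2\<close>.
\<close>
lemma Z_circle:
  assumes "diagram (X @ [(Minimum, i), (Maximum, i)] @ Y)" "diagram (X @ Y)"
  shows "Z A B \<iota> (X @ [(Minimum, i), (Maximum, i)] @ Y) = loop_value A B * Z A B \<iota> (X @ Y)"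
proof -
  obtain w w1 where w: "fits 0 X w" "fits w [(Minimum, i), (Maximum, i)] w1" "fits w1 Y 0"
    using assms(1) unfolding diagram_iff_fits fits_append by blast
  then have iw: "i \<le> w" and w1: "w1 = w" by auto
  let ?c = "loop_value A B" and ?u = "transfer X unit_vector"
  have "transfer [(Minimum, i), (Maximum, i)] ?u us = ?c * ?u us" if us: "us \<in> words w" for us
  proof -
    have "length (take i us) = i" using us iw by (simp add: words_def)
    from slice_op_Maximum[OF this, of "slice_op (Minimum, i) ?u" "drop i us"]
    show ?thesis
      using \<open>length (take i us) = i\<close>
      by (simp add: slice_op_Minimum M_values loop_value_def power2_eq_square move_simps del: length_take One_nat_def)
  qed
  then have "transfer Y (transfer [(Minimum, i), (Maximum, i)] ?u) [] = transfer Y (\<lambda>us. ?c * ?u us) []"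
    by (intro transfer_cong[OF w(3)]) (simp_all add: w1 words_0)
  also have "\<dots> = ?c * transfer Y ?u []"
  proof -
    have "slice_op s (\<lambda>us. ?c * v us) = (\<lambda>us. ?c * slice_op s v us)" for s v
    proof
      fix us
      show "slice_op s (\<lambda>us. ?c * v us) us = ?c * slice_op s v us"
        using slice_op_sum[where F = "{()}" and c = "\<lambda>_. ?c" and f = "\<lambda>_. v"] by simp
    qed
    then have "transfer Y (\<lambda>us. ?c * v us) = (\<lambda>us. ?c * transfer Y v us)" for v
      by (induction Y arbitrary: v) simp_all
    then show ?thesis by simp
  qed
  finally show ?thesis
    using Z_eq_transfer[OF assms(1)] Z_eq_transfer[OF assms(2)] by (simp only: fold_append comp_apply)
qed

end

text \<open>
  The exponent is the same for all values of the variables, which will be compared.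
\<close>
definition evaluates_to_loops :: "slice list \<Rightarrow> nat \<Rightarrow> bool" where
  "evaluates_to_loops K m \<longleftrightarrow>
     (\<forall>A B \<iota> :: complex. A * B = 1 \<longrightarrow> \<iota> * \<iota> = - 1 \<longrightarrow> Z A B \<iota> K = loop_value A B ^ m)"

lemma evaluates_to_loops_move:
  assumes "move K K' \<or> move K' K" "evaluates_to_loops K' m"
  shows "evaluates_to_loops K m"
  unfolding evaluates_to_loops_def
proof (intro allI impI)
  fix A B \<iota> :: complex assume *: "A * B = 1" "\<iota> * \<iota> = - 1"
  then interpret bracket_ring A B \<iota> by unfold_locales
  have "Z A B \<iota> K = Z A B \<iota> K'" using assms(1) Z_move by metis
  then show "Z A B \<iota> K = loop_value A B ^ m"
    using assms(2) * unfolding evaluates_to_loops_def by simp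
qed

lemma evaluates_to_loops_circle:
  assumes "diagram (X @ [(Minimum, i), (Maximum, i)] @ Y)" "diagram (X @ Y)" "evaluates_to_loops (X @ Y) m"
  shows "evaluates_to_loops (X @ [(Minimum, i), (Maximum, i)] @ Y) (Suc m)"
  unfolding evaluates_to_loops_def
proof (intro allI impI)
  fix A B \<iota> :: complex assume *: "A * B = 1" "\<iota> * \<iota> = - 1"
  then interpret bracket_ring A B \<iota> by unfold_locales
  show "Z A B \<iota> (X @ [(Minimum, i), (Maximum, i)] @ Y) = loop_value A B ^ Suc m"
    unfolding Z_circle[OF assms(1,2)] using assms(3) * unfolding evaluates_to_loops_def by simp
qed

lemma diagram_replace:
  assumes "diagram (X @ L @ Y)" "\<And>w w'. fits w L w' \<Longrightarrow> fits w L' w'"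
  shows "diagram (X @ L' @ Y)"
  using assms unfolding diagram_iff_fits fits_append by blast

text \<open>
  The first maximum has only minima below it. It is pushed down until the minimum just below it
  shares a strand with it; then the two form a circle or cancel, and the diagram gets shorter.
\<close>
lemma first_Maximum_evaluates:
  assumes shorter: "\<And>K. length K < N \<Longrightarrow> planar K \<Longrightarrow> diagram K \<Longrightarrow> \<exists>m. evaluates_to_loops K m"
    and "diagram (X @ (Maximum, i) # Y)" "length (X @ (Maximum, i) # Y) = N"
    and "\<forall>s\<in>set X. fst s = Minimum" "planar Y"
  shows "\<exists>m. evaluates_to_loops (X @ (Maximum, i) # Y) m"
  using assms(2-)
proof (induction X arbitrary: i Y rule: rev_induct)
  case Nil
  then show ?case by (simp add: diagram_iff_fits)
next
  case (snoc s X)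
  obtain j where s: "s = (Minimum, j)" using snoc.prems(3) by (cases s) auto
  let ?L = "[(Minimum, j), (Maximum, i)]"
  have eq: "(X @ [s]) @ (Maximum, i) # Y = X @ ?L @ Y" by (simp add: s)
  have d: "diagram (X @ ?L @ Y)" using snoc.prems(1) unfolding eq .
  have planarX: "planar X" using snoc.prems(3) by (auto simp: planar_def)
  have removed: "diagram (X @ Y)" if "\<And>w w'. fits w ?L w' \<Longrightarrow> fits w [] w'"
    using diagram_replace[OF d that] by simp
  have "length (X @ Y) < N" using snoc.prems(2) by simp
  then have shorter_XY: "\<exists>m. evaluates_to_loops (X @ Y) m" if "diagram (X @ Y)"
    using shorter[of "X @ Y"] planarX snoc.prems(4) that by simp
  have pushed: "\<exists>m. evaluates_to_loops (X @ [(Maximum, i'), (Minimum, j')] @ Y) m"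
    if "diagram (X @ [(Maximum, i'), (Minimum, j')] @ Y)" for i' j'
    using snoc.IH[of i' "(Minimum, j') # Y"] that snoc.prems(2-) by simp
  consider "i = j" | "i = j + 1" | "j = i + 1" | k where "i = j + 2 + k" | k where "j = i + 2 + k"
  proof -
    have "i = j \<or> i = j + 1 \<or> j = i + 1 \<or> j + 2 \<le> i \<or> i + 2 \<le> j" by linarith
    then show thesis using that by (auto dest!: le_Suc_ex)
  qed
  then show ?case
    unfolding eq
  proof cases
    case 1
    have dXY: "diagram (X @ Y)" by (rule removed) auto
    then show "\<exists>m. evaluates_to_loops (X @ ?L @ Y) m"
      using shorter_XY evaluates_to_loops_circle[of X i Y] d 1 by blast
  next
    case 2
    have dXY: "diagram (X @ [] @ Y)" using removed 2 by auto
    then have "move (X @ ?L @ Y) (X @ [] @ Y)"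
      using d unfolding 2 by (intro move.intros local_move.cancel_right)
    then show "\<exists>m. evaluates_to_loops (X @ ?L @ Y) m"
      using shorter_XY dXY evaluates_to_loops_move unfolding append_Nil by blast
  next
    case 3
    have dXY: "diagram (X @ [] @ Y)" using removed 3 by auto
    then have "move (X @ ?L @ Y) (X @ [] @ Y)"
      using d unfolding 3 by (intro move.intros local_move.cancel_left)
    then show "\<exists>m. evaluates_to_loops (X @ ?L @ Y) m"
      using shorter_XY dXY evaluates_to_loops_move unfolding append_Nil by blast
  next
    case (4 k)
    have d': "diagram (X @ [(Maximum, j + k), (Minimum, j)] @ Y)"
      by (rule diagram_replace[OF d]) (auto simp: 4)
    have "local_move ?L [(Maximum, j + k), (Minimum, j)]"
      using local_move.exchange[of Minimum j Maximum k] by (simp add: 4)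
    then have "move (X @ ?L @ Y) (X @ [(Maximum, j + k), (Minimum, j)] @ Y)"
      using d d' by (rule move.intros)
    then show "\<exists>m. evaluates_to_loops (X @ ?L @ Y) m"
      using pushed[OF d'] evaluates_to_loops_move by blast
  next
    case (5 k)
    have d': "diagram (X @ [(Maximum, i), (Minimum, i + k)] @ Y)"
      by (rule diagram_replace[OF d]) (auto simp: 5)
    have "local_move [(Maximum, i), (Minimum, i + k)] ?L"
      using local_move.exchange[of Maximum i Minimum k] by (simp add: 5)
    then have "move (X @ [(Maximum, i), (Minimum, i + k)] @ Y) (X @ ?L @ Y)"
      using d' d by (rule move.intros)
    then show "\<exists>m. evaluates_to_loops (X @ ?L @ Y) m"
      using pushed[OF d'] evaluates_to_loops_move by blast
  qed
qed

lemma fits_no_Maximum: "fits w K w' \<Longrightarrow> \<forall>s\<in>set K. fst s = Minimum \<Longrightarrow> w' = w + 2 * length K"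
proof (induction K arbitrary: w)
  case (Cons s K)
  then show ?case using Cons.IH[of "w + 2"] by (cases s) auto
qed simp

lemma planar_evaluates: "planar K \<Longrightarrow> diagram K \<Longrightarrow> \<exists>m. evaluates_to_loops K m"
proof (induction "length K" arbitrary: K rule: less_induct)
  case less
  show ?case
  proof (cases "\<exists>s\<in>set K. fst s = Maximum")
    case True
    then obtain X s Y where K: "K = X @ s # Y" "fst s = Maximum" "\<forall>s\<in>set X. fst s \<noteq> Maximum"
      by (elim split_list_first_propE)
    obtain i where s: "s = (Maximum, i)" using K(2) by (cases s) auto
    have "\<forall>s\<in>set X. fst s = Minimum" "planar Y" using less.prems(1) K by (auto simp: planar_def)
    then show ?thesis
      using first_Maximum_evaluates[of "length K" X i Y] less K(1) s by blast
  next
    case False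
    then have "\<forall>s\<in>set K. fst s = Minimum" using less.prems(1) by (auto simp: planar_def)
    then have "K = []" using fits_no_Maximum[of 0 K 0] less.prems(2) by (simp add: diagram_iff_fits)
    have "evaluates_to_loops K 0"
      unfolding evaluates_to_loops_def
    proof (intro allI impI)
      fix A B \<iota> :: complex assume *: "A * B = 1" "\<iota> * \<iota> = - 1"
      then interpret bracket_ring A B \<iota> by unfold_locales
      show "Z A B \<iota> K = loop_value A B ^ 0"
        using Z_eq_transfer[OF less.prems(2)] \<open>K = []\<close> by (simp add: unit_vector_def)
    qed
    then show ?thesis by blast
  qed
qed

lemma norm_curve_value: "norm (curve_value (A::complex) B r) = norm (A ^ (2 * r) + B ^ (2 * r))"
  by (simp add: curve_value_def norm_mult norm_power)

text \<open>
  By \<open>planar_evaluates\<close> and \<open>Z_eq_prod_curves\<close>, the product of \<open>A ^ (2 r) + A ^ (- 2 r)\<close> over the curves,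
  with \<open>r\<close> the rotation number, is up to sign the \<open>m\<close>-th power of \<open>A\<^sup>2 + A ^ (- 2)\<close>, for every complex
  \<open>A \<noteq> 0\<close>. The value \<open>A = 1\<close> shows that \<open>m\<close> is the number of curves. If \<open>r \<ge> 2\<close> for some curve, then the
  product vanishes at \<open>A = exp (\<i> pi / (4 r))\<close>, where \<open>A\<^sup>2 + A ^ (- 2) = 2 cos (pi / (2 r))\<close> does not.
  Finally, at \<open>A = 2\<close> a curve with \<open>r = 0\<close> would contribute the factor 2 instead of \<open>17/4\<close>.
\<close>
lemma rot_planar:
  assumes "planar K" "diagram K" "C \<in> curves K"
  shows "rot K C = 1"
proof -
  interpret link_diagram K by unfold_locales (rule assms(2))
  obtain m where m: "evaluates_to_loops K m" using planar_evaluates assms by blast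
  have fin: "finite (curves K)" by (rule finite_curves)
  have ident: "(\<Prod>C\<in>curves K. norm (A ^ (2 * rot K C) + B ^ (2 * rot K C))) = norm (A\<^sup>2 + B\<^sup>2) ^ m"
    if "A * B = 1" for A B :: complex
  proof -
    interpret virtual_evaluation A B \<i> K
      by unfold_locales (use that assms(1) in \<open>auto simp: planar_def is_classical_def\<close>)
    have "(\<Prod>C\<in>curves K. curve_value A B (rot K C)) = loop_value A B ^ m"
      using Z_eq_prod_curves m that unfolding evaluates_to_loops_def by simp
    then have "norm (\<Prod>C\<in>curves K. curve_value A B (rot K C)) = norm (- (A\<^sup>2 + B\<^sup>2)) ^ m"
      by (simp add: loop_value_def norm_power[symmetric])
    then show ?thesis by (simp only: prod_norm[symmetric] norm_curve_value norm_minus_cancel)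
  qed
  have m_eq: "m = card (curves K)"
    using ident[of 1 1] by simp
  have le: "rot K C \<le> 1" if C: "C \<in> curves K" for C
  proof (rule ccontr)
    assume "\<not> rot K C \<le> 1"
    define r where "r = rot K C"
    have r: "2 \<le> r" using \<open>\<not> rot K C \<le> 1\<close> by (simp add: r_def)
    define \<theta> where "\<theta> = pi / (4 * real r)"
    have "real (2 * r) * \<theta> = pi / 2" using r by (simp add: \<theta>_def)
    then have "cis \<theta> ^ (2 * r) = cis (pi / 2)" "cis (- \<theta>) ^ (2 * r) = cis (- (pi / 2))"
      by (simp_all only: Complex.DeMoivre mult_minus_right)
    then have "cis \<theta> ^ (2 * r) + cis (- \<theta>) ^ (2 * r) = 0"
      by (simp add: complex_eq_iff)
    then have "norm (cis \<theta> ^ (2 * r) + cis (- \<theta>) ^ (2 * r)) = 0" by (simp only: norm_zero)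
    then have "(\<Prod>C\<in>curves K. norm (cis \<theta> ^ (2 * rot K C) + cis (- \<theta>) ^ (2 * rot K C))) = 0"
      using C fin unfolding r_def by (intro prod_zero) blast+
    moreover have "cis \<theta> * cis (- \<theta>) = 1" by (simp add: cis_mult)
    ultimately have "(cis \<theta>)\<^sup>2 + (cis (- \<theta>))\<^sup>2 = 0"
      using ident[of "cis \<theta>" "cis (- \<theta>)"] by simp
    then have "cos (2 * \<theta>) = 0" by (simp add: Complex.DeMoivre complex_eq_iff)
    moreover have "0 < 2 * \<theta>" "2 * \<theta> < pi / 2"
      using r pi_gt_zero by (simp_all add: \<theta>_def field_simps)
    then have "0 < cos (2 * \<theta>)" by (intro cos_gt_zero)
    ultimately show False by simp
  qed
  define a where "a = card {C \<in> curves K. rot K C = 0}"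
  define b where "b = card {C \<in> curves K. rot K C \<noteq> 0}"
  have "card (curves K) = a + b"
    unfolding a_def b_def using fin by (subst card_Un_disjoint[symmetric]) (auto intro: arg_cong[where f = card])
  then have m_ab: "m = a + b" using m_eq by simp
  have "norm ((2::complex) ^ (2 * rot K C) + (1/2) ^ (2 * rot K C)) = (if rot K C = 0 then 2 else 17/4)"
    if "C \<in> curves K" for C
  proof -
    have "rot K C = 0 \<or> rot K C = 1" using le[OF that] by linarith
    then show ?thesis by (auto simp: power2_eq_square)
  qed
  then have "(\<Prod>C\<in>curves K. if rot K C = 0 then 2 else 17/4) =
      (\<Prod>C\<in>curves K. norm ((2::complex) ^ (2 * rot K C) + (1/2) ^ (2 * rot K C)))"
    by (intro prod.cong refl) (simp only:)
  also have "\<dots> = norm ((2::complex)\<^sup>2 + (1/2)\<^sup>2) ^ m" by (rule ident) simp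
  also have "norm ((2::complex)\<^sup>2 + (1/2)\<^sup>2) = 17/4" by (simp add: power2_eq_square)
  finally have left: "(\<Prod>C\<in>curves K. if rot K C = 0 then 2 else 17/4 :: real) = (17/4) ^ m" .
  have sets: "curves K \<inter> {C. rot K C = 0} = {C \<in> curves K. rot K C = 0}"
    "curves K \<inter> - {C. rot K C = 0} = {C \<in> curves K. rot K C \<noteq> 0}"
    by auto
  have "(\<Prod>C\<in>curves K. if rot K C = 0 then 2 else 17/4 :: real) = 2 ^ a * (17/4) ^ b"
    unfolding prod.If_cases[OF fin] sets prod_constant a_def b_def ..
  then have "(2::real) ^ a * (17/4) ^ b = (17/4) ^ a * (17/4) ^ b"
    using left unfolding m_ab power_add by (simp only:)
  moreover have "(17/4 :: real) ^ b \<noteq> 0" by (intro power_not_zero) simp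
  ultimately have eq: "(2::real) ^ a = (17/4) ^ a" by (simp only: mult_cancel_right simp_thms)
  have "a = 0"
  proof (rule ccontr)
    assume "a \<noteq> 0"
    then have "(2::real) ^ a < (17/4) ^ a" by (intro power_strict_mono) simp_all
    then show False unfolding eq by (rule less_irrefl[THEN notE])
  qed
  then have "{C \<in> curves K. rot K C = 0} = {}"
    unfolding a_def by (rule card_0_eq[THEN iffD1, rotated]) (use fin in simp)
  then have "C \<notin> {C \<in> curves K. rot K C = 0}" by (simp only: empty_iff not_False_eq_True)
  then have "rot K C \<noteq> 0" using assms(3) by (simp only: mem_Collect_eq simp_thms not_False_eq_True)
  then show ?thesis using le[OF assms(3)] by linarith
qed

lemma first_slice:
  assumes "diagram K" "K \<noteq> []"
  obtains i where "K ! 0 = (Minimum, i)"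
proof -
  obtain p i where pi: "K ! 0 = (p, i)" by force
  have "snd (K ! 0) + ins (fst (K ! 0)) \<le> width K 0" using assms unfolding diagram_def by blast
  then have "p = Minimum" by (cases p) (simp_all add: pi)
  then show thesis using that pi by blast
qed

lemma curves_nonempty:
  assumes "diagram K" "K \<noteq> []"
  shows "curves K \<noteq> {}"
proof -
  interpret link_diagram K by unfold_locales (rule assms(1))
  obtain i where "K ! 0 = (Minimum, i)" using first_slice[OF assms] .
  then have "(1, 0) \<in> points K" using assms(2) by (cases K) (auto simp: points_def)
  then have "((1, 0), True) \<in> darts" by simp
  then show ?thesis unfolding curves_eq by blast
qed

lemma smoothed_nonempty:
  assumes "diagram K" "K \<noteq> []"
  shows "smoothed K S \<noteq> []"
proof -
  obtain i where i: "K ! 0 = (Minimum, i)" using first_slice[OF assms] .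
  then have "(Minimum, i) \<in> set (smoothed K S)"
    using assms(2) by (auto simp: smoothed_def intro!: bexI[of _ 0])
  then show ?thesis by auto
qed

lemma smooth_not_Virtual: "s' \<in> set (smooth a s) \<Longrightarrow> fst s \<noteq> Virtual \<Longrightarrow> fst s' \<noteq> Virtual"
  by (cases "(a, s)" rule: smooth.cases) (auto split: if_splits)

lemma planar_smoothed:
  assumes "classical_diagram K"
  shows "planar (smoothed K S)"
  unfolding planar_def
proof
  fix s assume s: "s \<in> set (smoothed K S)"
  then obtain n where n: "n < length K" "s \<in> set (smooth (n \<in> S) (K ! n))"
    by (auto simp: smoothed_def)
  have "fst (K ! n) \<noteq> Virtual" using assms nth_mem[OF n(1)] unfolding classical_diagram_def by (metis imageI)
  then have "fst s \<noteq> Virtual" by (rule smooth_not_Virtual[OF n(2)])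
  then show "fst s = Maximum \<or> fst s = Minimum"
    using smoothed_no_classical[OF s] by (cases "fst s") (auto simp: is_classical_def)
qed

lemma (in bracket_ring) Z_eq_bracket:
  assumes "classical_diagram K" "K \<noteq> []"
  shows "Z A B \<iota> K = loop_value A B * bracket A B K"
proof -
  have d: "diagram K" using assms(1) by (simp add: classical_diagram_def)
  have "(\<Prod>C\<in>curves (smoothed K S). curve_value A B (rot (smoothed K S) C)) =
      loop_value A B * loop_value A B ^ (card (curves (smoothed K S)) - 1)" for S
  proof -
    let ?K = "smoothed K S"
    have dS: "diagram ?K" by (rule diagram_smoothed[OF d])
    interpret link_diagram ?K by unfold_locales (rule dS)
    have "0 < card (curves ?K)"
      using curves_nonempty[OF dS smoothed_nonempty[OF d assms(2)]] finite_curves by (simp add: card_gt_0_iff)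
    then obtain n where n: "card (curves ?K) = Suc n" by (cases "card (curves ?K)") auto
    have "(\<Prod>C\<in>curves ?K. curve_value A B (rot ?K C)) = (\<Prod>C\<in>curves ?K. loop_value A B)"
      using rot_planar[OF planar_smoothed[OF assms(1)] dS]
      by (intro prod.cong) (simp_all add: curve_value_def loop_value_def)
    then show ?thesis by (simp add: n)
  qed
  then show ?thesis
    unfolding Z_eq_rotational_state_sum[OF d] rotational_state_sum_def bracket_def
    by (simp add: sum_distrib_left mult.left_commute)
qed

section \<open>The state sum formula\<close>

theorem mainTheorem2:
  fixes A B \<iota> :: "'a::comm_ring_1"
  assumes "A * B = 1" and "\<iota> * \<iota> = -1"
  shows "(\<forall>K K'. diagram K \<and> virtual_regular_isotopic K K' \<longrightarrow> Z A B \<iota> K = Z A B \<iota> K')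
    \<and> (\<forall>K. diagram K \<longrightarrow> Z A B \<iota> K = rotational_state_sum A B K)
    \<and> (\<forall>K. classical_diagram K \<and> K \<noteq> [] \<longrightarrow> Z A B \<iota> K = loop_value A B * bracket A B K)"
proof -
  interpret bracket_ring A B \<iota> by unfold_locales (fact assms)+
  show ?thesis
  proof (intro conjI allI impI)
    fix K K' assume "diagram K \<and> virtual_regular_isotopic K K'"
    then show "Z A B \<iota> K = Z A B \<iota> K'" by (elim conjE) (rule Z_invariant)
  next
    fix K assume "diagram K"
    then show "Z A B \<iota> K = rotational_state_sum A B K" by (rule Z_eq_rotational_state_sum)
  next
    fix K assume "classical_diagram K \<and> K \<noteq> []"
    then show "Z A B \<iota> K = loop_value A B * bracket A B K" by (elim conjE) (rule Z_eq_bracket)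
  qed
qed

end
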